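(* Let $G$ be a countably infinite abelian group and $(F_n)_{n=1}^\infty$ a F\o lner sequence in $G$. Let $a_1,\dots,a_\ell:G\rightarrow G$ be mappings such that for every $h\in G\setminus\{e_G\}$ the collection of $2\ell$ mappings $A(h):=\{a_i(\cdot)\}_{i=1}^\ell\cup\{a_i(\cdot+h)\}_{i=1}^\ell$ is jointly ergodic along $(F_n)_{n=1}^\infty$. Let $(X,\mathscr{B},\nu)$ be a standard probability space and let $(T_g)_{g\in G}$, $(S_g)_{g\in G}$ be (not necessarily commuting) measure preserving actions of $G$ on $X$ such that $(T_g)_{g\in G}$ has singular spectrum and $(S_g)_{g\in G}$ is ergodic. Then for any $f_0,f_1,\dots,f_\ell\in L^\infty(X,\nu)$, $$\lim_{N\rightarrow\infty}\frac{1}{|F_N|}\sum_{g\in F_N}T_gf_0\,S_{a_1(g)}f_1\,S_{a_2(g)}f_2\cdots S_{a_\ell(g)}f_\ell=\mathbb{E}[f_0|\mathcal{I}_T]\prod_{j=1}^\ell\int_Xf_j\,d\nu,$$ with convergence in $L^2(X,\nu)$. Furthermore, if each $A(h)$, $h\in G\setminus\{e_G\}$, is only assumed to be jointly ergodic along $(F_n)_{n=1}^\infty$ for totally ergodic systems, then the same conclusion holds whenever $(S_g)_{g\in G}$ is totally ergodic (and $(T_g)_{g\in G}$ has singular spectrum).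
   Context: Groups are discrete; $e_G$ is the identity. A F\o lner sequence in a countable abelian group $G$ is a sequence of finite sets $F_n\subseteq G$ with $\lim_n|F_n\triangle(F_n+g)|/|F_n|=0$ for all $g\in G$. A measure preserving $G$-system $(X,\mathscr{B},\nu,(T_g)_{g\in G})$ is a standard probability space with invertible bi-measurable measure preserving maps $T_g$ satisfying $T_{e_G}=\mathrm{Id}$ and $T_gT_h=T_{gh}$. The induced unitary representation on $L^2(X,\nu)$ is also denoted by $T_g$: $T_gf=f\circ T_g^{-1}$. The action is ergodic if every $A\in\mathscr{B}$ with $\nu(A\triangle T_gA)=0$ for all $g\in G$ has $\nu(A)\in\{0,1\}$. It is totally ergodic if for every finite index subgroup $H\le G$ the action $(T_g)_{g\in H}$ is ergodic. $\mathcal{I}_T$ is the $\sigma$-algebra of $T$-invariant sets and $\mathbb{E}[\cdot|\mathcal{I}_T]:L^2(X,\mathscr{B},\nu)\to L^2(X,\mathcal{I}_T,\nu)$ is the orthogonal projection. Singular spectrum (abelian $G$): for $f\in L^2(X,\nu)$ let $\nu_{T,f}$ be the finite positive measure on the Pontryagin dual $\widehat G$ with $\langle T_gf,f\rangle=\int_{\widehat G}\chi(g)\,d\nu_{T,f}(\chi)$ for all $g\in G$. The maximal spectral type $[\mu_T]$ is the (minimal) measure class on $\widehat G$ such that $\nu_{T,f}\ll\mu_T$ for all $f\in L^2(X,\nu)$ with $\int_Xf\,d\nu=0$. $T$ has singular spectrum if $\mu_T$ is mutually singular with Haar measure on $\widehat G$. Joint ergodicity: a collection of mappings $b_1,\dots,b_m:G\to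 G$ is jointly ergodic along $(F_n)$ for a $G$-system $(Y,\mathscr{C},\rho,(R_g)_{g\in G})$ if for all $f_1,\dots,f_m\in L^\infty(Y,\rho)$, $\lim_N\frac1{|F_N|}\sum_{g\in F_N}R_{b_1(g)}f_1\cdots R_{b_m(g)}f_m=\prod_{j=1}^m\int_Yf_j\,d\rho$ in $L^2(Y,\rho)$. It is jointly ergodic along $(F_n)$ if this holds for every ergodic $G$-system, and jointly ergodic along $(F_n)$ for totally ergodic systems if it holds for every totally ergodic $G$-system. *)

theory Defs
  imports "HOL-Probability.Probability"
begin

text \<open>The discrete abelian group \<open>G\<close> is a type \<open>'g :: ab_group_add\<close>, written additively.\<close>

definition folner_sequence :: "(nat \<Rightarrow> 'g::ab_group_add set) \<Rightarrow> bool" where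
  "folner_sequence F \<longleftrightarrow>
     (\<forall>n. finite (F n) \<and> F n \<noteq> {}) \<and>
     (\<forall>g. (\<lambda>n. real (card (sym_diff (F n) ((\<lambda>x. x + g) ` F n))) / real (card (F n)))
            \<longlonglongrightarrow> 0)"

definition finite_index_subgroup :: "'g::ab_group_add set \<Rightarrow> bool" where
  "finite_index_subgroup H \<longleftrightarrow>
     0 \<in> H \<and> (\<forall>g\<in>H. \<forall>h\<in>H. g + h \<in> H) \<and> (\<forall>g\<in>H. - g \<in> H) \<and>
     finite (range (\<lambda>g. (\<lambda>h. g + h) ` H))"

definition characters :: "('g::ab_group_add \<Rightarrow> complex) set" where
  "characters = {\<omega>. (\<forall>g. cmod (\<omega> g) = 1) \<and> (\<forall>g h. \<omega> (g + h) = \<omega> g * \<omega> h)}"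

text \<open>
  The Pontryagin dual as a measurable space. As \<open>'g\<close> is discrete, the topology of the dual
  (uniform convergence on compact sets) is that of pointwise convergence, which is the topology
  of the function type \<open>'g \<Rightarrow> complex\<close>. Only the space and the measurable sets of
  \<open>dual_space\<close> matter, not its measure.
\<close>

definition dual_space :: "('g::ab_group_add \<Rightarrow> complex) measure" where
  "dual_space = restrict_space borel characters"

text \<open>
  For countable \<open>'g\<close> the dual is compact and metrizable, so that regularity of Haar measure is
  automatic; it is normalised to have total mass one, which makes it unique.
\<close>

definition haar_measure_dual :: "('g::ab_group_add \<Rightarrow> complex) measure \<Rightarrow> bool" where
  "haar_measure_dual m \<longleftrightarrow>
     sets m = sets dual_space \<and> prob_space m \<and>
     (\<forall>\<psi>\<in>characters. distr m m (\<lambda>\<omega> g. \<psi> g * \<omega> g) = m)"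

definition mutually_singular :: "'a measure \<Rightarrow> 'a measure \<Rightarrow> bool" where
  "mutually_singular M N \<longleftrightarrow>
     sets M = sets N \<and>
     (\<exists>A\<in>sets M. emeasure M A = 0 \<and> emeasure N (space N - A) = 0)"

definition L2_fun :: "'x measure \<Rightarrow> ('x \<Rightarrow> complex) \<Rightarrow> bool" where
  "L2_fun M f \<longleftrightarrow> f \<in> borel_measurable M \<and> integrable M (\<lambda>x. (cmod (f x))\<^sup>2)"

definition Linf_fun :: "'x measure \<Rightarrow> ('x \<Rightarrow> complex) \<Rightarrow> bool" where
  "Linf_fun M f \<longleftrightarrow> f \<in> borel_measurable M \<and> (\<exists>C. AE x in M. cmod (f x) \<le> C)"

definition L2_tendsto ::
  "'x measure \<Rightarrow> (nat \<Rightarrow> 'x \<Rightarrow> complex) \<Rightarrow> ('x \<Rightarrow> complex) \<Rightarrow> bool" where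
  "L2_tendsto M u v \<longleftrightarrow>
     (\<lambda>n. \<integral>\<^sup>+x. ennreal ((cmod (u n x - v x))\<^sup>2) \<partial>M) \<longlonglongrightarrow> 0"

definition complex_cond_exp ::
  "'x measure \<Rightarrow> 'x measure \<Rightarrow> ('x \<Rightarrow> complex) \<Rightarrow> 'x \<Rightarrow> complex" where
  "complex_cond_exp M \<A> f x =
     Complex (real_cond_exp M \<A> (\<lambda>y. Re (f y)) x) (real_cond_exp M \<A> (\<lambda>y. Im (f y)) x)"

text \<open>On \<open>L\<^sup>2\<close> this is the orthogonal projection onto the \<open>\<A>\<close>-measurable functions:\<close>

lemma complex_cond_exp_orthogonal_projection:
  fixes f :: "'x \<Rightarrow> complex"
  assumes M: "prob_space M" and sub: "subalgebra M \<A>" and f: "L2_fun M f"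
  shows "complex_cond_exp M \<A> f \<in> borel_measurable \<A>"
    and "L2_fun M (complex_cond_exp M \<A> f)"
    and "\<And>h. L2_fun M h \<Longrightarrow> h \<in> borel_measurable \<A> \<Longrightarrow>
           (\<integral>x. (f x - complex_cond_exp M \<A> f x) * cnj (h x) \<partial>M) = 0"
proof -
  interpret prob_space M by (rule M)
  interpret finite_measure_subalgebra M \<A>
    by unfold_locales (rule sub)
  let ?E = "real_cond_exp M \<A>"
  let ?P = "complex_cond_exp M \<A> f"
  have fm [measurable]: "f \<in> borel_measurable M"
    and f2: "integrable M (\<lambda>x. (cmod (f x))\<^sup>2)"
    using f by (auto simp: L2_fun_def)
  have prodI: "integrable M (\<lambda>x. a x * b x)"
    if "integrable M (\<lambda>x. (a x)\<^sup>2)" "integrable M (\<lambda>x. (b x)\<^sup>2)"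
      "a \<in> borel_measurable M" "b \<in> borel_measurable M" for a b :: "'x \<Rightarrow> real"
  proof (rule Bochner_Integration.integrable_bound[where f = "\<lambda>x. (a x)\<^sup>2 + (b x)\<^sup>2"])
    show "AE x in M. norm (a x * b x) \<le> norm ((a x)\<^sup>2 + (b x)\<^sup>2)"
    proof (rule AE_I2)
      fix x
      have "2 * (\<bar>a x\<bar> * \<bar>b x\<bar>) \<le> (a x)\<^sup>2 + (b x)\<^sup>2"
        using sum_squares_bound[of "\<bar>a x\<bar>" "\<bar>b x\<bar>"] by (simp add: mult.assoc)
      moreover have "0 \<le> \<bar>a x\<bar> * \<bar>b x\<bar>" by simp
      ultimately have "\<bar>a x\<bar> * \<bar>b x\<bar> \<le> (a x)\<^sup>2 + (b x)\<^sup>2" by linarith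
      then show "norm (a x * b x) \<le> norm ((a x)\<^sup>2 + (b x)\<^sup>2)"
        by (simp add: abs_mult)
    qed
  qed (use that in auto)
  have sqI: "integrable M (\<lambda>x. (a x)\<^sup>2)"
    if "integrable M (\<lambda>x. (cmod (k x))\<^sup>2)" "a \<in> borel_measurable M"
      "\<And>x. \<bar>a x\<bar> \<le> cmod (k x)" for a :: "'x \<Rightarrow> real" and k
  proof (rule Bochner_Integration.integrable_bound[OF that(1)])
    have "(a x)\<^sup>2 \<le> (cmod (k x))\<^sup>2" for x
      using that(3)[of x] by (simp add: abs_le_square_iff[symmetric])
    then show "AE x in M. norm ((a x)\<^sup>2) \<le> norm ((cmod (k x))\<^sup>2)" by simp
  qed (use that(2) in measurable)
  have L1: "integrable M a" if "integrable M (\<lambda>x. (a x)\<^sup>2)" "a \<in> borel_measurable M"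
    for a :: "'x \<Rightarrow> real"
    using prodI[of a "\<lambda>_. 1"] that by simp
  have Esq: "integrable M (\<lambda>x. (?E a x)\<^sup>2)"
    if "integrable M (\<lambda>x. (a x)\<^sup>2)" "a \<in> borel_measurable M" for a :: "'x \<Rightarrow> real"
    by (rule integrable_convex_cond_exp[where I = UNIV])
       (use that L1[OF that] in \<open>auto intro: convex_power2\<close>)
  define u v where "u = (\<lambda>x. Re (f x))" and "v = (\<lambda>x. Im (f x))"
  have um [measurable]: "u \<in> borel_measurable M" and vm [measurable]: "v \<in> borel_measurable M"
    by (simp_all add: u_def v_def)
  have u2: "integrable M (\<lambda>x. (u x)\<^sup>2)" and v2: "integrable M (\<lambda>x. (v x)\<^sup>2)"
    by (rule sqI[OF f2]; simp add: u_def v_def abs_Re_le_cmod abs_Im_le_cmod)+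
  have P: "?P = (\<lambda>x. Complex (?E u x) (?E v x))"
    by (simp add: complex_cond_exp_def fun_eq_iff u_def v_def)
  have P': "?P = (\<lambda>x. complex_of_real (?E u x) + \<i> * complex_of_real (?E v x))"
    by (simp add: P fun_eq_iff complex_eq_iff)
  show Pm: "?P \<in> borel_measurable \<A>"
    unfolding P' by (intro borel_measurable_add borel_measurable_times borel_measurable_const
      measurable_compose[OF borel_measurable_cond_exp borel_measurable_of_real])
  have PmM: "?P \<in> borel_measurable M"
    by (rule measurable_from_subalg[OF sub Pm])
  have P2: "(\<lambda>x. (cmod (?P x))\<^sup>2) = (\<lambda>x. (?E u x)\<^sup>2 + (?E v x)\<^sup>2)"
    by (simp add: P cmod_power2)
  show "L2_fun M ?P"
    unfolding L2_fun_def P2 using PmM Esq[OF u2 um] Esq[OF v2 vm] by auto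
  fix h assume hL: "L2_fun M h" and hm: "h \<in> borel_measurable \<A>"
  have hM [measurable]: "h \<in> borel_measurable M"
    and h2: "integrable M (\<lambda>x. (cmod (h x))\<^sup>2)"
    using hL by (auto simp: L2_fun_def)
  have key: "integrable M (\<lambda>x. k x * (a x - ?E a x)) \<and> (\<integral>x. k x * (a x - ?E a x) \<partial>M) = 0"
    if a: "integrable M (\<lambda>x. (a x)\<^sup>2)" "a \<in> borel_measurable M"
      and k: "integrable M (\<lambda>x. (k x)\<^sup>2)" "k \<in> borel_measurable \<A>"
    for a k :: "'x \<Rightarrow> real"
  proof -
    have kM: "k \<in> borel_measurable M" by (rule measurable_from_subalg[OF sub k(2)])
    have i1: "integrable M (\<lambda>x. k x * a x)" by (rule prodI[OF k(1) a(1) kM a(2)])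
    have i2: "integrable M (\<lambda>x. k x * ?E a x)"
      and e: "(\<integral>x. k x * ?E a x \<partial>M) = (\<integral>x. k x * a x \<partial>M)"
      using real_cond_exp_intg[OF i1 k(2) a(2)] by auto
    show ?thesis using i1 i2 e by (simp add: right_diff_distrib)
  qed
  define p q where "p = (\<lambda>x. Re (h x))" and "q = (\<lambda>x. Im (h x))"
  have pm: "p \<in> borel_measurable \<A>" and qm: "q \<in> borel_measurable \<A>"
    using hm by (simp_all add: p_def q_def)
  have p2: "integrable M (\<lambda>x. (p x)\<^sup>2)" and q2: "integrable M (\<lambda>x. (q x)\<^sup>2)"
    by (rule sqI[OF h2]; simp add: p_def q_def abs_Re_le_cmod abs_Im_le_cmod)+
  note K = key[OF u2 um p2 pm] key[OF u2 um q2 qm] key[OF v2 vm p2 pm] key[OF v2 vm q2 qm]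
  have eq: "(f x - ?P x) * cnj (h x) =
      complex_of_real (p x * (u x - ?E u x) + q x * (v x - ?E v x)) +
      \<i> * complex_of_real (p x * (v x - ?E v x) - q x * (u x - ?E u x))" for x
    by (simp add: P complex_eq_iff p_def q_def u_def v_def algebra_simps)
  show "(\<integral>x. (f x - ?P x) * cnj (h x) \<partial>M) = 0"
  proof -
    define A B where "A = (\<lambda>x. p x * (u x - ?E u x) + q x * (v x - ?E v x))"
      and "B = (\<lambda>x. p x * (v x - ?E v x) - q x * (u x - ?E u x))"
    have A: "integrable M A" "(\<integral>x. A x \<partial>M) = 0" and B: "integrable M B" "(\<integral>x. B x \<partial>M) = 0"
      unfolding A_def B_def using K by simp_all
    have "(\<integral>x. complex_of_real (A x) + \<i> * complex_of_real (B x) \<partial>M) =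
        (\<integral>x. complex_of_real (A x) \<partial>M) + (\<integral>x. \<i> * complex_of_real (B x) \<partial>M)"
      by (rule Bochner_Integration.integral_add) (use A(1) B(1) in simp_all)
    also have "\<dots> = 0" using A B by simp
    finally show ?thesis unfolding eq A_def B_def .
  qed
qed

text \<open>A standard measurable space is the Borel space of some Polish topology on its underlying set.\<close>

definition standard_probability_space :: "'x measure \<Rightarrow> bool" where
  "standard_probability_space M \<longleftrightarrow>
     prob_space M \<and>
     (\<exists>X. completely_metrizable_space X \<and> second_countable X \<and> topspace X = space M \<and>
          sets M = sigma_sets (space M) {U. openin X U})"

text \<open>
  Invertibility and bi-measurability of \<open>T g\<close> are not listed separately: the inverse of \<open>T g\<close> on
  the space is \<open>T (- g)\<close>, which is measurable as well.
\<close>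

definition mp_system :: "'x measure \<Rightarrow> ('g::ab_group_add \<Rightarrow> 'x \<Rightarrow> 'x) \<Rightarrow> bool" where
  "mp_system M T \<longleftrightarrow>
     standard_probability_space M \<and>
     (\<forall>g. T g \<in> measurable M M \<and> distr M M (T g) = M) \<and>
     (\<forall>x\<in>space M. T 0 x = x) \<and>
     (\<forall>g h. \<forall>x\<in>space M. T (g + h) x = T g (T h x))"

text \<open>\<open>T\<^sub>g f = f \<circ> T\<^sub>g\<^sup>-\<^sup>1\<close>, with \<open>T\<^sub>g\<^sup>-\<^sup>1 = T (- g)\<close>.\<close>

definition koopman ::
  "('g::ab_group_add \<Rightarrow> 'x \<Rightarrow> 'x) \<Rightarrow> 'g \<Rightarrow> ('x \<Rightarrow> complex) \<Rightarrow> 'x \<Rightarrow> complex" where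
  "koopman T g f = (\<lambda>x. f (T (- g) x))"

definition invariant_sets ::
  "'x measure \<Rightarrow> 'g set \<Rightarrow> ('g \<Rightarrow> 'x \<Rightarrow> 'x) \<Rightarrow> 'x set set" where
  "invariant_sets M H T = {A \<in> sets M. \<forall>g\<in>H. measure M (sym_diff A (T g ` A)) = 0}"

definition ergodic_on :: "'x measure \<Rightarrow> 'g set \<Rightarrow> ('g \<Rightarrow> 'x \<Rightarrow> 'x) \<Rightarrow> bool" where
  "ergodic_on M H T \<longleftrightarrow> (\<forall>A\<in>invariant_sets M H T. measure M A \<in> {0, 1})"

definition ergodic :: "'x measure \<Rightarrow> ('g \<Rightarrow> 'x \<Rightarrow> 'x) \<Rightarrow> bool" where
  "ergodic M T \<longleftrightarrow> ergodic_on M UNIV T"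

definition totally_ergodic ::
  "'x measure \<Rightarrow> ('g::ab_group_add \<Rightarrow> 'x \<Rightarrow> 'x) \<Rightarrow> bool" where
  "totally_ergodic M T \<longleftrightarrow> (\<forall>H. finite_index_subgroup H \<longrightarrow> ergodic_on M H T)"

definition invariant_algebra :: "'x measure \<Rightarrow> ('g \<Rightarrow> 'x \<Rightarrow> 'x) \<Rightarrow> 'x measure" where
  "invariant_algebra M T = sigma (space M) (invariant_sets M UNIV T)"

definition spectral_measure ::
  "'x measure \<Rightarrow> ('g::ab_group_add \<Rightarrow> 'x \<Rightarrow> 'x) \<Rightarrow> ('x \<Rightarrow> complex) \<Rightarrow>
   ('g \<Rightarrow> complex) measure \<Rightarrow> bool" where
  "spectral_measure M T f \<sigma> \<longleftrightarrow>
     sets \<sigma> = sets dual_space \<and> finite_measure \<sigma> \<and>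
     (\<forall>g. (\<integral>x. koopman T g f x * cnj (f x) \<partial>M) = (\<integral>\<omega>. \<omega> g \<partial>\<sigma>))"

text \<open>
  By the Bochner-Herglotz theorem every \<open>f\<close> in \<open>L\<^sup>2\<close> has exactly one spectral measure, so
  the existential quantifier over \<open>\<sigma>\<close> merely names it. \<^const>\<open>absolutely_continuous\<close> takes
  the dominating measure first.
\<close>

definition dominates_spectrum ::
  "'x measure \<Rightarrow> ('g::ab_group_add \<Rightarrow> 'x \<Rightarrow> 'x) \<Rightarrow> ('g \<Rightarrow> complex) measure \<Rightarrow> bool" where
  "dominates_spectrum M T \<mu> \<longleftrightarrow>
     sets \<mu> = sets dual_space \<and> finite_measure \<mu> \<and>
     (\<forall>f. L2_fun M f \<and> (\<integral>x. f x \<partial>M) = 0 \<longrightarrow>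
        (\<exists>\<sigma>. spectral_measure M T f \<sigma> \<and> absolutely_continuous \<mu> \<sigma>))"

text \<open>\<open>\<mu>\<close> is a representative of the class; it is unique up to mutual absolute continuity.\<close>

definition maximal_spectral_type ::
  "'x measure \<Rightarrow> ('g::ab_group_add \<Rightarrow> 'x \<Rightarrow> 'x) \<Rightarrow> ('g \<Rightarrow> complex) measure \<Rightarrow> bool" where
  "maximal_spectral_type M T \<mu> \<longleftrightarrow>
     dominates_spectrum M T \<mu> \<and>
     (\<forall>\<mu>'. dominates_spectrum M T \<mu>' \<longrightarrow> absolutely_continuous \<mu>' \<mu>)"

definition singular_spectrum ::
  "'x measure \<Rightarrow> ('g::ab_group_add \<Rightarrow> 'x \<Rightarrow> 'x) \<Rightarrow> bool" where
  "singular_spectrum M T \<longleftrightarrow>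
     (\<exists>\<mu> m. maximal_spectral_type M T \<mu> \<and> haar_measure_dual m \<and> mutually_singular \<mu> m)"

text \<open>The mappings are \<open>b 1, \<dots>, b m\<close>; other values of \<open>b\<close> are irrelevant.\<close>

definition jointly_ergodic_for ::
  "(nat \<Rightarrow> 'g set) \<Rightarrow> nat \<Rightarrow> (nat \<Rightarrow> 'g \<Rightarrow> 'g) \<Rightarrow>
   'y measure \<Rightarrow> ('g::ab_group_add \<Rightarrow> 'y \<Rightarrow> 'y) \<Rightarrow> bool" where
  "jointly_ergodic_for F m b N R \<longleftrightarrow>
     (\<forall>f. (\<forall>j\<in>{1..m}. Linf_fun N (f j)) \<longrightarrow>
        L2_tendsto N
          (\<lambda>n y. (\<Sum>g\<in>F n. \<Prod>j=1..m. koopman R (b j g) (f j) y) / of_nat (card (F n)))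
          (\<lambda>y. \<Prod>j=1..m. \<integral>z. f j z \<partial>N))"

text \<open>
  A formula cannot quantify over all types, so the two definitions below let the systems range over
  spaces whose underlying set is an arbitrary set of reals. The measurable structure is not tied to
  the usual topology of the reals. As a Polish space has at most the cardinality of the continuum,
  every system on a standard probability space is isomorphic to one of this form.
\<close>

definition jointly_ergodic ::
  "(nat \<Rightarrow> 'g::ab_group_add set) \<Rightarrow> nat \<Rightarrow> (nat \<Rightarrow> 'g \<Rightarrow> 'g) \<Rightarrow> bool" where
  "jointly_ergodic F m b \<longleftrightarrow>
     (\<forall>(N :: real measure) R. mp_system N R \<and> ergodic N R \<longrightarrow> jointly_ergodic_for F m b N R)"

definition jointly_ergodic_totally ::
  "(nat \<Rightarrow> 'g::ab_group_add set) \<Rightarrow> nat \<Rightarrow> (nat \<Rightarrow> 'g \<Rightarrow> 'g) \<Rightarrow> bool" where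
  "jointly_ergodic_totally F m b \<longleftrightarrow>
     (\<forall>(N :: real measure) R. mp_system N R \<and> totally_ergodic N R \<longrightarrow>
        jointly_ergodic_for F m b N R)"

text \<open>
  The \<open>2l\<close> mappings of \<open>A(h)\<close>, with \<open>a\<^sub>i(\<cdot> + h)\<close> at index \<open>l + i\<close>. It is treated as an indexed
  family: coinciding mappings are not merged.
\<close>

definition shifted_family ::
  "nat \<Rightarrow> (nat \<Rightarrow> 'g::ab_group_add \<Rightarrow> 'g) \<Rightarrow> 'g \<Rightarrow> nat \<Rightarrow> 'g \<Rightarrow> 'g" where
  "shifted_family l a h j = (if j \<le> l then a j else (\<lambda>g. a (j - l) (g + h)))"

end

theory Submission
  imports Defs
begin

text \<open>
  Put \<open>v g = (\<Prod>j. S\<^bsub>a j g\<^esub> f\<^sub>j) - (\<Prod>j. \<integral> f\<^sub>j)\<close>. Joint ergodicity of the families \<open>A(h)\<close> says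
  that the averages of \<open>\<langle>v g, v (g + h)\<rangle>\<close> tend to zero for every nonzero \<open>h\<close>. For \<open>f\<close> of mean zero
  the spectral measure \<open>\<sigma>\<close> of \<open>f\<close> is singular to Haar measure, so there is a trigonometric
  polynomial \<open>P = \<Sum>h. p h \<cdot> h\<close> that is close to \<open>1\<close> in \<open>L\<^sup>2(\<sigma>)\<close> and close to \<open>0\<close> in \<open>L\<^sup>2\<close> of Haar
  measure, i.e. \<open>f\<close> is close to \<open>\<Sum>h. p h T\<^sub>h f\<close> while \<open>\<Sum>h. \<bar>p h\<bar>\<^sup>2\<close> is small. Up to small errors and a
  shift of the Folner sequence, the average of \<open>T\<^sub>g f \<cdot> v g\<close> is that of \<open>T\<^sub>g f \<cdot> (\<Sum>h. p h v (g - h))\<close>.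
  The vectors \<open>v (g - h)\<close> are orthogonal on average, so the mean square of the second factor is
  about \<open>\<Sum>h. \<bar>p h\<bar>\<^sup>2 \<parallel>v\<parallel>\<^sup>2\<close>, which is small. What remains is the mean ergodic theorem for \<open>T\<close>.
\<close>

section \<open>Characters of a discrete abelian group\<close>

text \<open>\<open>T\<close> and \<open>S\<close> need not commute, so no correlation mixing them is
  ever computed. \<open>T\<close> enters through the spectral measure of a single function, the
  \<open>S\<close>-product through the correlations of \<open>v\<close>, and the two meet only in
  pointwise bounds on \<open>f\<close> and \<open>v\<close>. Hence all functions are first replaced
  by versions bounded at every point. A translate of \<open>f\<close> by \<open>h\<close> becomes a
  shift of the index of \<open>v\<close> by reindexing the average, which costs no more than a
  Folner defect. Spectral measures are not constructed: singular spectrum already asserts one for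
  each mean-zero function, and the mean ergodic theorem is drawn from the same source. Haar measure
  on the dual is given only by its invariance. To see that distinct group elements are orthogonal in
  its \<open>L\<^sup>2\<close>, which is what turns a small norm of \<open>P\<close> into a small
  sum of squared coefficients, one needs for every \<open>h \<noteq> 0\<close> a character that is
  not \<open>1\<close> at \<open>h\<close>; this is why characters are extended from
  subgroups.\<close>

lemma sum_const_add:
  fixes m n :: nat
  shows "(\<Sum>i<m + n. x) = (\<Sum>i<m. x) + (\<Sum>i<n. (x::'g::ab_group_add))"
  by (induction n) (auto simp: ac_simps)

text \<open>Graphs of unit-modulus characters defined on a subgroup.\<close>

definition partial_character :: "('g::ab_group_add \<times> complex) set \<Rightarrow> bool" where
  "partial_character R \<longleftrightarrow>
     (0, 1) \<in> R \<and> (\<forall>a z b w. (a, z) \<in> R \<and> (b, w) \<in> R \<longrightarrow> (a + b, z * w) \<in> R) \<and>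
     (\<forall>a z. (a, z) \<in> R \<longrightarrow> (- a, inverse z) \<in> R \<and> cmod z = 1) \<and>
     (\<forall>z. (0, z) \<in> R \<longrightarrow> z = 1)"

lemma partial_character_singleton: "partial_character {(0, 1)}"
  by (auto simp: partial_character_def)

lemma partial_characterD:
  assumes "partial_character R"
  shows "(0, 1) \<in> R" "(a, z) \<in> R \<Longrightarrow> (b, w) \<in> R \<Longrightarrow> (a + b, z * w) \<in> R"
    "(a, z) \<in> R \<Longrightarrow> (- a, inverse z) \<in> R" "(a, z) \<in> R \<Longrightarrow> cmod z = 1" "(0, z) \<in> R \<Longrightarrow> z = 1"
  using assms unfolding partial_character_def by blast+

lemma partial_character_unique:
  assumes R: "partial_character R" and "(a, z) \<in> R" "(a, w) \<in> R"
  shows "z = w"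
proof -
  have "(a + - a, z * inverse w) \<in> R"
    using partial_characterD[OF R] assms by blast
  then have "z * inverse w = 1" using partial_characterD(5)[OF R] by simp
  moreover have "w \<noteq> 0" using partial_characterD(4)[OF R assms(3)] by auto
  ultimately show ?thesis by (simp add: field_simps)
qed

text \<open>The elements of the subgroup generated by the old domain and \<open>x\<close> are
  \<open>b\<close> plus \<open>m\<close> times \<open>x\<close> minus \<open>n\<close> times
  \<open>x\<close>; two natural coefficients stand for one integer. Hypothesis \<open>c\<close> is
  exactly the compatibility that makes \<open>w * z ^ m / z ^ n\<close> independent of the
  representation.\<close>

lemma partial_character_adjoin:
  assumes R: "partial_character R" and z: "cmod z = 1"
    and c: "\<And>d w. (\<Sum>i<d. x, w) \<in> R \<Longrightarrow> w = z ^ d"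
  obtains R' where "partial_character R'" "R \<subseteq> R'" "(x, z) \<in> R'"
proof
  note D = partial_characterD[OF R]
  let ?s = "\<lambda>n::nat. \<Sum>i<n. x"
  let ?R = "{(b + ?s m - ?s n, w * z ^ m / z ^ n) | b w m n. (b, w) \<in> R}"
  have z0: "z \<noteq> 0" using z by auto
  \<comment> \<open>\<open>?R\<close> is closed under the group operations, so single-valuedness
    reduces to the fibre over \<open>0\<close>. Cancelling the smaller coefficient leaves one
    multiple of \<open>x\<close> in the old domain, where \<open>c\<close> applies.\<close>
  have w1: "w * z ^ m / z ^ n = 1" if "(b, w) \<in> R" "b + ?s m - ?s n = 0" for b w m n
  proof (cases "m \<le> n")
    case True
    then obtain d where d: "n = m + d" by (metis le_add_diff_inverse)
    have "b = ?s d" using that(2) by (simp add: d sum_const_add)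
    then have "w = z ^ d" using c that(1) by blast
    then show ?thesis using z0 by (simp add: d power_add)
  next
    case False
    then obtain d where d: "m = n + d" by (metis le_add_diff_inverse nat_le_linear)
    have "- b = ?s d"
      using that(2) by (simp add: d sum_const_add) (metis add.inverse_inverse add_eq_0_iff2)
    then have "(?s d, inverse w) \<in> R" using D(3)[OF that(1)] by simp
    then have "inverse w = z ^ d" by (rule c)
    moreover have "w \<noteq> 0" using D(4)[OF that(1)] by auto
    ultimately have "w * z ^ d = 1" by (simp add: field_simps)
    then show ?thesis using z0 by (simp add: d power_add)
  qed
  show "partial_character ?R"
    unfolding partial_character_def
  proof (intro conjI allI impI; (elim conjE)?)
    show "(0, 1) \<in> ?R" using D(1) by (force intro: exI[of _ 0])
  next
    fix a u b v assume "(a, u) \<in> ?R" "(b, v) \<in> ?R"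
    then obtain a' u' m n b' v' m' n' where
      a: "a = a' + ?s m - ?s n" "u = u' * z ^ m / z ^ n" "(a', u') \<in> R" and
      b: "b = b' + ?s m' - ?s n'" "v = v' * z ^ m' / z ^ n'" "(b', v') \<in> R" by blast
    have "(a' + b', u' * v') \<in> R" "a + b = (a' + b') + ?s (m + m') - ?s (n + n')"
      "u * v = (u' * v') * z ^ (m + m') / z ^ (n + n')"
      using D(2) a(3) b(3) unfolding a b by (auto simp: sum_const_add power_add algebra_simps)
    then show "(a + b, u * v) \<in> ?R" by blast
  next
    fix a u assume "(a, u) \<in> ?R"
    then obtain a' u' m n where *:
      "a = a' + ?s m - ?s n" "u = u' * z ^ m / z ^ n" "(a', u') \<in> R" by blast
    then have "(- a', inverse u') \<in> R" "- a = - a' + ?s n - ?s m"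
      "inverse u = inverse u' * z ^ n / z ^ m"
      using D(3) by (auto simp: algebra_simps divide_inverse)
    then show "(- a, inverse u) \<in> ?R" by blast
    show "cmod u = 1" using * D(4) z by (auto simp: norm_mult norm_divide norm_power)
  next
    fix u assume "(0, u) \<in> ?R"
    then show "u = 1" using w1 by force
  qed
  show "R \<subseteq> ?R" by (force intro: exI[of _ 0])
  show "(x, z) \<in> ?R" using D(1) by (force intro: exI[of _ 0] exI[of _ 1])
qed

text \<open>Division of \<open>d\<close> by the least positive \<open>N\<close> for which
  \<open>N\<close> times \<open>x\<close> lies in the domain: each step subtracts \<open>N\<close>,
  and minimality leaves only the remainder \<open>0\<close>. This provides the compatibility
  condition of \<open>partial_character_adjoin\<close>.\<close>

lemma partial_character_powers:
  assumes R: "partial_character R" and N: "0 < N" "(\<Sum>i<N. x, z ^ N) \<in> R" "z \<noteq> 0"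
    and min: "\<And>d w. 0 < d \<Longrightarrow> d < N \<Longrightarrow> (\<Sum>i<d. x, w) \<notin> R"
  shows "(\<Sum>i<d. x, w) \<in> R \<Longrightarrow> w = z ^ d"
proof (induction d arbitrary: w rule: less_induct)
  case (less d)
  note D = partial_characterD[OF R]
  show ?case
  proof (cases "d < N")
    case True
    then have "d = 0" using min less.prems by blast
    then show ?thesis using D(5) less.prems by simp
  next
    case False
    then obtain e where e: "d = N + e" by (metis le_add_diff_inverse not_less)
    have "((\<Sum>i<d. x) + - (\<Sum>i<N. x), w * inverse (z ^ N)) \<in> R"
      by (intro D(2) D(3) less.prems N(2))
    then have "(\<Sum>i<e. x, w / z ^ N) \<in> R"
      by (simp add: e sum_const_add divide_inverse)
    then have "w / z ^ N = z ^ e" using less.IH[of e] e N(1) by simp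
    then show ?thesis using N(3) by (simp add: e power_add field_simps)
  qed
qed

text \<open>The circle is divisible: the value at the least positive multiple of \<open>x\<close> in
  the domain has a root of modulus one. If no positive multiple lies in the domain, every value is
  compatible and \<open>1\<close> is taken.\<close>

lemma partial_character_extend:
  assumes R: "partial_character R"
  obtains R' z where "partial_character R'" "R \<subseteq> R'" "(x, z) \<in> R'"
proof (cases "\<exists>d>0::nat. \<exists>w. (\<Sum>i<d. x, w) \<in> R")
  case False
  have "w = 1 ^ d" if "(\<Sum>i<d. x, w) \<in> R" for d :: nat and w
    using that False partial_characterD(5)[OF R, of w] by (cases "d = 0") (simp, blast)
  from partial_character_adjoin[OF R norm_one this] obtain R'
    where "partial_character R'" "R \<subseteq> R'" "(x, 1) \<in> R'" .
  then show ?thesis by (rule that)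
next
  case True
  define N where "N = (LEAST d::nat. d > 0 \<and> (\<exists>w. (\<Sum>i<d. x, w) \<in> R))"
  have "N > 0 \<and> (\<exists>w. (\<Sum>i<N. x, w) \<in> R)"
    unfolding N_def by (rule LeastI_ex) (use True in auto)
  then obtain w where N: "N > 0" "(\<Sum>i<N. x, w) \<in> R" by blast
  have min: "(\<Sum>i<d. x, w) \<notin> R" if "0 < d" "d < N" for d :: nat and w
    using not_less_Least[of d "\<lambda>d::nat. d > 0 \<and> (\<exists>w. (\<Sum>i<d. x, w) \<in> R)"] that N_def by blast
  have w: "cmod w = 1" using partial_characterD(4)[OF R N(2)] .
  define z where "z = cis (Arg w / N)"
  have "z ^ N = cis (Arg w)"
    using N(1) by (simp add: z_def Complex.DeMoivre)
  also have "\<dots> = w" using w by (subst cis_Arg) (auto simp: sgn_eq)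
  finally have zN: "z ^ N = w" .
  have z: "cmod z = 1" by (simp add: z_def)
  have z0: "z \<noteq> 0" using z by auto
  have "\<And>d w. (\<Sum>i<d. x, w) \<in> R \<Longrightarrow> w = z ^ d"
    by (rule partial_character_powers[OF R N(1) _ _ min]) (simp_all add: zN N(2) z0)
  from partial_character_adjoin[OF R z this] obtain R'
    where "partial_character R'" "R \<subseteq> R'" "(x, z) \<in> R'" .
  then show ?thesis by (rule that)
qed

text \<open>On the cyclic subgroup generated by \<open>h\<close> a value other than \<open>1\<close>
  is available: \<open>-1\<close> for infinite order, a primitive root of unity for finite order. A
  maximal extension, given by Zorn's lemma, is total by
  \<open>partial_character_extend\<close>.\<close>

lemma characters_separate:
  fixes h :: "'g::ab_group_add"
  assumes "h \<noteq> 0"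
  obtains \<psi> where "\<psi> \<in> characters" "\<psi> h \<noteq> 1"
proof -
  let ?R0 = "{(0::'g, 1::complex)}"
  have "\<exists>R z. partial_character R \<and> (h, z) \<in> R \<and> z \<noteq> 1"
  proof (cases "\<exists>d>0::nat. (\<Sum>i<d. h) = 0")
    case False
    have "w = (-1) ^ d" if "(\<Sum>i<d. h, w) \<in> ?R0" for d :: nat and w
      using that False by (cases d) auto
    from partial_character_adjoin[OF partial_character_singleton _ this]
    obtain R where "partial_character R" "(h, -1) \<in> R" by auto
    moreover have "(-1 :: complex) \<noteq> 1" by simp
    ultimately show ?thesis by blast
  next
    case True
    define N where "N = (LEAST d::nat. d > 0 \<and> (\<Sum>i<d. h) = 0)"
    have N: "N > 0 \<and> (\<Sum>i<N. h) = 0"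
      unfolding N_def by (rule LeastI_ex) (use True in auto)
    have min: "(\<Sum>i<d. h) \<noteq> 0" if "0 < d" "d < N" for d :: nat
      using not_less_Least[of d "\<lambda>d::nat. d > 0 \<and> (\<Sum>i<d. h) = 0"] that N_def by blast
    have "N \<noteq> 1" using N assms by auto
    then have N2: "N \<ge> 2" using N by linarith
    define z where "z = cis (2 * pi / N)"
    have zN: "z ^ N = 1" using N by (simp add: z_def Complex.DeMoivre)
    have z: "cmod z = 1" by (simp add: z_def)
    have z1: "z \<noteq> 1"
    proof
      assume "z = 1"
      then have "cos (2 * pi / N) = 1" by (simp add: z_def complex_eq_iff)
      then obtain k :: int where "2 * pi / N = of_int k * 2 * pi"
        using cos_one_2pi_int by auto
      then have "1 = of_int k * real N" using N2 by (simp add: field_simps)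
      then have "1 = k * int N" by (metis of_int_1 of_int_eq_iff of_int_mult of_int_of_nat_eq)
      then show False using N2 
        by (metis \<open>N \<noteq> 1\<close> abs_of_nat abs_zmult_eq_1 mult.commute of_nat_1_eq_iff)
    qed
    have "\<And>d w. (\<Sum>i<d. h, w) \<in> ?R0 \<Longrightarrow> w = z ^ d"
      by (rule partial_character_powers[OF partial_character_singleton, of N])
         (use N zN min in \<open>simp_all add: z_def\<close>)
    from partial_character_adjoin[OF partial_character_singleton z this]
    obtain R where "partial_character R" "(h, z) \<in> R" .
    with z1 show ?thesis by blast
  qed
  then obtain R1 z1 where R1: "partial_character R1" "(h, z1) \<in> R1" "z1 \<noteq> 1" by blast
  \<comment> \<open>Only extensions of \<open>R1\<close> compete, so the value at \<open>h\<close>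
    remains \<open>z1\<close>.\<close>
  let ?A = "{R. partial_character R \<and> R1 \<subseteq> R}"
  have "\<exists>M\<in>?A. \<forall>X\<in>?A. M \<subseteq> X \<longrightarrow> X = M"
  proof (rule subset_Zorn_nonempty)
    show "?A \<noteq> {}" using R1 by blast
  next
    fix C assume C: "C \<noteq> {}" "subset.chain ?A C"
    have C1: "partial_character X" "R1 \<subseteq> X" if "X \<in> C" for X
      using C(2) that by (auto simp: subset_chain_def)
    have lin: "\<exists>Z\<in>C. p \<in> Z \<and> q \<in> Z" if pq: "p \<in> \<Union>C" "q \<in> \<Union>C" for p q
    proof -
      obtain X Y where "X \<in> C" "p \<in> X" "Y \<in> C" "q \<in> Y" using pq by blast
      moreover from this have "X \<subseteq> Y \<or> Y \<subseteq> X" using C(2) by (auto simp: subset_chain_def)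
      ultimately show ?thesis by blast
    qed
    have "partial_character (\<Union>C)"
      unfolding partial_character_def
    proof (intro conjI allI impI; (elim conjE)?)
      show "(0, 1) \<in> \<Union>C" using C(1) C1 partial_characterD(1) by blast
      show "(a + b, z * w) \<in> \<Union>C" if ab: "(a, z) \<in> \<Union>C" "(b, w) \<in> \<Union>C" for a b z w
      proof -
        obtain Z where "Z \<in> C" "(a, z) \<in> Z" "(b, w) \<in> Z" using lin[OF ab] by blast
        then show ?thesis using partial_characterD(2)[OF C1(1)] by blast
      qed
      show "(- a, inverse z) \<in> \<Union>C" if "(a, z) \<in> \<Union>C" for a z
        using that C1 partial_characterD(3) by blast
      show "cmod z = 1" if "(a, z) \<in> \<Union>C" for a z
        using that C1 partial_characterD(4) by blast
      show "z = 1" if "(0, z) \<in> \<Union>C" for z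
        using that C1 partial_characterD(5) by blast
    qed
    then show "\<Union>C \<in> ?A" using C(1) C1 by blast
  qed
  then obtain R where RA: "R \<in> ?A" and max': "\<forall>X\<in>?A. R \<subseteq> X \<longrightarrow> X = R" by (elim bexE)
  then have R: "partial_character R" "R1 \<subseteq> R" by simp_all
  have max: "X = R" if "partial_character X" "R \<subseteq> X" for X
    using max' R(2) that by simp
  have "\<exists>z. (x, z) \<in> R" for x
  proof -
    obtain R' z where "partial_character R'" "R \<subseteq> R'" "(x, z) \<in> R'"
      using partial_character_extend[OF R(1)] .
    then show ?thesis using max[of R'] by auto
  qed
  then obtain \<psi> where \<psi>: "\<And>x. (x, \<psi> x) \<in> R" by metis
  have "\<psi> \<in> characters"
    unfolding characters_def
    using partial_characterD(2,4)[OF R(1)] partial_character_unique[OF R(1)] \<psi> by blast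
  moreover have "\<psi> h = z1" using partial_character_unique[OF R(1)] \<psi> R1(2) R(2) by blast
  ultimately show ?thesis using that R1(3) by blast
qed

section \<open>Arithmetic of characters and integration over the dual group\<close>

lemma character_zero: "\<omega> \<in> characters \<Longrightarrow> \<omega> 0 = 1"
  by (auto simp: characters_def) (metis add_0 mult_cancel_right1 norm_zero zero_neq_one)

lemma character_minus: "\<omega> \<in> characters \<Longrightarrow> \<omega> (- g) = cnj (\<omega> g)"
proof -
  assume \<omega>: "\<omega> \<in> characters"
  have "\<omega> (- g) * \<omega> g = 1"
    using \<omega> character_zero[OF \<omega>] unfolding characters_def
    by (metis (mono_tags, lifting) ab_left_minus mem_Collect_eq)
  moreover have "cnj (\<omega> g) * \<omega> g = 1"
    using \<omega> by (simp add: characters_def mult.commute complex_norm_square[symmetric])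
  moreover have "\<omega> g \<noteq> 0" using \<omega> unfolding characters_def
    by (metis (mono_tags, lifting) mem_Collect_eq norm_zero zero_neq_one)
  ultimately show ?thesis by (metis mult_right_cancel)
qed

lemma character_add: "\<omega> \<in> characters \<Longrightarrow> \<omega> (g + h) = \<omega> g * \<omega> h"
  by (auto simp: characters_def)

lemma character_diff: "\<omega> \<in> characters \<Longrightarrow> \<omega> (g - h) = \<omega> g * cnj (\<omega> h)"
  using character_add[of \<omega> g "- h"] by (simp add: character_minus)

lemma norm_character: "\<omega> \<in> characters \<Longrightarrow> cmod (\<omega> g) = 1"
  by (auto simp: characters_def)

lemma space_dual_space: "space dual_space = characters"
  by (simp add: dual_space_def space_restrict_space)

lemma measurable_eval_dual_space:
  fixes g :: "'g::{ab_group_add,countable}"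
  shows "(\<lambda>\<omega>. \<omega> g) \<in> borel_measurable dual_space"
  unfolding dual_space_def
  by (intro measurable_restrict_space1 borel_measurable_continuous_onI
      continuous_on_product_coordinates)

text \<open>Translation by a character \<open>\<psi>\<close> with \<open>\<psi> h \<noteq> 1\<close>
  fixes Haar measure but multiplies the integral by \<open>\<psi> h\<close>.\<close>

lemma haar_measure_dual_integral:
  fixes h :: "'g::{ab_group_add,countable}"
  assumes m: "haar_measure_dual m" and "h \<noteq> 0"
  shows "(\<integral>\<omega>. \<omega> h \<partial>m) = 0"
proof -
  obtain \<psi> :: "'g \<Rightarrow> complex" where \<psi>: "\<psi> \<in> characters" "\<psi> h \<noteq> 1"
    using characters_separate[OF assms(2)] .
  have s: "sets m = sets dual_space" and d: "distr m m (\<lambda>\<omega> g. \<psi> g * \<omega> g) = m"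
    using m \<psi> by (auto simp: haar_measure_dual_def)
  have sp: "space m = characters" using sets_eq_imp_space_eq[OF s] by (simp add: space_dual_space)
  have ev: "(\<lambda>\<omega>. \<omega> g) \<in> borel_measurable m" for g :: 'g
    using measurable_eval_dual_space measurable_cong_sets[OF s] by blast
  have meas: "(\<lambda>\<omega> g. \<psi> g * \<omega> g) \<in> measurable m m"
  proof -
    have "(\<lambda>\<omega> g. \<psi> g * \<omega> g) \<in> measurable m (restrict_space borel characters)"
    proof (rule measurable_restrict_space2)
      show "(\<lambda>\<omega> g. \<psi> g * \<omega> g) \<in> space m \<rightarrow> characters"
        using \<psi> by (auto simp: sp characters_def norm_mult)
      show "(\<lambda>\<omega> g. \<psi> g * \<omega> g) \<in> borel_measurable m"
      proof (rule measurable_coordinatewise_then_product)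
        show "(\<lambda>\<omega>. \<psi> g * \<omega> g) \<in> borel_measurable m" for g
          by (intro borel_measurable_times borel_measurable_const ev)
      qed
    qed
    then show ?thesis
      using measurable_cong_sets[OF refl s] by (auto simp: dual_space_def)
  qed
  have "(\<integral>\<omega>. \<omega> h \<partial>m) = (\<integral>\<omega>. \<omega> h \<partial>distr m m (\<lambda>\<omega> g. \<psi> g * \<omega> g))" by (simp add: d)
  also have "\<dots> = (\<integral>\<omega>. \<psi> h * \<omega> h \<partial>m)"
    using meas ev by (subst integral_distr) auto
  also have "\<dots> = \<psi> h * (\<integral>\<omega>. \<omega> h \<partial>m)" by simp
  finally show ?thesis using \<psi>(2) by (simp add: mult_cancel_right1)
qed

section \<open>Trigonometric polynomials and singular measures\<close>

definition trig_poly :: "(('g::ab_group_add \<Rightarrow> complex) \<Rightarrow> complex) \<Rightarrow> bool" where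
  "trig_poly P \<longleftrightarrow> (\<exists>H p. finite H \<and> (\<forall>\<omega>\<in>characters. P \<omega> = (\<Sum>h\<in>H. p h * \<omega> h)))"

lemma trig_poly_monom: "trig_poly (\<lambda>\<omega>. c * \<omega> h)"
  unfolding trig_poly_def by (intro exI[of _ "{h}"] exI[of _ "\<lambda>_. c"]) simp

lemma trig_poly_const: "trig_poly (\<lambda>\<omega>. c)"
  unfolding trig_poly_def
  by (intro exI[of _ "{0}"] exI[of _ "\<lambda>_. c"]) (simp add: character_zero)

lemma trig_poly_cong:
  "trig_poly P \<Longrightarrow> (\<And>\<omega>. \<omega> \<in> characters \<Longrightarrow> Q \<omega> = P \<omega>) \<Longrightarrow> trig_poly Q"
  unfolding trig_poly_def by metis

lemma trig_poly_add:
  assumes "trig_poly P" "trig_poly Q"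
  shows "trig_poly (\<lambda>\<omega>. P \<omega> + Q \<omega>)"
proof -
  obtain H p where H: "finite H" "\<And>\<omega>. \<omega> \<in> characters \<Longrightarrow> P \<omega> = (\<Sum>h\<in>H. p h * \<omega> h)"
    using assms(1) by (auto simp: trig_poly_def)
  obtain K q where K: "finite K" "\<And>\<omega>. \<omega> \<in> characters \<Longrightarrow> Q \<omega> = (\<Sum>h\<in>K. q h * \<omega> h)"
    using assms(2) by (auto simp: trig_poly_def)
  define r where "r h = (if h \<in> H then p h else 0) + (if h \<in> K then q h else 0)" for h
  have "P \<omega> + Q \<omega> = (\<Sum>h\<in>H \<union> K. r h * \<omega> h)" if "\<omega> \<in> characters" for \<omega>
  proof -
    have "P \<omega> = (\<Sum>h\<in>H \<union> K. (if h \<in> H then p h else 0) * \<omega> h)"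
      unfolding H(2)[OF that] by (rule sum.mono_neutral_cong_left) (use H(1) K(1) in auto)
    moreover have "Q \<omega> = (\<Sum>h\<in>H \<union> K. (if h \<in> K then q h else 0) * \<omega> h)"
      unfolding K(2)[OF that] by (rule sum.mono_neutral_cong_left) (use H(1) K(1) in auto)
    ultimately show ?thesis by (simp add: r_def sum.distrib[symmetric] distrib_right)
  qed
  then show ?thesis unfolding trig_poly_def using H(1) K(1)
    by (intro exI[of _ "H \<union> K"] exI[of _ r]) simp
qed

lemma trig_poly_mult:
  assumes "trig_poly P" "trig_poly Q"
  shows "trig_poly (\<lambda>\<omega>. P \<omega> * Q \<omega>)"
proof -
  obtain H p where H: "finite H" "\<And>\<omega>. \<omega> \<in> characters \<Longrightarrow> P \<omega> = (\<Sum>h\<in>H. p h * \<omega> h)"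
    using assms(1) by (auto simp: trig_poly_def)
  obtain K q where K: "finite K" "\<And>\<omega>. \<omega> \<in> characters \<Longrightarrow> Q \<omega> = (\<Sum>h\<in>K. q h * \<omega> h)"
    using assms(2) by (auto simp: trig_poly_def)
  define s where "s = (\<lambda>(a, b). a + b :: 'a)"
  \<comment> \<open>Convolution of the coefficients: different pairs may have the same sum, so the
    terms are grouped by it.\<close>
  define r where "r k = (\<Sum>x | x \<in> H \<times> K \<and> s x = k. p (fst x) * q (snd x))" for k
  have "P \<omega> * Q \<omega> = (\<Sum>k\<in>s ` (H \<times> K). r k * \<omega> k)" if \<omega>: "\<omega> \<in> characters" for \<omega>
  proof -
    have "P \<omega> * Q \<omega> = (\<Sum>x\<in>H \<times> K. p (fst x) * q (snd x) * \<omega> (s x))"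
      unfolding H(2)[OF \<omega>] K(2)[OF \<omega>]
      by (simp add: sum_product sum.cartesian_product s_def character_add[OF \<omega>] case_prod_unfold
          mult_ac)
    also have "\<dots> = (\<Sum>k\<in>s ` (H \<times> K).
        \<Sum>x | x \<in> H \<times> K \<and> s x = k. p (fst x) * q (snd x) * \<omega> (s x))"
      by (rule sum.image_gen) (use H(1) K(1) in simp)
    also have "\<dots> = (\<Sum>k\<in>s ` (H \<times> K). r k * \<omega> k)"
      unfolding r_def sum_distrib_right by (intro sum.cong refl) simp
    finally show ?thesis .
  qed
  then show ?thesis unfolding trig_poly_def using H(1) K(1)
    by (intro exI[of _ "s ` (H \<times> K)"] exI[of _ r]) simp
qed

text \<open>The conjugate of \<open>\<omega> g\<close> is \<open>\<omega> (- g)\<close>. This yields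
  real-valued trigonometric polynomials, as needed for the real form of the Stone-Weierstrass
  theorem.\<close>

lemma trig_poly_Re: "trig_poly (\<lambda>\<omega>. complex_of_real (Re (\<omega> g)))"
  and trig_poly_Im: "trig_poly (\<lambda>\<omega>. complex_of_real (Im (\<omega> g)))"
proof -
  have *: "trig_poly (\<lambda>\<omega>. c * \<omega> g + d * \<omega> (- g))" for c d
    by (intro trig_poly_add trig_poly_monom)
  show "trig_poly (\<lambda>\<omega>. complex_of_real (Re (\<omega> g)))"
    by (rule trig_poly_cong[OF *[of "1/2" "1/2"]]) (auto simp: character_minus complex_eq_iff)
  show "trig_poly (\<lambda>\<omega>. complex_of_real (Im (\<omega> g)))"
    by (rule trig_poly_cong[OF *[of "-\<i>/2" "\<i>/2"]]) (auto simp: character_minus complex_eq_iff)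
qed

section \<open>Compactness of the dual, uniform approximation and regularity\<close>

lemma closed_characters: "closed (characters :: ('g::ab_group_add \<Rightarrow> complex) set)"
  unfolding characters_def
  by (intro closed_Collect_conj closed_Collect_all closed_Collect_eq continuous_intros
      continuous_on_product_coordinates)

lemma compact_characters: "compact (characters :: ('g::ab_group_add \<Rightarrow> complex) set)"
proof -
  have "compactin (product_topology (\<lambda>_. euclidean) UNIV) (PiE (UNIV::'g set) (\<lambda>_. sphere (0::complex) 1))"
    unfolding compactin_PiE by simp
  then have "compact (PiE (UNIV::'g set) (\<lambda>_. sphere (0::complex) 1))"
    by (simp add: euclidean_product_topology)
  moreover have "characters = PiE UNIV (\<lambda>_. sphere (0::complex) 1) \<inter> (characters :: ('g \<Rightarrow> complex) set)"
    by (auto simp: characters_def)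
  ultimately show ?thesis
    using closed_characters by (metis compact_Int_closed)
qed

text \<open>Stone-Weierstrass on the compact dual. Points are separated because distinct characters
  differ in the real or imaginary part of some coordinate.\<close>

lemma trig_poly_dense:
  fixes f :: "('g::{ab_group_add,countable} \<Rightarrow> complex) \<Rightarrow> real"
  assumes f: "continuous_on characters f" and "e > 0"
  obtains P where "trig_poly P" "\<And>\<omega>. \<omega> \<in> characters \<Longrightarrow> cmod (P \<omega> - of_real (f \<omega>)) < e"
proof -
  define R :: "(('g \<Rightarrow> complex) \<Rightarrow> real) set"
    where "R = {r. continuous_on characters r \<and> trig_poly (\<lambda>\<omega>. complex_of_real (r \<omega>))}"
  interpret function_ring_on R characters
  proof unfold_locales
    show "compact (characters :: ('g \<Rightarrow> complex) set)" by (rule compact_characters)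
    show "continuous_on characters r" if "r \<in> R" for r using that by (simp add: R_def)
    show "(\<lambda>\<omega>. r \<omega> + s \<omega>) \<in> R" if "r \<in> R" "s \<in> R" for r s
      using that trig_poly_add[of "\<lambda>\<omega>. complex_of_real (r \<omega>)" "\<lambda>\<omega>. complex_of_real (s \<omega>)"]
      by (simp add: R_def continuous_on_add)
    show "(\<lambda>\<omega>. r \<omega> * s \<omega>) \<in> R" if "r \<in> R" "s \<in> R" for r s
      using that trig_poly_mult[of "\<lambda>\<omega>. complex_of_real (r \<omega>)" "\<lambda>\<omega>. complex_of_real (s \<omega>)"]
      by (simp add: R_def continuous_on_mult)
    show "(\<lambda>_. c) \<in> R" for c by (simp add: R_def trig_poly_const)
  next
    fix \<omega> \<omega>' :: "'g \<Rightarrow> complex" assume "\<omega> \<noteq> \<omega>'"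
    then obtain g where g: "Re (\<omega> g) \<noteq> Re (\<omega>' g) \<or> Im (\<omega> g) \<noteq> Im (\<omega>' g)"
      by (auto simp: fun_eq_iff complex_eq_iff)
    have "continuous_on characters (\<lambda>\<omega>::'g \<Rightarrow> complex. \<omega> g)"
      by (rule continuous_on_subset[OF continuous_on_product_coordinates]) simp
    then have mem: "(\<lambda>\<omega>. Re (\<omega> g)) \<in> R" "(\<lambda>\<omega>. Im (\<omega> g)) \<in> R"
      by (simp_all add: R_def trig_poly_Re trig_poly_Im continuous_on_Re continuous_on_Im)
    from g show "\<exists>f\<in>R. f \<omega> \<noteq> f \<omega>'"
      by (rule disjE) (rule bexI[OF _ mem(1)], assumption, rule bexI[OF _ mem(2)], assumption)
  qed
  obtain r where "r \<in> R" and r: "\<And>\<omega>. \<omega> \<in> characters \<Longrightarrow> \<bar>f \<omega> - r \<omega>\<bar> < e"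
    using Stone_Weierstrass_basic[OF assms] by (elim bexE) auto
  then have "trig_poly (\<lambda>\<omega>. complex_of_real (r \<omega>))" by (simp add: R_def)
  moreover have "cmod (of_real (r \<omega>) - of_real (f \<omega>)) < e" if "\<omega> \<in> characters" for \<omega>
    using r[OF that] by (simp only: of_real_diff[symmetric] norm_of_real abs_minus_commute)
  ultimately show ?thesis by (rule that)
qed

text \<open>The complement of \<open>A\<close> carries all of \<open>\<sigma>\<close> and none of
  \<open>m\<close>. Inner regularity of \<open>\<sigma>\<close> gives the compact set inside it,
  outer regularity of \<open>m\<close> the open set around it.\<close>

lemma dual_space_compact_open:
  fixes \<sigma> m :: "('g::{ab_group_add,countable} \<Rightarrow> complex) measure"
  assumes "finite_measure \<sigma>" "sets \<sigma> = sets dual_space"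
    and "finite_measure m" "sets m = sets dual_space"
    and A: "A \<in> sets dual_space" "emeasure \<sigma> A = 0" "emeasure m (space m - A) = 0"
    and e: "e > 0"
  obtains K U where "compact K" "open U" "K \<subseteq> U" "measure \<sigma> (characters - K) < e"
    "measure m (characters \<inter> U) < e"
proof -
  interpret s: finite_measure \<sigma> by fact
  interpret m: finite_measure m by fact
  have sp: "space \<sigma> = characters" "space m = characters"
    using assms(2,4)[THEN sets_eq_imp_space_eq] by (simp_all add: space_dual_space)
  have cb: "characters \<in> sets (borel :: ('g \<Rightarrow> complex) measure)"
    by (intro borel_closed closed_characters)
  have A': "A \<subseteq> characters" "A \<in> sets borel"
    using A(1) cb by (auto simp: dual_space_def sets_restrict_space)
  have B: "characters - A \<in> sets borel" using A' cb by auto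
  have id: "(\<lambda>\<omega>. \<omega>) \<in> measurable \<sigma> borel" "(\<lambda>\<omega>. \<omega>) \<in> measurable m borel"
    using measurable_restrict_space1[OF measurable_ident, of borel characters]
    by (simp_all add: id_def dual_space_def[symmetric] measurable_cong_sets[OF assms(2) refl]
        measurable_cong_sets[OF assms(4) refl])
  \<comment> \<open>The regularity theorems concern Borel measures on the whole function space, so
    both measures are pushed forward from the set of characters.\<close>
  let ?s = "distr \<sigma> borel (\<lambda>\<omega>. \<omega>)" and ?m = "distr m borel (\<lambda>\<omega>. \<omega>)"
  have es: "emeasure ?s X = emeasure \<sigma> (characters \<inter> X)" if "X \<in> sets borel" for X
    using id that by (subst emeasure_distr) (auto simp: sp intro!: arg_cong[where f="emeasure \<sigma>"])
  have em: "emeasure ?m X = emeasure m (characters \<inter> X)" if "X \<in> sets borel" for X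
    using id that by (subst emeasure_distr) (auto simp: sp intro!: arg_cong[where f="emeasure m"])
  have fs: "emeasure ?s (space ?s) \<noteq> \<infinity>" "emeasure ?m (space ?m) \<noteq> \<infinity>"
    using es[of UNIV] em[of UNIV] by (simp_all add: s.emeasure_eq_measure m.emeasure_eq_measure)
  have CA: "characters \<inter> (characters - A) = characters - A" by auto
  have full: "emeasure \<sigma> (characters - A) = emeasure \<sigma> characters"
    using A(2) A(1) assms(2) by (metis emeasure_Diff_null_set null_setsI sets.top sp(1))
  have "emeasure ?s (characters - A) = emeasure \<sigma> characters"
    using es[OF B] full by (simp add: CA)
  then have sup: "emeasure \<sigma> characters = (SUP K\<in>{K. K \<subseteq> characters - A \<and> compact K}. emeasure ?s K)"
    using inner_regular[of ?s "characters - A", OF _ fs(1) B] by simp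
  have "\<exists>K\<in>{K. K \<subseteq> characters - A \<and> compact K}. emeasure \<sigma> characters < emeasure ?s K + ennreal e"
  proof (rule ccontr)
    assume "\<not> ?thesis"
    then have le: "emeasure ?s K + ennreal e \<le> emeasure \<sigma> characters"
      if "K \<subseteq> characters - A" "compact K" for K using that by (auto simp: not_less)
    \<comment> \<open>Taking the empty set for \<open>K\<close> shows that the difference formed
      below is nonnegative; otherwise \<open>ennreal\<close> would truncate it to \<open>0\<close>
      and the contradiction would be lost.\<close>
    then have me: "e \<le> measure \<sigma> characters" 
      using le[of "{}"] e by (simp add: s.emeasure_eq_measure)
    have "emeasure ?s K \<le> ennreal (measure \<sigma> characters - e)" 
      if "K \<subseteq> characters - A" "compact K" for K 
    proof -
      have "emeasure ?s K = ennreal (measure \<sigma> (characters \<inter> K))"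
        using es[of K] that(2) by (simp add: s.emeasure_eq_measure compact_imp_closed)
      moreover from this le[OF that] e have "measure \<sigma> (characters \<inter> K) \<le> measure \<sigma> characters - e"
        by (simp add: s.emeasure_eq_measure ennreal_plus[symmetric] del: ennreal_plus)
      ultimately show ?thesis by (simp add: ennreal_leI)
    qed
    then have "emeasure \<sigma> characters \<le> ennreal (measure \<sigma> characters - e)"
      unfolding sup by (intro SUP_least) auto
    then show False using e me by (simp add: s.emeasure_eq_measure)
  qed
  then obtain K where K: "K \<subseteq> characters - A" "compact K"
    "emeasure \<sigma> characters < emeasure ?s K + ennreal e" by auto
  have Kb: "K \<in> sets borel" using K(2) by (simp add: compact_imp_closed)
  have "emeasure ?m (characters - A) = 0"
    using em[OF B] A(3) sp by (simp add: CA)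
  then have "(INF U\<in>{U. characters - A \<subseteq> U \<and> open U}. emeasure ?m U) = 0"
    using outer_regular[of ?m "characters - A", OF _ fs(2) B] by simp
  then have "(INF U\<in>{U. characters - A \<subseteq> U \<and> open U}. emeasure ?m U) < ennreal e"
    using e by simp
  then obtain U where U: "characters - A \<subseteq> U" "open U" "emeasure ?m U < ennreal e"
    by (auto simp: INF_less_iff)
  have "measure m (characters \<inter> U) < e"
    using U(3) em[of U] U(2) by (simp add: m.emeasure_eq_measure ennreal_less_iff)
  moreover have "measure \<sigma> (characters - K) < e"
  proof -
    have Ks: "K \<in> sets \<sigma>" using Kb K(1) assms(2) cb
      by (auto simp: dual_space_def sets_restrict_space image_iff)
    have "characters \<inter> K = K" using K(1) by auto
    then have "measure \<sigma> characters < measure \<sigma> K + e"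
      using K(3) es[OF Kb] e
      by (simp add: s.emeasure_eq_measure ennreal_plus[symmetric] ennreal_less_iff del: ennreal_plus)
    then show ?thesis
      using s.finite_measure_compl[OF Ks] by (simp add: sp)
  qed
  ultimately show ?thesis using that K U by blast
qed

text \<open>A Urysohn function that is \<open>1\<close> on \<open>K\<close> and \<open>0\<close>
  outside \<open>U\<close> is close to \<open>1\<close> for \<open>\<sigma>\<close> and to
  \<open>0\<close> for \<open>m\<close>; a trigonometric polynomial uniformly close to it inherits
  both properties.\<close>

lemma singular_trig_poly:
  fixes \<sigma> m :: "('g::{ab_group_add,countable} \<Rightarrow> complex) measure"
  assumes \<sigma>: "finite_measure \<sigma>" "sets \<sigma> = sets dual_space"
    and m: "finite_measure m" "sets m = sets dual_space"
    and A: "A \<in> sets dual_space" "emeasure \<sigma> A = 0" "emeasure m (space m - A) = 0"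
    and e: "e > 0"
  obtains H p where "finite H" "(\<integral>\<omega>. (cmod (1 - (\<Sum>h\<in>H. p h * \<omega> h)))\<^sup>2 \<partial>\<sigma>) < e"
    "(\<integral>\<omega>. (cmod (\<Sum>h\<in>H. p h * \<omega> h))\<^sup>2 \<partial>m) < e"
proof -
  interpret s: finite_measure \<sigma> by fact
  interpret m: finite_measure m by fact
  have sp: "space \<sigma> = characters" "space m = characters"
    using assms(2,4)[THEN sets_eq_imp_space_eq] by (simp_all add: space_dual_space)
  obtain K U where KU: "compact K" "open U" "K \<subseteq> U" "measure \<sigma> (characters - K) < e / 8"
    "measure m (characters \<inter> U) < e / 8"
    using dual_space_compact_open[OF assms(1-7), of "e / 8"] e by auto
  \<comment> \<open>The exceptional sets contribute less than \<open>4 * (e / 8)\<close> and the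
    uniform error at most \<open>d\<close> times a total mass, that is \<open>e / 2\<close>. The
    summand \<open>1\<close> keeps \<open>c\<close> positive.\<close>
  define c where "c = measure \<sigma> characters + measure m characters + 1"
  have c: "c > 0" unfolding c_def by (simp add: add_nonneg_pos)
  define d where "d = min 1 (e / (2 * c))"
  have d: "0 < d" "d \<le> 1" using e c by (auto simp: d_def)
  have dm: "d * measure \<sigma> characters \<le> e / 2" "d * measure m characters \<le> e / 2"
  proof -
    have "d * c \<le> e / (2 * c) * c" using c by (intro mult_right_mono) (auto simp: d_def)
    then have "d * c \<le> e / 2" using c by simp
    moreover have "d * measure \<sigma> characters \<le> d * c" "d * measure m characters \<le> d * c"
      using d by (auto simp: c_def intro!: mult_left_mono)
    ultimately show "d * measure \<sigma> characters \<le> e / 2" "d * measure m characters \<le> e / 2"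
      by linarith+
  qed
  have "normal_space (euclidean :: ('g \<Rightarrow> complex) topology)"
    by (intro metrizable_imp_normal_space metrizable_space_euclidean)
  then obtain f where f: "continuous_map euclidean (top_of_set {0..1::real}) f" "f ` (- U) \<subseteq> {0}" "f ` K \<subseteq> {1}"
    using Urysohn_lemma[of euclidean "- U" K 0 1] KU
    by (auto simp: compact_imp_closed disjnt_def closed_Compl)
  then have f01: "0 \<le> f \<omega>" "f \<omega> \<le> 1" and "continuous_on UNIV f" for \<omega>
    by (auto simp: continuous_map_in_subtopology image_subset_iff)
  then have "continuous_on characters f" by (auto intro: continuous_on_subset)
  from trig_poly_dense[OF this d(1)]
  obtain P where "trig_poly P" and P: "\<And>\<omega>. \<omega> \<in> characters \<Longrightarrow> cmod (P \<omega> - of_real (f \<omega>)) < d"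
    by blast
  then obtain H p where H: "finite H" "\<And>\<omega>. \<omega> \<in> characters \<Longrightarrow> P \<omega> = (\<Sum>h\<in>H. p h * \<omega> h)"
    by (auto simp: trig_poly_def)
  \<comment> \<open>Here \<open>b\<close> is the indicator of the exceptional set. As
    \<open>d \<le> 1\<close>, one bound covers both cases: \<open>d\<^sup>2 \<le> d\<close> and
    \<open>(d + 1)\<^sup>2 \<le> d + 4\<close>.\<close>
  have sq: "(cmod z)\<^sup>2 \<le> d + 4 * b" if "cmod z \<le> d + b" "b = 0 \<or> b = 1" for z and b :: real
  proof -
    have "(cmod z)\<^sup>2 \<le> (d + b)\<^sup>2" using that(1) by (simp add: power_mono)
    also have "\<dots> \<le> d + 4 * b"
    proof -
      have "d * d \<le> d * 1" using d by (intro mult_left_mono) auto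
      then have "d * d \<le> d" "d * d \<le> 1" using d by linarith+
      then have "d + d * d \<le> 3" using d by linarith
      with \<open>d * d \<le> d\<close> show ?thesis using that(2) d by (auto simp: power2_eq_square algebra_simps)
    qed
    finally show ?thesis .
  qed
  have b1: "(cmod (1 - (\<Sum>h\<in>H. p h * \<omega> h)))\<^sup>2 \<le> d + 4 * indicator (characters - K) \<omega>"
    if "\<omega> \<in> characters" for \<omega>
  proof -
    have "cmod (1 - P \<omega>) \<le> cmod (P \<omega> - of_real (f \<omega>)) + cmod (of_real (1 - f \<omega>))"
      using norm_triangle_ineq4[of "of_real (1 - f \<omega>)" "P \<omega> - of_real (f \<omega>)"] by simp
    also have "\<dots> \<le> d + \<bar>1 - f \<omega>\<bar>" using P[OF that] by (simp only: norm_of_real)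
    also have "\<dots> \<le> d + indicator (characters - K) \<omega>"
      using f(3) f01[of \<omega>] that by (auto simp: indicator_def)
    finally show ?thesis using sq H(2)[OF that] by (auto simp: indicator_def)
  qed
  have b2: "(cmod (\<Sum>h\<in>H. p h * \<omega> h))\<^sup>2 \<le> d + 4 * indicator (characters \<inter> U) \<omega>"
    if "\<omega> \<in> characters" for \<omega>
  proof -
    have "cmod (P \<omega>) \<le> cmod (P \<omega> - of_real (f \<omega>)) + cmod (of_real (f \<omega>))"
      using norm_triangle_ineq[of "P \<omega> - of_real (f \<omega>)" "of_real (f \<omega>)"] by simp
    also have "\<dots> \<le> d + \<bar>f \<omega>\<bar>" using P[OF that] by simp
    also have "\<dots> \<le> d + indicator (characters \<inter> U) \<omega>"
      using f(2) f01[of \<omega>] that by (auto simp: indicator_def)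
    finally show ?thesis using sq H(2)[OF that] by (auto simp: indicator_def)
  qed
  have ev: "(\<lambda>\<omega>. \<omega> g) \<in> borel_measurable \<sigma>" "(\<lambda>\<omega>. \<omega> g) \<in> borel_measurable m" for g :: 'g
    using measurable_eval_dual_space measurable_cong_sets[OF \<sigma>(2) refl]
      measurable_cong_sets[OF m(2) refl] by blast+
  have bound: "(\<integral>\<omega>. q \<omega> \<partial>\<mu>) < e"
    if \<mu>: "finite_measure \<mu>" "space \<mu> = characters" "q \<in> borel_measurable \<mu>" "X \<in> sets \<mu>"
      and q: "\<And>\<omega>. \<omega> \<in> characters \<Longrightarrow> q \<omega> \<le> d + 4 * indicator X \<omega>" "\<And>\<omega>. 0 \<le> q \<omega>"
      and X: "measure \<mu> X < e / 8" "d * measure \<mu> characters \<le> e / 2"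
    for \<mu> :: "('g \<Rightarrow> complex) measure" and q X
  proof -
    interpret finite_measure \<mu> by fact
    have i: "integrable \<mu> (\<lambda>\<omega>. d + 4 * indicator X \<omega> :: real)"
      using \<mu>(4)
      by (intro Bochner_Integration.integrable_add integrable_mult_right integrable_real_indicator)
         (auto simp: less_top[symmetric])
    have "(\<integral>\<omega>. q \<omega> \<partial>\<mu>) \<le> (\<integral>\<omega>. d + 4 * indicator X \<omega> \<partial>\<mu>)"
      using q d by (intro integral_mono' i) (auto simp: \<mu>(2))
    also have "\<dots> = d * measure \<mu> characters + 4 * measure \<mu> X"
    proof -
      have "X \<inter> characters = X" using sets.sets_into_space[OF \<mu>(4)] \<mu>(2) by auto
      then show ?thesis using \<mu>(4)
        by (subst Bochner_Integration.integral_add)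
           (auto simp: \<mu>(2) less_top[symmetric] intro!: integrable_mult_right integrable_real_indicator)
    qed
    also have "\<dots> < e" using X by simp
    finally show ?thesis .
  qed
  have "characters - K = characters \<inter> - K" by auto
  then have K: "characters - K \<in> sets \<sigma>" "characters \<inter> U \<in> sets m"
    using KU(2) compact_imp_closed[OF KU(1)] unfolding \<sigma>(2) m(2) dual_space_def sets_restrict_space
    by (auto intro!: imageI borel_closed[THEN borel_comp])
  have "(\<integral>\<omega>. (cmod (1 - (\<Sum>h\<in>H. p h * \<omega> h)))\<^sup>2 \<partial>\<sigma>) < e"
    by (rule bound[OF \<sigma>(1) sp(1) _ K(1)]) (use b1 KU dm ev in \<open>auto intro!: borel_measurable_sum borel_measurable_times\<close>)
  moreover have "(\<integral>\<omega>. (cmod (\<Sum>h\<in>H. p h * \<omega> h))\<^sup>2 \<partial>m) < e"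
    by (rule bound[OF m(1) sp(2) _ K(2)]) (use b2 KU dm ev in \<open>auto intro!: borel_measurable_sum borel_measurable_times\<close>)
  ultimately show ?thesis using that H(1) by blast
qed

text \<open>Serves two measures: for the spectral measure it matches the expansion of a norm on the
  space acted upon, for Haar measure only the diagonal survives.\<close>

lemma dual_integral_norm_trig_poly:
  fixes \<mu> :: "('g::{ab_group_add,countable} \<Rightarrow> complex) measure"
  assumes \<mu>: "finite_measure \<mu>" "sets \<mu> = sets dual_space"
  shows "complex_of_real (\<integral>\<omega>. (cmod (\<Sum>h\<in>H. q h * \<omega> h))\<^sup>2 \<partial>\<mu>) =
     (\<Sum>h\<in>H. \<Sum>k\<in>H. q h * cnj (q k) * (\<integral>\<omega>. \<omega> (h - k) \<partial>\<mu>))"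
proof -
  interpret finite_measure \<mu> by fact
  have sp: "space \<mu> = characters"
    using \<mu>(2)[THEN sets_eq_imp_space_eq] by (simp add: space_dual_space)
  have ev: "(\<lambda>\<omega>. \<omega> g) \<in> borel_measurable \<mu>" for g :: 'g
    using measurable_eval_dual_space measurable_cong_sets[OF \<mu>(2) refl] by blast
  have i: "integrable \<mu> (\<lambda>\<omega>. \<omega> g)" for g :: 'g
    by (rule integrable_const_bound[of _ 1]) (auto simp: ev sp norm_character)
  have "complex_of_real (\<integral>\<omega>. (cmod (\<Sum>h\<in>H. q h * \<omega> h))\<^sup>2 \<partial>\<mu>) =
      (\<integral>\<omega>. complex_of_real ((cmod (\<Sum>h\<in>H. q h * \<omega> h))\<^sup>2) \<partial>\<mu>)"
    by (rule integral_complex_of_real[symmetric])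
  also have "\<dots> = (\<integral>\<omega>. (\<Sum>h\<in>H. \<Sum>k\<in>H. q h * cnj (q k) * \<omega> (h - k)) \<partial>\<mu>)"
  proof (rule Bochner_Integration.integral_cong[OF refl])
    fix \<omega> assume "\<omega> \<in> space \<mu>"
    then have \<omega>: "\<omega> \<in> characters" by (simp add: sp)
    show "complex_of_real ((cmod (\<Sum>h\<in>H. q h * \<omega> h))\<^sup>2) =
      (\<Sum>h\<in>H. \<Sum>k\<in>H. q h * cnj (q k) * \<omega> (h - k))"
      unfolding complex_norm_square cnj_sum sum_product
      by (simp add: character_diff[OF \<omega>] mult_ac)
  qed
  also have "\<dots> = (\<Sum>h\<in>H. \<Sum>k\<in>H. q h * cnj (q k) * (\<integral>\<omega>. \<omega> (h - k) \<partial>\<mu>))"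
    using i by simp
  finally show ?thesis .
qed

text \<open>Parseval's identity for finite sums: evaluations at distinct group elements are
  orthonormal.\<close>

lemma haar_integral_norm_trig_poly:
  fixes m :: "('g::{ab_group_add,countable} \<Rightarrow> complex) measure"
  assumes m: "haar_measure_dual m" and H: "finite H"
  shows "(\<integral>\<omega>. (cmod (\<Sum>h\<in>H. q h * \<omega> h))\<^sup>2 \<partial>m) = (\<Sum>h\<in>H. (cmod (q h))\<^sup>2)"
proof -
  interpret prob_space m using m by (simp add: haar_measure_dual_def)
  have s: "sets m = sets dual_space" using m by (simp add: haar_measure_dual_def)
  have "space m = characters"
    using s[THEN sets_eq_imp_space_eq] by (simp add: space_dual_space)
  then have "(\<integral>\<omega>. \<omega> (0::'g) \<partial>m) = (\<integral>\<omega>. 1 \<partial>m)"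
    by (intro Bochner_Integration.integral_cong) (auto simp: character_zero)
  then have i: "(\<integral>\<omega>. \<omega> (h - k) \<partial>m) = (if h = k then 1 else 0)" for h k :: 'g
    using haar_measure_dual_integral[OF m, of "h - k"] prob_space by auto
  have "complex_of_real (\<integral>\<omega>. (cmod (\<Sum>h\<in>H. q h * \<omega> h))\<^sup>2 \<partial>m) =
      (\<Sum>h\<in>H. \<Sum>k\<in>H. q h * cnj (q k) * (if h = k then 1 else 0))"
    unfolding dual_integral_norm_trig_poly[OF finite_measure_axioms s] i ..
  also have "\<dots> = (\<Sum>h\<in>H. q h * cnj (q h))"
    using H by (simp add: if_distrib[of "\<lambda>x. _ * x"] sum.delta' cong: if_cong)
  also have "\<dots> = complex_of_real (\<Sum>h\<in>H. (cmod (q h))\<^sup>2)"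
    unfolding of_real_sum complex_norm_square ..
  finally show ?thesis by (simp only: of_real_eq_iff)
qed

section \<open>Bounded functions and the mean square norm\<close>

lemma mp_systemD:
  assumes "mp_system M T"
  shows "prob_space M" "T g \<in> measurable M M" "distr M M (T g) = M"
    "x \<in> space M \<Longrightarrow> T 0 x = x" "x \<in> space M \<Longrightarrow> T (g + h) x = T g (T h x)"
    "x \<in> space M \<Longrightarrow> T g x \<in> space M"
proof -
  show *: "T g \<in> measurable M M" using assms by (simp add: mp_system_def)
  show "x \<in> space M \<Longrightarrow> T g x \<in> space M" using measurable_space[OF *] .
qed (use assms in \<open>simp_all add: mp_system_def standard_probability_space_def\<close>)

lemma mp_system_inverse:
  assumes "mp_system M T" "x \<in> space M"
  shows "T (- g) (T g x) = x" "T g (T (- g) x) = x"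
  using mp_systemD(4)[OF assms] mp_systemD(5)[OF assms, symmetric] by simp_all

lemma mp_system_integral:
  fixes f :: "'x \<Rightarrow> 'b::{banach, second_countable_topology}"
  assumes "mp_system M T" "f \<in> borel_measurable M"
  shows "(\<integral>x. f (T g x) \<partial>M) = (\<integral>x. f x \<partial>M)"
  using integral_distr[of "T g" M M f] assms(2) mp_systemD(2,3)[OF assms(1), of g] by simp

lemma mp_system_AE:
  assumes "mp_system M T" "AE x in M. P x"
  shows "AE x in M. P (T g x)"
proof (rule AE_distrD[OF mp_systemD(2)[OF assms(1), of g]])
  show "AE x in distr M M (T g). P x" using assms(2) by (simp only: mp_systemD(3)[OF assms(1)])
qed

text \<open>The bound is demanded at every point of the type, not almost everywhere, so it passes to
  translates, sums and products without any handling of null sets.\<close>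

definition bounded_measurable :: "'x measure \<Rightarrow> ('x \<Rightarrow> complex) set" where
  "bounded_measurable M = {u \<in> borel_measurable M. \<exists>C. \<forall>x. cmod (u x) \<le> C}"

lemma bounded_measurableI:
  "u \<in> borel_measurable M \<Longrightarrow> (\<And>x. cmod (u x) \<le> C) \<Longrightarrow> u \<in> bounded_measurable M"
  by (auto simp: bounded_measurable_def)

lemma bounded_measurable_measurable [measurable_dest]:
  "u \<in> bounded_measurable M \<Longrightarrow> u \<in> borel_measurable M"
  by (simp add: bounded_measurable_def)

lemma bounded_measurableD:
  assumes "u \<in> bounded_measurable M"
  shows "\<exists>C\<ge>0. \<forall>x. cmod (u x) \<le> C"
proof -
  obtain C where C: "\<And>x. cmod (u x) \<le> C" using assms by (auto simp: bounded_measurable_def)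
  have "C \<ge> 0" using C[of undefined] norm_ge_zero order_trans by blast
  then show ?thesis using C by blast
qed

lemma bounded_measurable_const: "(\<lambda>x. c) \<in> bounded_measurable M"
  by (rule bounded_measurableI[of _ _ "cmod c"]) simp_all

lemma bounded_measurable_add:
  assumes "u \<in> bounded_measurable M" "v \<in> bounded_measurable M"
  shows "(\<lambda>x. u x + v x) \<in> bounded_measurable M"
proof -
  obtain C where C: "C \<ge> 0" "\<And>x. cmod (u x) \<le> C" using bounded_measurableD[OF assms(1)] by auto
  obtain D where D: "D \<ge> 0" "\<And>x. cmod (v x) \<le> D" using bounded_measurableD[OF assms(2)] by auto
  have "cmod (u x + v x) \<le> C + D" for x by (rule norm_triangle_mono[OF C(2) D(2)])
  then show ?thesis
    by (rule bounded_measurableI[rotated])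
       (intro borel_measurable_add bounded_measurable_measurable assms)
qed

lemma bounded_measurable_mult:
  assumes "u \<in> bounded_measurable M" "v \<in> bounded_measurable M"
  shows "(\<lambda>x. u x * v x) \<in> bounded_measurable M"
proof -
  obtain C where C: "C \<ge> 0" "\<And>x. cmod (u x) \<le> C" using bounded_measurableD[OF assms(1)] by auto
  obtain D where D: "D \<ge> 0" "\<And>x. cmod (v x) \<le> D" using bounded_measurableD[OF assms(2)] by auto
  have "cmod (u x * v x) \<le> C * D" for x unfolding norm_mult by (rule mult_mono[OF C(2) D(2) C(1)]) simp
  then show ?thesis
    by (rule bounded_measurableI[rotated])
       (intro borel_measurable_times bounded_measurable_measurable assms)
qed

lemma bounded_measurable_uminus:
  "u \<in> bounded_measurable M \<Longrightarrow> (\<lambda>x. - u x) \<in> bounded_measurable M"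
  by (auto simp: bounded_measurable_def)

lemma bounded_measurable_diff:
  "u \<in> bounded_measurable M \<Longrightarrow> v \<in> bounded_measurable M \<Longrightarrow> (\<lambda>x. u x - v x) \<in> bounded_measurable M"
  using bounded_measurable_add[of u M "\<lambda>x. - v x"] bounded_measurable_uminus[of v M] by simp

lemma bounded_measurable_divide:
  "u \<in> bounded_measurable M \<Longrightarrow> (\<lambda>x. u x / c) \<in> bounded_measurable M"
  using bounded_measurable_mult[OF _ bounded_measurable_const, of u M "inverse c"]
  by (simp add: divide_inverse)

lemma bounded_measurable_cnj:
  "u \<in> bounded_measurable M \<Longrightarrow> (\<lambda>x. cnj (u x)) \<in> bounded_measurable M"
  by (auto simp: bounded_measurable_def intro!: borel_measurable_continuous_on[OF continuous_on_cnj])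

lemma bounded_measurable_sum:
  "(\<And>i. i \<in> I \<Longrightarrow> u i \<in> bounded_measurable M) \<Longrightarrow> (\<lambda>x. \<Sum>i\<in>I. u i x) \<in> bounded_measurable M"
  by (induction I rule: infinite_finite_induct)
     (auto intro!: bounded_measurable_add bounded_measurable_const)

lemma bounded_measurable_prod:
  "(\<And>i. i \<in> I \<Longrightarrow> u i \<in> bounded_measurable M) \<Longrightarrow> (\<lambda>x. \<Prod>i\<in>I. u i x) \<in> bounded_measurable M"
  by (induction I rule: infinite_finite_induct)
     (auto intro!: bounded_measurable_mult bounded_measurable_const)

lemma bounded_measurable_compose:
  assumes "u \<in> bounded_measurable M" "S \<in> measurable M M"
  shows "(\<lambda>x. u (S x)) \<in> bounded_measurable M"
  using assms measurable_compose[OF assms(2), of u borel] by (auto simp: bounded_measurable_def)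

lemma bounded_measurable_koopman:
  "mp_system M T \<Longrightarrow> u \<in> bounded_measurable M \<Longrightarrow> koopman T g u \<in> bounded_measurable M"
  unfolding koopman_def by (rule bounded_measurable_compose) (auto simp: mp_systemD)

lemma bounded_measurable_indicator:
  "A \<in> sets M \<Longrightarrow> (\<lambda>x. indicator A x) \<in> bounded_measurable M"
  by (rule bounded_measurableI[of _ _ 1]) (auto simp: indicator_def)

lemmas bounded_measurable_intros =
  bounded_measurable_const bounded_measurable_add bounded_measurable_mult bounded_measurable_diff
  bounded_measurable_divide bounded_measurable_cnj bounded_measurable_sum bounded_measurable_prod
  bounded_measurable_koopman

lemma bounded_measurable_integrable:
  assumes "finite_measure M" "u \<in> bounded_measurable M"
  shows "integrable M u"
proof -
  obtain C where "C \<ge> 0" "\<And>x. cmod (u x) \<le> C" using bounded_measurableD[OF assms(2)] by auto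
  then show ?thesis
    by (intro finite_measure.integrable_const_bound[OF assms(1), of _ C])
       (use assms(2) in \<open>auto simp: bounded_measurable_measurable\<close>)
qed

lemma bounded_measurable_integrable_sq:
  assumes "finite_measure M" "u \<in> bounded_measurable M"
  shows "integrable M (\<lambda>x. (cmod (u x))\<^sup>2)"
proof -
  interpret finite_measure M by fact
  obtain C where "C \<ge> 0" "\<And>x. cmod (u x) \<le> C" using bounded_measurableD[OF assms(2)] by auto
  then show ?thesis using assms(2)
    by (intro integrable_const_bound[of _ "C\<^sup>2"]) (auto intro!: power_mono)
qed

section \<open>Squared norms, used without taking roots\<close>

definition sqnorm :: "'x measure \<Rightarrow> ('x \<Rightarrow> complex) \<Rightarrow> real" where
  "sqnorm M u = (\<integral>x. (cmod (u x))\<^sup>2 \<partial>M)"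

lemma sqnorm_nonneg: "0 \<le> sqnorm M u"
  by (simp add: sqnorm_def)

lemma sqnorm_minus_commute: "sqnorm M (\<lambda>x. u x - v x) = sqnorm M (\<lambda>x. v x - u x)"
  by (simp add: sqnorm_def norm_minus_commute)

lemma norm_add_sq_le: "(norm (a + b))\<^sup>2 \<le> 2 * (norm a)\<^sup>2 + 2 * (norm (b :: 'b::real_normed_vector))\<^sup>2"
proof -
  have "(norm (a + b))\<^sup>2 \<le> (norm a + norm b)\<^sup>2" by (simp add: norm_triangle_ineq power_mono)
  also have "\<dots> \<le> 2 * (norm a)\<^sup>2 + 2 * (norm b)\<^sup>2"
    using sum_squares_bound[of "norm a" "norm b"] by (simp add: power2_sum)
  finally show ?thesis .
qed

text \<open>The factors \<open>2\<close> replace the triangle inequality. Boundedness guarantees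
  integrability; for a function that is not square integrable \<open>sqnorm\<close> would be the
  default value \<open>0\<close>.\<close>

lemma sqnorm_add_le:
  assumes "finite_measure M" "u \<in> bounded_measurable M" "v \<in> bounded_measurable M"
  shows "sqnorm M (\<lambda>x. u x + v x) \<le> 2 * sqnorm M u + 2 * sqnorm M v"
proof -
  have "sqnorm M (\<lambda>x. u x + v x) \<le> (\<integral>x. 2 * (cmod (u x))\<^sup>2 + 2 * (cmod (v x))\<^sup>2 \<partial>M)"
    unfolding sqnorm_def
    by (intro integral_mono norm_add_sq_le Bochner_Integration.integrable_add integrable_mult_right
        bounded_measurable_integrable_sq bounded_measurable_add assms)
  also have "\<dots> = 2 * sqnorm M u + 2 * sqnorm M v"
    unfolding sqnorm_def
    by (subst Bochner_Integration.integral_add)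
       (auto intro!: integrable_mult_right bounded_measurable_integrable_sq assms)
  finally show ?thesis .
qed

lemma sqnorm_diff_triangle:
  assumes "finite_measure M" "u \<in> bounded_measurable M" "v \<in> bounded_measurable M"
    "w \<in> bounded_measurable M"
  shows "sqnorm M (\<lambda>x. u x - w x) \<le> 2 * sqnorm M (\<lambda>x. u x - v x) + 2 * sqnorm M (\<lambda>x. v x - w x)"
  using sqnorm_add_le[OF assms(1), of "\<lambda>x. u x - v x" "\<lambda>x. v x - w x"] assms
  by (simp add: bounded_measurable_diff)

lemma sqnorm_mono_mult:
  assumes "finite_measure M" "v \<in> bounded_measurable M" "w \<in> bounded_measurable M"
    "\<And>x. x \<in> space M \<Longrightarrow> cmod (w x) \<le> C * cmod (v x)" 
  shows "sqnorm M w \<le> C\<^sup>2 * sqnorm M v"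
proof -
  have "sqnorm M w \<le> (\<integral>x. C\<^sup>2 * (cmod (v x))\<^sup>2 \<partial>M)"
    unfolding sqnorm_def
  proof (intro integral_mono integrable_mult_right bounded_measurable_integrable_sq assms)
    fix x assume "x \<in> space M"
    then have "(cmod (w x))\<^sup>2 \<le> (C * cmod (v x))\<^sup>2" by (intro power_mono assms(4)) auto
    then show "(cmod (w x))\<^sup>2 \<le> C\<^sup>2 * (cmod (v x))\<^sup>2" by (simp add: power_mult_distrib)
  qed
  then show ?thesis by (simp add: sqnorm_def)
qed

lemma sqnorm_le_bound:
  assumes "prob_space M" "w \<in> bounded_measurable M" "\<And>x. x \<in> space M \<Longrightarrow> cmod (w x) \<le> C"
  shows "sqnorm M w \<le> C\<^sup>2"
proof -
  interpret prob_space M by fact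
  have "sqnorm M w \<le> C\<^sup>2 * sqnorm M (\<lambda>x. 1)"
    by (rule sqnorm_mono_mult) (use assms in \<open>auto intro: bounded_measurable_const finite_measure_axioms\<close>)
  then show ?thesis by (simp add: sqnorm_def prob_space)
qed

lemma sqnorm_koopman:
  assumes "mp_system M T" "u \<in> bounded_measurable M"
  shows "sqnorm M (koopman T g u) = sqnorm M u"
  unfolding sqnorm_def koopman_def
  by (rule mp_system_integral[OF assms(1), of "\<lambda>x. (cmod (u x))\<^sup>2"]) (use assms(2) in measurable)

text \<open>Convexity of the square, applied pointwise and integrated. For the empty set both sides
  are \<open>0\<close>.\<close>

lemma sqnorm_average_le:
  assumes "finite_measure M" "\<And>g. g \<in> A \<Longrightarrow> w g \<in> bounded_measurable M" "finite A"
  shows "sqnorm M (\<lambda>x. (\<Sum>g\<in>A. w g x) / of_nat (card A)) \<le> (\<Sum>g\<in>A. sqnorm M (w g)) / card A"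
proof (cases "A = {}")
  case False
  then have c: "card A > 0" using assms(3) by (simp add: card_gt_0_iff)
  have "sqnorm M (\<lambda>x. (\<Sum>g\<in>A. w g x) / of_nat (card A)) \<le> (\<integral>x. (\<Sum>g\<in>A. (cmod (w g x))\<^sup>2) / card A \<partial>M)"
    unfolding sqnorm_def
  proof (rule integral_mono)
    show "integrable M (\<lambda>x. (cmod ((\<Sum>g\<in>A. w g x) / of_nat (card A)))\<^sup>2)"
      by (intro bounded_measurable_integrable_sq bounded_measurable_intros assms)
    show "integrable M (\<lambda>x. (\<Sum>g\<in>A. (cmod (w g x))\<^sup>2) / card A)"
      by (intro integrable_divide Bochner_Integration.integrable_sum
          bounded_measurable_integrable_sq assms)
    fix x
    have "(cmod (\<Sum>g\<in>A. w g x))\<^sup>2 \<le> (\<Sum>g\<in>A. cmod (w g x))\<^sup>2"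
      by (intro power_mono norm_sum) simp
    also have "\<dots> \<le> (\<Sum>g\<in>A. (cmod (w g x))\<^sup>2) * card A"
      by (rule sum_squared_le_sum_of_squares)
    finally show "(cmod ((\<Sum>g\<in>A. w g x) / of_nat (card A)))\<^sup>2 \<le> (\<Sum>g\<in>A. (cmod (w g x))\<^sup>2) / card A"
      using c by (simp add: norm_divide power_divide field_simps power2_eq_square)
  qed
  also have "\<dots> = (\<Sum>g\<in>A. sqnorm M (w g)) / card A"
    unfolding sqnorm_def
    by (subst integral_divide_zero, subst Bochner_Integration.integral_sum)
       (auto intro!: bounded_measurable_integrable_sq assms)
  finally show ?thesis .
qed (simp add: sqnorm_def)

text \<open>The variance of the modulus of \<open>u\<close> is nonnegative on a probability
  space.\<close>

lemma sqnorm_integral_le: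
  assumes "prob_space M" "u \<in> bounded_measurable M"
  shows "(cmod (\<integral>x. u x \<partial>M))\<^sup>2 \<le> sqnorm M u"
proof -
  interpret prob_space M by fact
  define m where "m = (\<integral>x. cmod (u x) \<partial>M)"
  have i: "integrable M (\<lambda>x. cmod (u x))" "integrable M (\<lambda>x. (cmod (u x))\<^sup>2)"
    using bounded_measurable_integrable[OF finite_measure_axioms assms(2)]
      bounded_measurable_integrable_sq[OF finite_measure_axioms assms(2)] by simp_all
  have "0 \<le> (\<integral>x. (cmod (u x) - m)\<^sup>2 \<partial>M)" by simp
  also have "\<dots> = sqnorm M u - m\<^sup>2"
    using i by (simp add: power2_diff sqnorm_def prob_space m_def[symmetric] power2_eq_square
        algebra_simps)
  finally have "m\<^sup>2 \<le> sqnorm M u" by simp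
  moreover have "cmod (\<integral>x. u x \<partial>M) \<le> m" unfolding m_def by (rule integral_norm_bound)
  then have "(cmod (\<integral>x. u x \<partial>M))\<^sup>2 \<le> m\<^sup>2" by (intro power_mono) auto
  ultimately show ?thesis by linarith
qed

text \<open>With \<open>w\<close> an indicator it identifies a limit as a conditional expectation,
  with \<open>w = 1\<close> it turns convergence in mean square into convergence of
  integrals.\<close>

lemma sqnorm_mult_tendsto_integral:
  assumes M: "prob_space M" and "\<And>n. u n \<in> bounded_measurable M" "v \<in> bounded_measurable M"
    and w: "w \<in> bounded_measurable M" and lim: "(\<lambda>n. sqnorm M (\<lambda>x. u n x - v x)) \<longlonglongrightarrow> 0"
  shows "(\<lambda>n. \<integral>x. u n x * w x \<partial>M) \<longlonglongrightarrow> (\<integral>x. v x * w x \<partial>M)"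
proof -
  interpret prob_space M by fact
  obtain C where "C \<ge> 0" and C: "\<And>x. cmod (w x) \<le> C" using bounded_measurableD[OF w] by auto
  note bm = bounded_measurable_intros assms
  have "(\<lambda>n. (cmod ((\<integral>x. u n x * w x \<partial>M) - (\<integral>x. v x * w x \<partial>M)))\<^sup>2) \<longlonglongrightarrow> 0"
  proof (rule tendsto_sandwich[OF _ _ tendsto_const])
    show "\<forall>\<^sub>F n in sequentially. (cmod ((\<integral>x. u n x * w x \<partial>M) - (\<integral>x. v x * w x \<partial>M)))\<^sup>2
        \<le> C\<^sup>2 * sqnorm M (\<lambda>x. u n x - v x)"
    proof (rule always_eventually, rule allI)
      fix n
      have "(\<integral>x. u n x * w x \<partial>M) - (\<integral>x. v x * w x \<partial>M) = (\<integral>x. (u n x - v x) * w x \<partial>M)"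
        by (subst Bochner_Integration.integral_diff[symmetric])
           (auto simp: left_diff_distrib intro!: bounded_measurable_integrable finite_measure_axioms bm)
      also have "(cmod \<dots>)\<^sup>2 \<le> sqnorm M (\<lambda>x. (u n x - v x) * w x)"
        by (intro sqnorm_integral_le bm)
      also have "\<dots> \<le> C\<^sup>2 * sqnorm M (\<lambda>x. u n x - v x)"
        by (intro sqnorm_mono_mult bm finite_measure_axioms)
           (simp add: norm_mult mult.commute[of C] mult_left_mono C)
      finally show "(cmod ((\<integral>x. u n x * w x \<partial>M) - (\<integral>x. v x * w x \<partial>M)))\<^sup>2
        \<le> C\<^sup>2 * sqnorm M (\<lambda>x. u n x - v x)" .
    qed
    show "(\<lambda>n. C\<^sup>2 * sqnorm M (\<lambda>x. u n x - v x)) \<longlonglongrightarrow> 0" by (intro tendsto_mult_right_zero lim)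
  qed auto
  then have "(\<lambda>n. sqrt ((cmod ((\<integral>x. u n x * w x \<partial>M) - (\<integral>x. v x * w x \<partial>M)))\<^sup>2)) \<longlonglongrightarrow> sqrt 0"
    by (intro tendsto_intros)
  then show ?thesis by (simp add: tendsto_norm_zero_iff LIM_zero_iff)
qed

lemma sqnorm_eq_0_AE:
  assumes "finite_measure M" "u \<in> bounded_measurable M" "sqnorm M u = 0"
  shows "AE x in M. u x = 0"
proof -
  have "AE x in M. (cmod (u x))\<^sup>2 = 0"
    using assms(3) integral_nonneg_eq_0_iff_AE[OF bounded_measurable_integrable_sq[OF assms(1,2)]]
    by (simp add: sqnorm_def)
  then show ?thesis by simp
qed

lemma L2_tendsto_iff_sqnorm:
  assumes "finite_measure M" "\<And>n. u n \<in> bounded_measurable M" "v \<in> bounded_measurable M"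
  shows "L2_tendsto M u v \<longleftrightarrow> (\<lambda>n. sqnorm M (\<lambda>x. u n x - v x)) \<longlonglongrightarrow> 0"
proof -
  have "(\<integral>\<^sup>+x. ennreal ((cmod (u n x - v x))\<^sup>2) \<partial>M) = ennreal (sqnorm M (\<lambda>x. u n x - v x))" for n
    unfolding sqnorm_def
    by (rule nn_integral_eq_integral)
       (auto intro!: bounded_measurable_integrable_sq bounded_measurable_diff assms)
  then show ?thesis unfolding L2_tendsto_def
    by (simp add: ennreal_0[symmetric] tendsto_ennreal_iff sqnorm_nonneg del: ennreal_0)
qed

lemma L2_tendsto_cong_AE:
  assumes "\<And>n. AE x in M. u n x = u' n x" "AE x in M. v x = v' x"
  shows "L2_tendsto M u v \<longleftrightarrow> L2_tendsto M u' v'"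
proof -
  have "(\<integral>\<^sup>+x. ennreal ((cmod (u n x - v x))\<^sup>2) \<partial>M) = (\<integral>\<^sup>+x. ennreal ((cmod (u' n x - v' x))\<^sup>2) \<partial>M)" for n
    by (rule nn_integral_cong_AE) (use assms(1)[of n] assms(2) in eventually_elim, simp)
  then show ?thesis by (simp add: L2_tendsto_def)
qed

section \<open>Averages along a Folner sequence\<close>

definition folner_average :: "(nat \<Rightarrow> 'g set) \<Rightarrow> nat \<Rightarrow> ('g \<Rightarrow> complex) \<Rightarrow> complex" where
  "folner_average F n b = (\<Sum>g\<in>F n. b g) / of_nat (card (F n))"

lemma folner_sequence_card_pos: "folner_sequence F \<Longrightarrow> 0 < card (F n)"
  by (simp add: folner_sequence_def card_gt_0_iff)

definition folner_defect :: "(nat \<Rightarrow> 'g::ab_group_add set) \<Rightarrow> 'g \<Rightarrow> nat \<Rightarrow> real" where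
  "folner_defect F h n = real (card (sym_diff (F n) ((\<lambda>x. x + h) ` F n))) / real (card (F n))"

lemma folner_defect_tendsto: "folner_sequence F \<Longrightarrow> folner_defect F h \<longlonglongrightarrow> 0"
  by (simp add: folner_sequence_def folner_defect_def[abs_def])

text \<open>Moving the shift from the argument to the set leaves two sums that cancel on the
  intersection of \<open>F n\<close> with its translate.\<close>

lemma folner_average_shift:
  fixes b :: "'g::ab_group_add \<Rightarrow> complex"
  assumes F: "folner_sequence F" and b: "\<And>g. cmod (b g) \<le> B"
  shows "cmod (folner_average F n (\<lambda>g. b (g + h)) - folner_average F n b) \<le> B * folner_defect F h n"
proof -
  let ?A = "F n" and ?B = "(\<lambda>x. x + h) ` F n"
  have fin: "finite ?A" "finite ?B" using F by (auto simp: folner_sequence_def)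
  have B: "B \<ge> 0" using b[of 0] norm_ge_zero order_trans by blast
  have "(\<Sum>g\<in>?A. b (g + h)) = sum b ?B" by (subst sum.reindex) (auto simp: inj_on_def)
  moreover have "sum b ?B = sum b (?B - ?A) + sum b (?A \<inter> ?B)"
    using sum.Int_Diff[OF fin(2), of b ?A] by (simp add: Int_commute add.commute)
  moreover have "sum b ?A = sum b (?A - ?B) + sum b (?A \<inter> ?B)"
    using sum.Int_Diff[OF fin(1), of b ?B] by (simp add: add.commute)
  ultimately have "cmod ((\<Sum>g\<in>?A. b (g + h)) - sum b ?A) = cmod (sum b (?B - ?A) - sum b (?A - ?B))"
    by simp
  also have "\<dots> \<le> cmod (sum b (?B - ?A)) + cmod (sum b (?A - ?B))" by (rule norm_triangle_ineq4)
  also have "\<dots> \<le> of_nat (card (?B - ?A)) * B + of_nat (card (?A - ?B)) * B"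
    by (intro add_mono sum_norm_bound b)
  also have "\<dots> = B * real (card (sym_diff ?A ?B))"
    using fin by (subst card_Un_disjoint) (auto simp: algebra_simps)
  finally show ?thesis
    using folner_sequence_card_pos[OF F, of n]
    by (simp add: folner_average_def folner_defect_def diff_divide_distrib[symmetric] norm_divide
        divide_right_mono)
qed

lemma folner_average_norm_le:
  assumes F: "folner_sequence F" and b: "\<And>g. cmod (b g) \<le> B"
  shows "cmod (folner_average F n b) \<le> B"
proof -
  have "cmod (\<Sum>g\<in>F n. b g) \<le> of_nat (card (F n)) * B" by (intro sum_norm_bound b)
  then show ?thesis using folner_sequence_card_pos[OF F, of n]
    by (simp add: folner_average_def norm_divide field_simps)
qed

text \<open>A shift by \<open>h\<close> multiplies the average by \<open>\<omega> h\<close>, yet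
  changes it by at most a Folner defect. If \<open>\<omega> h \<noteq> 1\<close>, the average must
  vanish in the limit.\<close>

lemma folner_average_character:
  fixes \<omega> :: "'g::ab_group_add \<Rightarrow> complex"
  assumes F: "folner_sequence F" and \<omega>: "\<omega> \<in> characters"
  shows "(\<lambda>n. folner_average F n \<omega>) \<longlonglongrightarrow> (if \<omega> = (\<lambda>_. 1) then 1 else 0)"
proof (cases "\<omega> = (\<lambda>_. 1)")
  case True
  have "folner_average F n \<omega> = 1" for n
    using folner_sequence_card_pos[OF F, of n] by (simp add: folner_average_def True)
  then show ?thesis by (simp add: True)
next
  case False
  then obtain h where h: "\<omega> h \<noteq> 1" by auto
  have "cmod ((\<omega> h - 1) * folner_average F n \<omega>) \<le> 1 * folner_defect F h n" for n
  proof -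
    have "folner_average F n (\<lambda>g. \<omega> (g + h)) = \<omega> h * folner_average F n \<omega>"
      by (simp add: folner_average_def character_add[OF \<omega>] sum_distrib_right[symmetric] mult.commute)
    then show ?thesis
      using folner_average_shift[OF F, of \<omega> 1 n h] norm_character[OF \<omega>] by (simp add: algebra_simps)
  qed
  then have "(\<lambda>n. (\<omega> h - 1) * folner_average F n \<omega>) \<longlonglongrightarrow> 0"
    by (intro Lim_null_comparison[OF _ folner_defect_tendsto[OF F, of h]]) auto
  then have "(\<lambda>n. inverse (\<omega> h - 1) * ((\<omega> h - 1) * folner_average F n \<omega>)) \<longlonglongrightarrow> 0"
    by (rule tendsto_mult_right_zero)
  moreover have "inverse (\<omega> h - 1) * ((\<omega> h - 1) * z) = z" for z
    using h by simp
  ultimately show ?thesis using False by simp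
qed

section \<open>The spectral isometry and completeness in mean square\<close>

lemma bounded_measurable_folner_average:
  "(\<And>g. w g \<in> bounded_measurable M) \<Longrightarrow> (\<lambda>x. folner_average F n (\<lambda>g. w g x)) \<in> bounded_measurable M"
  unfolding folner_average_def by (intro bounded_measurable_intros)

text \<open>Sending \<open>koopman T h f\<close> to the evaluation at \<open>h\<close> preserves
  inner products: since \<open>T\<close> preserves the measure, the inner product of two translates
  depends only on \<open>h - k\<close>, where it is a Fourier coefficient of
  \<open>\<sigma>\<close>.\<close>

lemma sqnorm_koopman_sum:
  fixes T :: "'g::{ab_group_add,countable} \<Rightarrow> 'x \<Rightarrow> 'x"
  assumes T: "mp_system M T" and f: "f \<in> bounded_measurable M" and \<sigma>: "spectral_measure M T f \<sigma>"
  shows "sqnorm M (\<lambda>x. \<Sum>h\<in>H. q h * koopman T h f x) = (\<integral>\<omega>. (cmod (\<Sum>h\<in>H. q h * \<omega> h))\<^sup>2 \<partial>\<sigma>)"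
proof -
  interpret prob_space M using mp_systemD(1)[OF T] .
  note bm = bounded_measurable_intros T f
  have corr: "(\<integral>x. koopman T h f x * cnj (koopman T k f x) \<partial>M) = (\<integral>\<omega>. \<omega> (h - k) \<partial>\<sigma>)" for h k
  proof -
    have "(\<integral>x. koopman T h f x * cnj (koopman T k f x) \<partial>M) =
        (\<integral>x. koopman T h f (T k x) * cnj (koopman T k f (T k x)) \<partial>M)"
      by (rule mp_system_integral[OF T, symmetric, of "\<lambda>x. koopman T h f x * cnj (koopman T k f x)"])
         (intro bounded_measurable_measurable bm)
    also have "\<dots> = (\<integral>x. koopman T (h - k) f x * cnj (f x) \<partial>M)"
    proof (rule Bochner_Integration.integral_cong[OF refl])
      fix x assume x: "x \<in> space M"
      have "T (- h) (T k x) = T (- (h - k)) x"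
        using mp_systemD(5)[OF T x, of "- h" k] by simp
      then show "koopman T h f (T k x) * cnj (koopman T k f (T k x)) =
          koopman T (h - k) f x * cnj (f x)"
        by (simp add: koopman_def mp_system_inverse[OF T x])
    qed
    finally show ?thesis using \<sigma> by (simp add: spectral_measure_def)
  qed
  have "complex_of_real (sqnorm M (\<lambda>x. \<Sum>h\<in>H. q h * koopman T h f x)) =
      (\<integral>x. complex_of_real ((cmod (\<Sum>h\<in>H. q h * koopman T h f x))\<^sup>2) \<partial>M)"
    unfolding sqnorm_def by (rule integral_complex_of_real[symmetric])
  also have "\<dots> = (\<integral>x. (\<Sum>h\<in>H. \<Sum>k\<in>H. q h * cnj (q k) * (koopman T h f x * cnj (koopman T k f x))) \<partial>M)"
    unfolding complex_norm_square cnj_sum sum_product by (simp add: mult_ac)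
  also have "\<dots> = (\<Sum>h\<in>H. \<Sum>k\<in>H. (\<integral>x. q h * cnj (q k) * (koopman T h f x * cnj (koopman T k f x)) \<partial>M))"
    by (subst Bochner_Integration.integral_sum,
        (intro bounded_measurable_integrable finite_measure_axioms bm)[1])
       (intro sum.cong refl Bochner_Integration.integral_sum
        bounded_measurable_integrable finite_measure_axioms bm)
  also have "\<dots> = (\<Sum>h\<in>H. \<Sum>k\<in>H. q h * cnj (q k) * (\<integral>\<omega>. \<omega> (h - k) \<partial>\<sigma>))"
    by (simp add: corr)
  also have "\<dots> = complex_of_real (\<integral>\<omega>. (cmod (\<Sum>h\<in>H. q h * \<omega> h))\<^sup>2 \<partial>\<sigma>)"
    by (rule dual_integral_norm_trig_poly[symmetric]) (use \<sigma> in \<open>simp_all add: spectral_measure_def\<close>)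
  finally show ?thesis by (simp only: of_real_eq_iff)
qed

text \<open>The Riesz-Fischer argument: a subsequence with summable increments converges almost
  everywhere, and the bound \<open>C\<close> provides domination. The Cauchy condition has the form
  \<open>d n + d k\<close> because it will come from comparing both terms with one limit in another
  space.\<close>

lemma bounded_L2_Cauchy_limit:
  fixes u :: "nat \<Rightarrow> 'x \<Rightarrow> complex"
  assumes M: "prob_space M" and u: "\<And>n. u n \<in> borel_measurable M" "\<And>n x. cmod (u n x) \<le> C"
    and d: "\<And>n k. sqnorm M (\<lambda>x. u n x - u k x) \<le> d n + d k" "d \<longlonglongrightarrow> 0"
  obtains v where "v \<in> bounded_measurable M" "(\<lambda>n. sqnorm M (\<lambda>x. u n x - v x)) \<longlonglongrightarrow> 0"
proof -
  interpret prob_space M by fact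
  have ub: "u n \<in> bounded_measurable M" for n by (rule bounded_measurableI[OF u])
  note bm = bounded_measurable_intros ub
  have C0: "C \<ge> 0" using u(2)[of 0 undefined] norm_ge_zero order_trans by blast
  \<comment> \<open>Two such terms bound a squared increment by \<open>(1 / 4) ^ i\<close>, whose
    root \<open>(1 / 2) ^ i\<close> is summable.\<close>
  have "\<exists>n. \<forall>k\<ge>n. d k \<le> (1 / 4) ^ i / 2" for i
    using order_tendstoD(2)[OF d(2), of "(1 / 4) ^ i / 2"] by (force simp: eventually_sequentially)
  then obtain N where N: "\<And>i k. k \<ge> N i \<Longrightarrow> d k \<le> (1 / 4) ^ i / 2" by metis
  define r where "r i = i + (\<Sum>j\<le>i. N j)" for i
  have rN: "r k \<ge> N i" if "i \<le> k" for i k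
    using member_le_sum[of i "{..k}" N] that by (simp add: r_def)
  have "i \<le> r i" for i by (simp add: r_def)
  then have rlim: "filterlim r sequentially sequentially"
    by (intro filterlim_at_top_mono[OF filterlim_ident]) auto
  define s where "s i = (\<lambda>x. u (r (Suc i)) x - u (r i) x)" for i
  have sb: "s i \<in> bounded_measurable M" for i unfolding s_def by (intro bm)
  have L1: "(\<integral>x. cmod (s i x) \<partial>M) \<le> (1 / 2) ^ i" for i
  proof -
    let ?t = "(1 / 2 :: real) ^ i"
    have "(\<integral>x. cmod (s i x) \<partial>M) \<le> (\<integral>x. ?t / 2 + (cmod (s i x))\<^sup>2 / (2 * ?t) \<partial>M)"
    proof (rule integral_mono)
      show "integrable M (\<lambda>x. cmod (s i x))"
        using bounded_measurable_integrable[OF finite_measure_axioms sb] by simp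
      show "integrable M (\<lambda>x. ?t / 2 + (cmod (s i x))\<^sup>2 / (2 * ?t))"
        by (intro Bochner_Integration.integrable_add integrable_divide
            bounded_measurable_integrable_sq[OF finite_measure_axioms sb]) simp
      (* AM-GM, so that no square roots of integrals are needed *)
      show "cmod (s i x) \<le> ?t / 2 + (cmod (s i x))\<^sup>2 / (2 * ?t)" for x
      proof -
        have "2 * cmod (s i x) * ?t \<le> (cmod (s i x))\<^sup>2 + ?t\<^sup>2" by (rule sum_squares_bound)
        then have "(2 * cmod (s i x) * ?t) / (2 * ?t) \<le> ((cmod (s i x))\<^sup>2 + ?t\<^sup>2) / (2 * ?t)"
          by (intro divide_right_mono) auto
        also have "\<dots> = (cmod (s i x))\<^sup>2 / (2 * ?t) + ?t\<^sup>2 / (2 * ?t)" by (rule add_divide_distrib)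
        also have "?t\<^sup>2 / (2 * ?t) = ?t / 2" by (simp add: power2_eq_square)
        finally show ?thesis by simp
      qed
    qed
    also have "\<dots> = ?t / 2 + sqnorm M (s i) / (2 * ?t)"
      unfolding sqnorm_def
      by (subst Bochner_Integration.integral_add)
         (auto intro!: bounded_measurable_integrable_sq[OF finite_measure_axioms sb] simp: prob_space)
    also have "sqnorm M (s i) \<le> (1 / 4) ^ i"
      using d(1)[of "r (Suc i)" "r i"] N[OF rN, of i "Suc i"] N[OF rN, of i i] unfolding s_def by simp
    then have "sqnorm M (s i) / (2 * ?t) \<le> (1 / 4) ^ i / (2 * ?t)" by (intro divide_right_mono) auto
    also have "(1 / 4) ^ i / (2 * ?t) = ?t / 2"
      by (simp add: power_divide power_mult_distrib[symmetric] field_simps flip: power_mult_distrib)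
    finally show ?thesis by simp
  qed
  have "(\<integral>\<^sup>+x. (\<Sum>i. ennreal (cmod (s i x))) \<partial>M) = (\<Sum>i. \<integral>\<^sup>+x. ennreal (cmod (s i x)) \<partial>M)"
    by (rule nn_integral_suminf) (use sb in measurable)
  also have "\<dots> \<le> (\<Sum>i. ennreal ((1 / 2) ^ i))"
  proof (rule suminf_le)
    show "(\<integral>\<^sup>+x. ennreal (cmod (s i x)) \<partial>M) \<le> ennreal ((1 / 2) ^ i)" for i
      using L1[of i] bounded_measurable_integrable[OF finite_measure_axioms sb, of i]
      by (subst nn_integral_eq_integral) (auto intro: ennreal_leI)
  qed auto
  also have "\<dots> = ennreal (\<Sum>i. (1 / 2) ^ i)"
    by (intro suminf_ennreal2) (auto intro: summable_geometric)
  also have "\<dots> < \<infinity>" by simp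
  finally have "(\<integral>\<^sup>+x. (\<Sum>i. ennreal (cmod (s i x))) \<partial>M) \<noteq> \<infinity>" by simp
  then have "AE x in M. (\<Sum>i. ennreal (cmod (s i x))) \<noteq> \<infinity>"
    by (intro nn_integral_PInf_AE) (use sb in measurable)
  then have conv: "AE x in M. convergent (\<lambda>i. u (r i) x)"
  proof eventually_elim
    case (elim x)
    have "summable (\<lambda>i. cmod (s i x))"
      by (rule summable_suminf_not_top) (use elim in auto)
    then have "summable (\<lambda>i. s i x)" by (rule summable_norm_cancel)
    then have "convergent (\<lambda>n. \<Sum>i<n. s i x)" by (simp add: summable_iff_convergent)
    then have "convergent (\<lambda>n. u (r n) x - u (r 0) x)"
      using sum_lessThan_telescope[of "\<lambda>i. u (r i) x"] by (simp add: s_def)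
    then show ?case by (simp only: convergent_diff_const_right_iff)
  qed
  define v0 where "v0 x = lim (\<lambda>i. u (r i) x)" for x
  \<comment> \<open>Cut off to be bounded everywhere, also at points where the subsequence diverges
    and \<open>lim\<close> is arbitrary. Almost everywhere nothing changes.\<close>
  define v where "v x = (if cmod (v0 x) \<le> C then v0 x else 0)" for x
  have [measurable]: "v0 \<in> borel_measurable M" unfolding v0_def using u(1) by measurable
  have vm: "v \<in> bounded_measurable M"
    by (rule bounded_measurableI[of _ _ C]) (auto simp: v_def[abs_def] C0)
  have lim: "AE x in M. (\<lambda>i. u (r i) x) \<longlonglongrightarrow> v x"
    using conv
  proof eventually_elim
    case (elim x)
    then have l: "(\<lambda>i. u (r i) x) \<longlonglongrightarrow> v0 x" by (simp add: v0_def convergent_LIMSEQ_iff)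
    have "cmod (v0 x) \<le> C" by (rule LIMSEQ_le_const2[OF tendsto_norm[OF l]]) (use u(2) in auto)
    then show ?case using l by (simp add: v_def)
  qed
  \<comment> \<open>Let the second index of the Cauchy estimate tend to infinity along
    \<open>r\<close>.\<close>
  have le: "sqnorm M (\<lambda>x. u n x - v x) \<le> d n" for n
  proof (rule LIMSEQ_le)
    show "(\<lambda>i. sqnorm M (\<lambda>x. u n x - u (r i) x)) \<longlonglongrightarrow> sqnorm M (\<lambda>x. u n x - v x)"
      unfolding sqnorm_def
    proof (rule integral_dominated_convergence[where w = "\<lambda>_. (C + C)\<^sup>2"])
      show "AE x in M. (\<lambda>i. (cmod (u n x - u (r i) x))\<^sup>2) \<longlonglongrightarrow> (cmod (u n x - v x))\<^sup>2"
        using lim by eventually_elim (intro tendsto_intros)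
      show "AE x in M. norm ((cmod (u n x - u (r i) x))\<^sup>2) \<le> (C + C)\<^sup>2" for i
      proof (rule AE_I2)
        fix x
        have "cmod (u n x - u (r i) x) \<le> C + C"
          by (rule order_trans[OF norm_triangle_ineq4 add_mono[OF u(2) u(2)]])
        from power_mono[OF this norm_ge_zero, of 2]
        show "norm ((cmod (u n x - u (r i) x))\<^sup>2) \<le> (C + C)\<^sup>2"
          by (simp only: real_norm_def abs_power2)
      qed
    qed (use u(1) vm in measurable)
    show "(\<lambda>i. d n + d (r i)) \<longlonglongrightarrow> d n"
      using tendsto_add[OF tendsto_const filterlim_compose[OF d(2) rlim], of "d n"] by simp
    show "\<exists>N. \<forall>i\<ge>N. sqnorm M (\<lambda>x. u n x - u (r i) x) \<le> d n + d (r i)" using d(1) by blast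
  qed
  have "(\<lambda>n. sqnorm M (\<lambda>x. u n x - v x)) \<longlonglongrightarrow> 0"
    by (rule tendsto_sandwich[OF _ _ tendsto_const d(2)]) (auto intro!: always_eventually le sqnorm_nonneg)
  then show ?thesis using that vm by blast
qed

section \<open>The mean ergodic theorem\<close>

text \<open>
  The averages of a nontrivial character tend to zero, hence by dominated convergence the averages
  of \<open>f\<close> form a Cauchy sequence: their differences are computed in \<open>L\<^sup>2(\<sigma>)\<close>.
\<close>

lemma koopman_average_L2_limit:
  fixes T :: "'g::{ab_group_add,countable} \<Rightarrow> 'x \<Rightarrow> 'x"
  assumes T: "mp_system M T" and F: "folner_sequence F" and f: "f \<in> bounded_measurable M"
    and \<sigma>: "spectral_measure M T f \<sigma>"
  obtains v where "v \<in> bounded_measurable M"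
    "(\<lambda>n. sqnorm M (\<lambda>x. folner_average F n (\<lambda>g. koopman T g f x) - v x)) \<longlonglongrightarrow> 0"
proof -
  interpret prob_space M using mp_systemD(1)[OF T] .
  interpret s: finite_measure \<sigma> using \<sigma> by (simp add: spectral_measure_def)
  have ss: "sets \<sigma> = sets dual_space" using \<sigma> by (simp add: spectral_measure_def)
  have sp: "space \<sigma> = characters"
    using ss[THEN sets_eq_imp_space_eq] by (simp add: space_dual_space)
  have ev: "(\<lambda>\<omega>. \<omega> g) \<in> borel_measurable \<sigma>" for g :: 'g
    using measurable_eval_dual_space measurable_cong_sets[OF ss refl] by blast
  \<comment> \<open>Set to \<open>0\<close> outside \<open>characters\<close>, so that the bound
    \<open>1\<close> holds at every point of the type.\<close>
  define \<phi> where "\<phi> n \<omega> = (if \<omega> \<in> characters then folner_average F n \<omega> else 0)"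
    for n and \<omega> :: "'g \<Rightarrow> complex"
  define \<psi> where "\<psi> \<omega> = (if \<omega> = (\<lambda>_. 1) then 1 else 0 :: complex)" for \<omega> :: "'g \<Rightarrow> complex"
  have \<phi>m: "\<phi> n \<in> borel_measurable \<sigma>" for n
  proof -
    have "(\<lambda>\<omega>. folner_average F n \<omega>) \<in> borel_measurable \<sigma>"
      unfolding folner_average_def by (intro borel_measurable_divide borel_measurable_sum ev) simp
    then show ?thesis by (rule measurable_cong[THEN iffD1, rotated]) (simp add: sp \<phi>_def)
  qed
  have \<phi>1: "cmod (\<phi> n \<omega>) \<le> 1" for n \<omega>
    using folner_average_norm_le[OF F, of \<omega> 1 n] by (auto simp: \<phi>_def norm_character)
  have lim: "(\<lambda>n. \<phi> n \<omega>) \<longlonglongrightarrow> \<psi> \<omega>" if "\<omega> \<in> space \<sigma>" for \<omega>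
    using that folner_average_character[OF F, of \<omega>] by (simp add: \<phi>_def \<psi>_def sp)
  have \<psi>m: "\<psi> \<in> borel_measurable \<sigma>" by (rule borel_measurable_LIMSEQ_metric[OF \<phi>m lim])
  have \<phi>b: "\<phi> n \<in> bounded_measurable \<sigma>" for n by (rule bounded_measurableI[OF \<phi>m \<phi>1])
  have \<psi>b: "\<psi> \<in> bounded_measurable \<sigma>" by (rule bounded_measurableI[OF \<psi>m, of 1]) (simp add: \<psi>_def)
  have "(\<lambda>n. sqnorm \<sigma> (\<lambda>\<omega>. \<phi> n \<omega> - \<psi> \<omega>)) \<longlonglongrightarrow> (\<integral>\<omega>. 0 \<partial>\<sigma>)"
    unfolding sqnorm_def
  proof (rule integral_dominated_convergence[where w = "\<lambda>_. (1 + 1)\<^sup>2"])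
    show "AE \<omega> in \<sigma>. (\<lambda>i. (cmod (\<phi> i \<omega> - \<psi> \<omega>))\<^sup>2) \<longlonglongrightarrow> 0"
    proof (rule AE_I2)
      fix \<omega> assume "\<omega> \<in> space \<sigma>"
      then have "(\<lambda>i. (cmod (\<phi> i \<omega> - \<psi> \<omega>))\<^sup>2) \<longlonglongrightarrow> (cmod (\<psi> \<omega> - \<psi> \<omega>))\<^sup>2"
        by (intro tendsto_intros lim)
      then show "(\<lambda>i. (cmod (\<phi> i \<omega> - \<psi> \<omega>))\<^sup>2) \<longlonglongrightarrow> 0" by simp
    qed
    show "AE \<omega> in \<sigma>. norm ((cmod (\<phi> i \<omega> - \<psi> \<omega>))\<^sup>2) \<le> (1 + 1)\<^sup>2" for i
    proof (intro AE_I2)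
      fix \<omega>
      have "cmod (\<phi> i \<omega> - \<psi> \<omega>) \<le> 1 + 1"
        by (rule order_trans[OF norm_triangle_ineq4 add_mono[OF \<phi>1]]) (simp add: \<psi>_def)
      from power_mono[OF this norm_ge_zero, of 2]
      show "norm ((cmod (\<phi> i \<omega> - \<psi> \<omega>))\<^sup>2) \<le> (1 + 1)\<^sup>2" by (simp only: real_norm_def abs_power2)
    qed
  qed (use \<phi>m \<psi>m in measurable)
  then have d0: "(\<lambda>n. 2 * sqnorm \<sigma> (\<lambda>\<omega>. \<phi> n \<omega> - \<psi> \<omega>)) \<longlonglongrightarrow> 0"
    by (simp add: tendsto_mult_right_zero)
  let ?u = "\<lambda>n x. folner_average F n (\<lambda>g. koopman T g f x)"
  obtain C where C: "\<And>x. cmod (f x) \<le> C" using bounded_measurableD[OF f] by auto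
  have fin: "finite (F n)" for n using F by (simp add: folner_sequence_def)
  have diff: "sqnorm M (\<lambda>x. ?u n x - ?u k x) = sqnorm \<sigma> (\<lambda>\<omega>. \<phi> n \<omega> - \<phi> k \<omega>)" for n k
  proof -
    \<comment> \<open>The difference of two averages is one linear combination over
      \<open>F n \<union> F k\<close>, to which the spectral isometry applies.\<close>
    define q where "q g = (if g \<in> F n then 1 / of_nat (card (F n)) else 0) -
      (if g \<in> F k then 1 / of_nat (card (F k)) else 0 :: complex)" for g
    have q: "folner_average F n b - folner_average F k b = (\<Sum>g\<in>F n \<union> F k. q g * b g)" for b
    proof -
      have "folner_average F n b = (\<Sum>g\<in>F n \<union> F k. (if g \<in> F n then 1 / of_nat (card (F n)) else 0) * b g)"
        unfolding folner_average_def sum_divide_distrib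
        by (rule sum.mono_neutral_cong_left) (use fin in auto)
      moreover have "folner_average F k b = (\<Sum>g\<in>F n \<union> F k. (if g \<in> F k then 1 / of_nat (card (F k)) else 0) * b g)"
        unfolding folner_average_def sum_divide_distrib
        by (rule sum.mono_neutral_cong_left) (use fin in auto)
      ultimately show ?thesis by (simp only: q_def sum_subtractf[symmetric] left_diff_distrib)
    qed
    have "sqnorm M (\<lambda>x. ?u n x - ?u k x) = (\<integral>\<omega>. (cmod (\<Sum>g\<in>F n \<union> F k. q g * \<omega> g))\<^sup>2 \<partial>\<sigma>)"
      unfolding q by (rule sqnorm_koopman_sum[OF T f \<sigma>])
    also have "\<dots> = sqnorm \<sigma> (\<lambda>\<omega>. \<phi> n \<omega> - \<phi> k \<omega>)"
      unfolding sqnorm_def q[symmetric]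
      by (rule Bochner_Integration.integral_cong) (simp_all add: sp \<phi>_def)
    finally show ?thesis .
  qed
  show ?thesis
  proof (rule bounded_L2_Cauchy_limit[OF prob_space_axioms, of ?u C])
    show "?u n \<in> borel_measurable M" for n
      by (intro bounded_measurable_measurable bounded_measurable_folner_average
          bounded_measurable_koopman T f)
    show "cmod (?u n x) \<le> C" for n x
      by (rule folner_average_norm_le[OF F]) (simp add: koopman_def C)
    show "sqnorm M (\<lambda>x. ?u n x - ?u k x) \<le>
        2 * sqnorm \<sigma> (\<lambda>\<omega>. \<phi> n \<omega> - \<psi> \<omega>) + 2 * sqnorm \<sigma> (\<lambda>\<omega>. \<phi> k \<omega> - \<psi> \<omega>)" for n k
      unfolding diff sqnorm_minus_commute[of \<sigma> "\<phi> k" \<psi>]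
      by (intro sqnorm_diff_triangle s.finite_measure_axioms \<phi>b \<psi>b)
  qed (use d0 that in auto)
qed

lemma sqnorm_cong: "(\<And>x. x \<in> space M \<Longrightarrow> u x = v x) \<Longrightarrow> sqnorm M u = sqnorm M v"
  unfolding sqnorm_def by (rule Bochner_Integration.integral_cong) simp_all

lemma koopman_koopman:
  assumes "mp_system M T" "x \<in> space M"
  shows "koopman T g f (T (- h) x) = koopman T (g + h) f x"
  using mp_systemD(5)[OF assms, of "- g" "- h"] by (simp add: koopman_def)

text \<open>Translating an average of translates only shifts its index, so the averages are
  invariant up to a Folner defect and the limit is invariant exactly.\<close>

lemma koopman_average_limit_invariant:
  fixes T :: "'g::{ab_group_add,countable} \<Rightarrow> 'x \<Rightarrow> 'x"
  assumes T: "mp_system M T" and F: "folner_sequence F" and f: "f \<in> bounded_measurable M"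
    and v: "v \<in> bounded_measurable M"
    and lim: "(\<lambda>n. sqnorm M (\<lambda>x. folner_average F n (\<lambda>g. koopman T g f x) - v x)) \<longlonglongrightarrow> 0"
  shows "AE x in M. v (T h x) = v x"
proof -
  interpret prob_space M using mp_systemD(1)[OF T] .
  obtain C where C: "\<And>x. cmod (f x) \<le> C" using bounded_measurableD[OF f] by auto
  let ?u = "\<lambda>n x. folner_average F n (\<lambda>g. koopman T g f x)"
  let ?s = "\<lambda>n. sqnorm M (\<lambda>x. ?u n x - v x)"
  have bu: "?u n \<in> bounded_measurable M" for n
    by (intro bounded_measurable_folner_average bounded_measurable_koopman T f)
  note bm = bounded_measurable_intros T f v bu
  let ?w = "koopman T (- h) v"
  \<comment> \<open>Two uses of the triangle inequality with factor \<open>2\<close>: the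
    coefficient \<open>6\<close> is \<open>2 + 2 * 2\<close>, the first \<open>2\<close> coming from
    the translated error, whose norm \<open>T\<close> preserves.\<close>
  have "sqnorm M (\<lambda>x. ?w x - v x) \<le> 6 * ?s n + 4 * (C * folner_defect F (- h) n)\<^sup>2" for n
  proof -
    let ?u' = "koopman T (- h) (?u n)"
    have "sqnorm M (\<lambda>x. ?w x - v x) \<le> 2 * sqnorm M (\<lambda>x. ?w x - ?u' x) + 2 * sqnorm M (\<lambda>x. ?u' x - v x)"
      by (intro sqnorm_diff_triangle finite_measure_axioms bm)
    also have "sqnorm M (\<lambda>x. ?u' x - v x) \<le> 2 * sqnorm M (\<lambda>x. ?u' x - ?u n x) + 2 * ?s n"
      by (intro sqnorm_diff_triangle finite_measure_axioms bm)
    also have "sqnorm M (\<lambda>x. ?w x - ?u' x) = ?s n"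
    proof -
      have "sqnorm M (\<lambda>x. ?w x - ?u' x) = sqnorm M (koopman T (- h) (\<lambda>x. v x - ?u n x))"
        by (simp add: koopman_def)
      also have "\<dots> = sqnorm M (\<lambda>x. v x - ?u n x)" by (intro sqnorm_koopman bm)
      finally show ?thesis by (simp only: sqnorm_minus_commute[of M v])
    qed
    also have "sqnorm M (\<lambda>x. ?u' x - ?u n x) \<le> (C * folner_defect F (- h) n)\<^sup>2"
    proof (intro sqnorm_le_bound prob_space_axioms bm)
      fix x assume x: "x \<in> space M"
      have "?u' x = folner_average F n (\<lambda>g. koopman T (g + - h) f x)"
        using koopman_koopman[OF T x, of _ f "- h"] by (simp add: koopman_def)
      then show "cmod (?u' x - ?u n x) \<le> C * folner_defect F (- h) n"
        using folner_average_shift[OF F, of "\<lambda>g. koopman T g f x" C n "- h"]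
        by (simp add: koopman_def C)
    qed
    finally show ?thesis by simp
  qed
  moreover have "(\<lambda>n. 6 * ?s n + 4 * (C * folner_defect F (- h) n)\<^sup>2) \<longlonglongrightarrow> 6 * 0 + 4 * (C * 0)\<^sup>2"
    by (intro tendsto_intros lim folner_defect_tendsto F)
  ultimately have "sqnorm M (\<lambda>x. ?w x - v x) \<le> 6 * 0 + 4 * (C * 0)\<^sup>2"
    by (intro LIMSEQ_le_const) auto
  then have "sqnorm M (\<lambda>x. ?w x - v x) = 0" using sqnorm_nonneg[of M] by (simp add: order_antisym)
  then have "AE x in M. ?w x - v x = 0" by (intro sqnorm_eq_0_AE finite_measure_axioms bm)
  then show ?thesis by (simp add: koopman_def)
qed

section \<open>Invariant sets and the conditional expectation\<close>

lemma mp_system_image: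
  assumes "mp_system M T" "A \<in> sets M"
  shows "T g ` A = {x \<in> space M. T (- g) x \<in> A}"
proof -
  have "A \<subseteq> space M" using sets.sets_into_space[OF assms(2)] .
  show ?thesis
  proof (intro equalityI subsetI)
    fix x assume "x \<in> T g ` A"
    then show "x \<in> {x \<in> space M. T (- g) x \<in> A}"
      using \<open>A \<subseteq> space M\<close> mp_systemD(6)[OF assms(1)] mp_system_inverse(1)[OF assms(1)] by auto
  next
    fix x assume "x \<in> {x \<in> space M. T (- g) x \<in> A}"
    then show "x \<in> T g ` A"
      using mp_system_inverse(2)[OF assms(1), of x g] by (metis (mono_tags, lifting) imageI mem_Collect_eq)
  qed
qed

text \<open>An almost everywhere equivalence combines well with complements, countable unions and
  conjugation, unlike the measure of a symmetric difference of images.\<close>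

lemma invariant_sets_iff:
  assumes T: "mp_system M T"
  shows "A \<in> invariant_sets M H T \<longleftrightarrow> A \<in> sets M \<and> (\<forall>g\<in>H. AE x in M. T (- g) x \<in> A \<longleftrightarrow> x \<in> A)"
proof -
  interpret prob_space M using mp_systemD(1)[OF T] .
  have "measure M (sym_diff A (T g ` A)) = 0 \<longleftrightarrow> (AE x in M. T (- g) x \<in> A \<longleftrightarrow> x \<in> A)"
    if A: "A \<in> sets M" for g
  proof -
    note [measurable] = A mp_systemD(2)[OF T]
    have eq: "sym_diff A (T g ` A) = {x \<in> space M. \<not> (T (- g) x \<in> A \<longleftrightarrow> x \<in> A)}"
      using sets.sets_into_space[OF A] by (auto simp: mp_system_image[OF T A])
    have "(AE x in M. T (- g) x \<in> A \<longleftrightarrow> x \<in> A) \<longleftrightarrow> emeasure M (sym_diff A (T g ` A)) = 0"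
      by (rule AE_iff_measurable[OF _ eq[symmetric]]) (unfold eq, measurable)
    then show ?thesis by (simp add: emeasure_eq_measure)
  qed
  then show ?thesis by (auto simp: invariant_sets_def)
qed

text \<open>Shows that generating a sigma-algebra in \<open>invariant_algebra\<close> adds no sets,
  so measurability of a function can be tested by the invariance of its preimages.\<close>

lemma sigma_algebra_invariant_sets:
  assumes T: "mp_system M T"
  shows "sigma_algebra (space M) (invariant_sets M H T)"
  unfolding sigma_algebra_iff2
proof (intro conjI ballI allI impI)
  show "invariant_sets M H T \<subseteq> Pow (space M)"
    using sets.sets_into_space by (auto simp: invariant_sets_def)
  show "{} \<in> invariant_sets M H T" by (simp add: invariant_sets_iff[OF T])
  fix A assume A: "A \<in> invariant_sets M H T"
  have "AE x in M. T (- g) x \<in> space M - A \<longleftrightarrow> x \<in> space M - A" if "g \<in> H" for g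
  proof -
    have "AE x in M. T (- g) x \<in> A \<longleftrightarrow> x \<in> A" using A that by (simp add: invariant_sets_iff[OF T])
    then show ?thesis using AE_space by eventually_elim (simp add: mp_systemD(6)[OF T])
  qed
  then show "space M - A \<in> invariant_sets M H T"
    using A unfolding invariant_sets_iff[OF T] by (intro conjI ballI sets.compl_sets) auto
next
  fix A :: "nat \<Rightarrow> _" assume "range A \<subseteq> invariant_sets M H T"
  then have A: "A i \<in> invariant_sets M H T" for i by auto
  have "AE x in M. T (- g) x \<in> (\<Union>i. A i) \<longleftrightarrow> x \<in> (\<Union>i. A i)" if "g \<in> H" for g
  proof -
    have "AE x in M. \<forall>i. T (- g) x \<in> A i \<longleftrightarrow> x \<in> A i"
      using A that by (simp add: invariant_sets_iff[OF T] AE_all_countable)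
    then show ?thesis by eventually_elim simp
  qed
  then show "(\<Union>i. A i) \<in> invariant_sets M H T"
    using A unfolding invariant_sets_iff[OF T] by (intro conjI ballI sets.countable_nat_UN) auto
qed

lemma sets_invariant_algebra:
  "mp_system M T \<Longrightarrow> sets (invariant_algebra M T) = invariant_sets M UNIV T"
  unfolding invariant_algebra_def using sigma_algebra_invariant_sets[of M T UNIV]
  by (simp add: sigma_algebra.sets_measure_of_eq)

lemma space_invariant_algebra: "mp_system M T \<Longrightarrow> space (invariant_algebra M T) = space M"
  unfolding invariant_algebra_def
  by (rule space_measure_of) (auto simp: invariant_sets_def dest: sets.sets_into_space)

lemma subalgebra_invariant_algebra: "mp_system M T \<Longrightarrow> subalgebra M (invariant_algebra M T)"
  by (auto simp: subalgebra_def space_invariant_algebra sets_invariant_algebra invariant_sets_def)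

lemma complex_cond_exp_charact:
  assumes M: "prob_space M" and sub: "subalgebra M N"
    and f: "f \<in> bounded_measurable M" and v: "v \<in> bounded_measurable M" "v \<in> borel_measurable N"
    and eq: "\<And>A. A \<in> sets N \<Longrightarrow> (\<integral>x. f x * indicator A x \<partial>M) = (\<integral>x. v x * indicator A x \<partial>M)"
  shows "AE x in M. complex_cond_exp M N f x = v x"
proof -
  interpret prob_space M by fact
  interpret finite_measure_subalgebra M N by unfold_locales (rule sub)
  have AM: "A \<in> sets M" if "A \<in> sets N" for A using sub that by (auto simp: subalgebra_def)
  have i: "integrable M f" "integrable M v"
    using f v(1) by (auto intro: bounded_measurable_integrable finite_measure_axioms)
  have i2: "integrable M (\<lambda>x. u x * indicator A x)" if "u \<in> bounded_measurable M" "A \<in> sets N" for u A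
    using that AM by (intro bounded_measurable_integrable finite_measure_axioms
        bounded_measurable_mult bounded_measurable_indicator)
  have Re: "(\<integral>x\<in>A. Re (u x) \<partial>M) = Re (\<integral>x. u x * indicator A x \<partial>M)"
    and Im: "(\<integral>x\<in>A. Im (u x) \<partial>M) = Im (\<integral>x. u x * indicator A x \<partial>M)"
    if "u \<in> bounded_measurable M" "A \<in> sets N" for u A
    unfolding set_lebesgue_integral_def integral_Re[OF i2[OF that], symmetric] integral_Im[OF i2[OF that], symmetric]
    by (auto intro!: Bochner_Integration.integral_cong simp: indicator_def)
  have "AE x in M. real_cond_exp M N (\<lambda>x. Re (f x)) x = Re (v x)"
    by (rule real_cond_exp_charact) (use i v(2) in \<open>auto simp: Re f v(1) eq\<close>)
  moreover have "AE x in M. real_cond_exp M N (\<lambda>x. Im (f x)) x = Im (v x)"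
    by (rule real_cond_exp_charact) (use i v(2) in \<open>auto simp: Im f v(1) eq\<close>)
  ultimately show ?thesis
    by eventually_elim (simp add: complex_cond_exp_def)
qed

text \<open>Almost everywhere the indicator of \<open>A\<close> may be translated along with
  \<open>f\<close>; then \<open>T\<close> preserves the integral of the product.\<close>

lemma invariant_integral_koopman:
  assumes T: "mp_system M T" and f: "f \<in> bounded_measurable M" and A: "A \<in> invariant_sets M UNIV T"
  shows "(\<integral>x. koopman T g f x * indicator A x \<partial>M) = (\<integral>x. f x * indicator A x \<partial>M)"
proof -
  have Am [measurable]: "A \<in> sets M" and ae: "AE x in M. T (- g) x \<in> A \<longleftrightarrow> x \<in> A"
    using A by (auto simp: invariant_sets_iff[OF T])
  note [measurable] = mp_systemD(2)[OF T] bounded_measurable_measurable[OF f]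
  have "(\<integral>x. koopman T g f x * indicator A x \<partial>M) = (\<integral>x. f (T (- g) x) * indicator A (T (- g) x) \<partial>M)"
    unfolding koopman_def
  proof (rule integral_cong_AE)
    show "AE x in M. f (T (- g) x) * indicator A x = f (T (- g) x) * indicator A (T (- g) x)"
      using ae by eventually_elim (simp add: indicator_def)
  qed measurable
  also have "\<dots> = (\<integral>x. f x * indicator A x \<partial>M)"
    by (rule mp_system_integral[OF T, of "\<lambda>x. f x * indicator A x"]) measurable
  finally show ?thesis .
qed

text \<open>The spectral measure is that of \<open>f\<close> minus a constant because singular
  spectrum supplies one for mean-zero functions; the constant is added back in \<open>v\<close>. The
  limit is the conditional expectation: it is invariant and, like every average, has the integrals
  of \<open>f\<close> over invariant sets.\<close>

lemma mean_ergodic_folner: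
  fixes T :: "'g::{ab_group_add,countable} \<Rightarrow> 'x \<Rightarrow> 'x"
  assumes T: "mp_system M T" and F: "folner_sequence F" and f: "f \<in> bounded_measurable M"
    and \<sigma>: "spectral_measure M T (\<lambda>x. f x - c) \<sigma>"
  obtains v where "v \<in> bounded_measurable M"
    "AE x in M. complex_cond_exp M (invariant_algebra M T) f x = v x"
    "(\<lambda>n. sqnorm M (\<lambda>x. folner_average F n (\<lambda>g. koopman T g f x) - v x)) \<longlonglongrightarrow> 0"
proof -
  interpret prob_space M using mp_systemD(1)[OF T] .
  have "(\<lambda>x. f x - c) \<in> bounded_measurable M" by (intro bounded_measurable_intros f)
  from koopman_average_L2_limit[OF T F this \<sigma>] obtain v0 where v0: "v0 \<in> bounded_measurable M"
    "(\<lambda>n. sqnorm M (\<lambda>x. folner_average F n (\<lambda>g. koopman T g (\<lambda>x. f x - c) x) - v0 x)) \<longlonglongrightarrow> 0"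
    by blast
  define v where "v x = v0 x + c" for x
  have v: "v \<in> bounded_measurable M" unfolding v_def by (intro bounded_measurable_intros v0)
  let ?u = "\<lambda>n x. folner_average F n (\<lambda>g. koopman T g f x)"
  have "folner_average F n (\<lambda>g. koopman T g (\<lambda>x. f x - c) x) - v0 x = ?u n x - v x" for n x
    using folner_sequence_card_pos[OF F, of n]
    by (simp add: folner_average_def koopman_def sum_subtractf v_def diff_divide_distrib)
  with v0(2) have lim: "(\<lambda>n. sqnorm M (\<lambda>x. ?u n x - v x)) \<longlonglongrightarrow> 0" by simp
  have bu: "?u n \<in> bounded_measurable M" for n
    by (intro bounded_measurable_folner_average bounded_measurable_koopman T f)
  note inv = koopman_average_limit_invariant[OF T F f v lim]
  have vN: "v \<in> borel_measurable (invariant_algebra M T)"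
  proof (rule measurableI)
    fix B :: "complex set" assume B: "B \<in> sets borel"
    have "v -` B \<inter> space M \<in> invariant_sets M UNIV T"
      unfolding invariant_sets_iff[OF T]
    proof (intro conjI ballI)
      show "v -` B \<inter> space M \<in> sets M"
        by (rule measurable_sets[OF bounded_measurable_measurable[OF v] B])
      show "AE x in M. T (- g) x \<in> v -` B \<inter> space M \<longleftrightarrow> x \<in> v -` B \<inter> space M" for g
        using inv[of "- g"] AE_space by eventually_elim (simp add: mp_systemD(6)[OF T])
    qed
    then show "v -` B \<inter> space (invariant_algebra M T) \<in> sets (invariant_algebra M T)"
      by (simp add: sets_invariant_algebra[OF T] space_invariant_algebra[OF T])
  qed simp
  have "AE x in M. complex_cond_exp M (invariant_algebra M T) f x = v x"
  proof (rule complex_cond_exp_charact[OF prob_space_axioms subalgebra_invariant_algebra[OF T] f v vN])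
    fix A assume A: "A \<in> sets (invariant_algebra M T)"
    then have AI: "A \<in> invariant_sets M UNIV T" by (simp add: sets_invariant_algebra[OF T])
    then have Am: "A \<in> sets M" by (simp add: invariant_sets_def)
    have "(\<integral>x. ?u n x * indicator A x \<partial>M) = (\<integral>x. f x * indicator A x \<partial>M)" for n
    proof -
      have "(\<integral>x. ?u n x * indicator A x \<partial>M) =
          (\<integral>x. (\<Sum>g\<in>F n. koopman T g f x * indicator A x) / of_nat (card (F n)) \<partial>M)"
        by (simp add: folner_average_def sum_distrib_right)
      also have "\<dots> = (\<Sum>g\<in>F n. \<integral>x. koopman T g f x * indicator A x \<partial>M) / of_nat (card (F n))"
        by (subst integral_divide_zero, subst Bochner_Integration.integral_sum)
           (auto intro!: bounded_measurable_integrable finite_measure_axioms bounded_measurable_mult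
             bounded_measurable_indicator bounded_measurable_koopman T f Am)
      also have "\<dots> = (\<integral>x. f x * indicator A x \<partial>M)"
        using folner_sequence_card_pos[OF F, of n] by (simp add: invariant_integral_koopman[OF T f AI])
      finally show ?thesis .
    qed
    moreover have "(\<lambda>n. \<integral>x. ?u n x * indicator A x \<partial>M) \<longlonglongrightarrow> (\<integral>x. v x * indicator A x \<partial>M)"
      by (intro sqnorm_mult_tendsto_integral prob_space_axioms bu v bounded_measurable_indicator Am lim)
    ultimately have "(\<lambda>n::nat. \<integral>x. f x * indicator A x \<partial>M) \<longlonglongrightarrow> (\<integral>x. v x * indicator A x \<partial>M)" by simp
    then show "(\<integral>x. f x * indicator A x \<partial>M) = (\<integral>x. v x * indicator A x \<partial>M)"
      by (rule LIMSEQ_unique[OF tendsto_const])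
  qed
  then show ?thesis by (rule that[OF v _ lim])
qed

section \<open>Transfer to systems on sets of reals\<close>

text \<open>
  \<^const>\<open>jointly_ergodic\<close> only speaks about systems on sets of reals; a Polish space embeds into the
  reals as a set, by recording which members of a countable base contain a given point.
\<close>

lemma second_countable_t1_inj_real:
  assumes "second_countable X" "t1_space X"
  obtains \<phi> :: "'a \<Rightarrow> real" where "inj_on \<phi> (topspace X)"
proof -
  obtain B where B: "countable B" "\<And>V. V \<in> B \<Longrightarrow> openin X V"
    "\<And>U x. openin X U \<Longrightarrow> x \<in> U \<Longrightarrow> \<exists>V\<in>B. x \<in> V \<and> V \<subseteq> U"
    using assms(1) unfolding second_countable_def by metis
  obtain \<beta> :: "nat set \<Rightarrow> real" where \<beta>: "inj \<beta>"
    using nat_sets_eqpoll_reals unfolding eqpoll_def bij_betw_def by blast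
  define c where "c x = to_nat_on B ` {V \<in> B. x \<in> V}" for x
  have "inj_on c (topspace X)"
  proof (rule inj_onI, rule ccontr)
    fix x y assume xy: "x \<in> topspace X" "y \<in> topspace X" "c x = c y" "x \<noteq> y"
    then obtain U where "openin X U" "x \<in> U" "y \<notin> U"
      using assms(2) unfolding t1_space_def by blast
    then obtain V where V: "V \<in> B" "x \<in> V" "y \<notin> V" using B(3) by blast
    then have "to_nat_on B V \<in> c y" using xy(3) by (auto simp: c_def)
    then obtain W where "W \<in> B" "y \<in> W" "to_nat_on B W = to_nat_on B V" by (auto simp: c_def)
    then show False using V inj_on_to_nat_on[OF B(1)] by (metis inj_onD)
  qed
  then have "inj_on (\<beta> \<circ> c) (topspace X)"
    using \<beta> by (intro comp_inj_on) (auto intro: inj_on_subset)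
  then show ?thesis by (rule that)
qed

lemma standard_probability_space_inj_real:
  assumes "standard_probability_space M"
  obtains \<phi> :: "'x \<Rightarrow> real" where "inj_on \<phi> (space M)"
proof -
  obtain X where X: "completely_metrizable_space X" "second_countable X" "topspace X = space M"
    using assms by (auto simp: standard_probability_space_def)
  then have "t1_space X"
    by (intro Hausdorff_imp_t1_space metrizable_imp_Hausdorff_space
        completely_metrizable_imp_metrizable_space)
  from second_countable_t1_inj_real[OF X(2) this] that X(3) show ?thesis by metis
qed

text \<open>The topology is pulled back along the inverse of \<open>\<phi>\<close>, which makes
  \<open>\<phi>\<close> a homeomorphism onto its image. The Polish structure thus comes from
  \<open>M\<close> and not from the target type.\<close>

lemma standard_probability_space_embed:
  assumes M: "standard_probability_space M" and inj: "inj_on \<phi> (space M)"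
  shows "standard_probability_space (embed_measure M \<phi>)"
proof -
  define \<psi> where "\<psi> = the_inv_into (space M) \<phi>"
  have \<psi>: "\<psi> (\<phi> x) = x" if "x \<in> space M" for x
    using that inj by (simp add: \<psi>_def the_inv_into_f_f)
  obtain X where X: "completely_metrizable_space X" "second_countable X" "topspace X = space M"
    "sets M = sigma_sets (space M) {U. openin X U}"
    using M by (auto simp: standard_probability_space_def)
  interpret prob_space M using M by (simp add: standard_probability_space_def)
  let ?N = "embed_measure M \<phi>"
  let ?Y = "pullback_topology (\<phi> ` space M) \<psi> X"
  have top: "topspace ?Y = \<phi> ` space M"
    unfolding topspace_pullback_topology using \<psi> X(3) by auto
  have "homeomorphic_maps X ?Y \<phi> \<psi>"
    unfolding homeomorphic_maps_def
  proof (intro conjI ballI)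
    show "continuous_map X ?Y \<phi>"
      unfolding continuous_map
    proof (intro conjI allI impI)
      show "\<phi> ` topspace X \<subseteq> topspace ?Y" by (simp add: top X(3))
      fix U assume "openin ?Y U"
      then obtain V where V: "openin X V" "U = \<psi> -` V \<inter> \<phi> ` space M"
        by (auto simp: openin_pullback_topology)
      have "{x \<in> topspace X. \<phi> x \<in> U} = V"
        using V openin_subset[OF V(1)] by (auto simp: X(3) \<psi> dest: inj_onD[OF inj])
      then show "openin X {x \<in> topspace X. \<phi> x \<in> U}" using V by simp
    qed
    show "continuous_map ?Y X \<psi>"
      unfolding continuous_map
    proof (intro conjI allI impI)
      show "\<psi> ` topspace ?Y \<subseteq> topspace X" by (auto simp: top X(3) \<psi>)
      fix U assume "openin X U"
      then show "openin ?Y {x \<in> topspace ?Y. \<psi> x \<in> U}"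
        by (auto simp: openin_pullback_topology top intro!: exI[of _ U])
    qed
  qed (auto simp: top X(3) \<psi>)
  then have hom: "X homeomorphic_space ?Y" unfolding homeomorphic_space_def by blast
  have "sets ?N = {\<psi> -` A \<inter> \<phi> ` space M | A. A \<in> sigma_sets (space M) {U. openin X U}}"
  proof -
    \<comment> \<open>Images under \<open>\<phi>\<close> are rewritten as preimages under
      \<open>\<psi>\<close>, because preimages commute with generating a sigma-algebra.\<close>
    have eq: "\<phi> ` A = \<psi> -` A \<inter> \<phi> ` space M" if "A \<in> sets M" for A
      unfolding \<psi>_def by (rule the_inv_into_vimage[OF inj sets.sets_into_space[OF that], symmetric])
    have "(B = \<phi> ` A \<and> A \<in> sets M) = (B = \<psi> -` A \<inter> \<phi> ` space M \<and> A \<in> sets M)" for A B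
      by (metis eq)
    then show ?thesis unfolding sets_embed_measure'[OF inj] X(4)[symmetric] by (simp only:)
  qed
  also have "\<dots> = sigma_sets (\<phi> ` space M) {\<psi> -` A \<inter> \<phi> ` space M | A. A \<in> {U. openin X U}}"
    by (rule sigma_sets_vimage_commute) (auto simp: \<psi>)
  also have "{\<psi> -` A \<inter> \<phi> ` space M | A. A \<in> {U. openin X U}} = {U. openin ?Y U}"
    by (auto simp: openin_pullback_topology)
  finally have sets: "sets ?N = sigma_sets (space ?N) {U. openin ?Y U}"
    by (simp add: space_embed_measure)
  have "prob_space ?N"
    by (subst embed_measure_eq_distr'[OF inj])
       (rule prob_space_distr[OF measurable_embed_measure2'[OF inj]])
  moreover have "completely_metrizable_space ?Y" "second_countable ?Y"
    using X(1,2) homeomorphic_completely_metrizable_space[OF hom]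
      homeomorphic_space_second_countability[OF hom] by auto
  moreover have "topspace ?Y = space ?N" by (simp only: top space_embed_measure)
  ultimately show ?thesis
    unfolding standard_probability_space_def using sets by (intro conjI exI[of _ ?Y])
qed

section \<open>Conjugating an action by an injection\<close>

definition conjugate_action ::
  "'x set \<Rightarrow> ('x \<Rightarrow> 'y) \<Rightarrow> ('g \<Rightarrow> 'x \<Rightarrow> 'x) \<Rightarrow> 'g \<Rightarrow> 'y \<Rightarrow> 'y" where
  "conjugate_action A \<phi> S g = (\<lambda>y. \<phi> (S g (the_inv_into A \<phi> y)))"

lemma conjugate_action_apply:
  "inj_on \<phi> A \<Longrightarrow> x \<in> A \<Longrightarrow> conjugate_action A \<phi> S g (\<phi> x) = \<phi> (S g x)"
  by (simp add: conjugate_action_def the_inv_into_f_f)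

lemma measurable_the_inv_into_embed:
  assumes inj: "inj_on \<phi> (space M)"
  shows "the_inv_into (space M) \<phi> \<in> measurable (embed_measure M \<phi>) M"
proof (rule measurable_embed_measure1)
  have "(\<lambda>x. x) \<in> measurable M M" by simp
  then show "(\<lambda>x. the_inv_into (space M) \<phi> (\<phi> x)) \<in> measurable M M"
    by (rule measurable_cong[THEN iffD1, rotated]) (simp add: the_inv_into_f_f inj)
qed

lemma measurable_conjugate_action:
  assumes inj: "inj_on \<phi> (space M)" and "S g \<in> measurable M M"
  shows "conjugate_action (space M) \<phi> S g \<in> measurable (embed_measure M \<phi>) (embed_measure M \<phi>)"
  unfolding conjugate_action_def
  by (intro measurable_compose[OF measurable_the_inv_into_embed[OF inj]]
      measurable_compose[OF assms(2)] measurable_embed_measure2' inj)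

lemma mp_system_conjugate:
  assumes S: "mp_system M S" and inj: "inj_on \<phi> (space M)"
  shows "mp_system (embed_measure M \<phi>) (conjugate_action (space M) \<phi> S)"
proof -
  let ?N = "embed_measure M \<phi>" and ?R = "conjugate_action (space M) \<phi> S"
  note \<phi> = measurable_embed_measure2'[OF inj]
  have R: "?R g \<in> measurable ?N ?N" for g
    by (rule measurable_conjugate_action[OF inj mp_systemD(2)[OF S]])
  have N: "distr M ?N \<phi> = ?N" by (rule embed_measure_eq_distr'[OF inj, symmetric])
  have "distr ?N ?N (?R g) = ?N" for g
  proof -
    have "distr ?N ?N (?R g) = distr (distr M ?N \<phi>) ?N (?R g)" by (simp only: N)
    also have "\<dots> = distr M ?N (?R g \<circ> \<phi>)" by (rule distr_distr[OF R \<phi>])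
    also have "\<dots> = distr M ?N (\<phi> \<circ> S g)"
      by (rule distr_cong) (simp_all add: conjugate_action_apply[OF inj])
    also have "\<dots> = distr (distr M M (S g)) ?N \<phi>"
      by (rule distr_distr[OF \<phi> mp_systemD(2)[OF S], symmetric])
    also have "\<dots> = ?N" by (simp only: mp_systemD(3)[OF S] N)
    finally show ?thesis .
  qed
  then show ?thesis
    unfolding mp_system_def
    using standard_probability_space_embed[OF _ inj] S R
    by (auto simp: mp_system_def space_embed_measure conjugate_action_apply[OF inj]
        mp_systemD(4,5,6)[OF S])
qed

text \<open>The preimage of an invariant set is invariant and has the same measure. Keeping
  \<open>H\<close> arbitrary transfers ergodicity and total ergodicity together.\<close>

lemma ergodic_on_conjugate:
  assumes S: "mp_system M S" and inj: "inj_on \<phi> (space M)" and erg: "ergodic_on M H S"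
  shows "ergodic_on (embed_measure M \<phi>) H (conjugate_action (space M) \<phi> S)"
  unfolding ergodic_on_def
proof
  let ?N = "embed_measure M \<phi>" and ?R = "conjugate_action (space M) \<phi> S"
  fix B assume "B \<in> invariant_sets ?N H ?R"
  then have B: "B \<in> sets ?N" "\<And>g. g \<in> H \<Longrightarrow> AE x in ?N. ?R (- g) x \<in> B \<longleftrightarrow> x \<in> B"
    by (auto simp: invariant_sets_iff[OF mp_system_conjugate[OF S inj]])
  let ?A = "\<phi> -` B \<inter> space M"
  have "?A \<in> invariant_sets M H S"
    unfolding invariant_sets_iff[OF S]
  proof (intro conjI ballI)
    show "?A \<in> sets M" by (rule measurable_sets[OF measurable_embed_measure2'[OF inj] B(1)])
    fix g assume "g \<in> H"
    from B(2)[OF this] have "AE x in M. ?R (- g) (\<phi> x) \<in> B \<longleftrightarrow> \<phi> x \<in> B"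
      by (simp only: AE_embed_measure'[OF inj])
    then show "AE x in M. S (- g) x \<in> ?A \<longleftrightarrow> x \<in> ?A"
      using AE_space
      by eventually_elim (simp add: conjugate_action_apply[OF inj] mp_systemD(6)[OF S])
  qed
  then have "measure M ?A \<in> {0, 1}" using erg by (simp add: ergodic_on_def)
  moreover have "measure ?N B = measure M ?A"
    using emeasure_embed_measure'[OF inj B(1)] by (simp add: measure_def)
  ultimately show "measure ?N B \<in> {0, 1}" by simp
qed

text \<open>Goes back from the embedded system: test functions on \<open>M\<close> are carried over
  by the inverse of \<open>\<phi>\<close>, and the integrals expressing convergence agree on both
  sides.\<close>

lemma jointly_ergodic_for_conjugate:
  assumes S: "mp_system M S" and inj: "inj_on \<phi> (space M)"
    and je: "jointly_ergodic_for F m b (embed_measure M \<phi>) (conjugate_action (space M) \<phi> S)"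
  shows "jointly_ergodic_for F m b M S"
  unfolding jointly_ergodic_for_def
proof (intro allI impI)
  let ?N = "embed_measure M \<phi>" and ?R = "conjugate_action (space M) \<phi> S"
  let ?\<psi> = "the_inv_into (space M) \<phi>"
  note \<phi> = measurable_embed_measure2'[OF inj]
  note \<psi> = measurable_the_inv_into_embed[OF inj]
  fix f assume f: "\<forall>j\<in>{1..m}. Linf_fun M (f j)"
  define f' where "f' j y = f j (?\<psi> y)" for j y
  have f'\<phi>: "f' j (\<phi> x) = f j x" if "x \<in> space M" for j x
    using that by (simp add: f'_def the_inv_into_f_f inj)
  have fm: "f j \<in> borel_measurable M" if "j \<in> {1..m}" for j using f that by (simp add: Linf_fun_def)
  have f'm: "f' j \<in> borel_measurable ?N" if "j \<in> {1..m}" for j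
    unfolding f'_def by (rule measurable_compose[OF \<psi> fm[OF that]])
  have f'L: "Linf_fun ?N (f' j)" if "j \<in> {1..m}" for j
  proof -
    have "Linf_fun M (f j)" using f that by blast
    then obtain C where C: "AE x in M. cmod (f j x) \<le> C" by (auto simp: Linf_fun_def)
    have "AE x in ?N. cmod (f' j x) \<le> C"
      unfolding AE_embed_measure'[OF inj] using C AE_space by eventually_elim (simp add: f'\<phi>)
    then show ?thesis using f'm[OF that] by (auto simp: Linf_fun_def)
  qed
  have int: "(\<integral>y. f' j y \<partial>?N) = (\<integral>x. f j x \<partial>M)" if "j \<in> {1..m}" for j
  proof -
    have "(\<integral>y. f' j y \<partial>?N) = (\<integral>y. f' j y \<partial>distr M ?N \<phi>)"
      by (simp only: embed_measure_eq_distr'[OF inj, symmetric])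
    also have "\<dots> = (\<integral>x. f' j (\<phi> x) \<partial>M)" by (rule integral_distr[OF \<phi> f'm[OF that]])
    also have "\<dots> = (\<integral>x. f j x \<partial>M)"
      by (rule Bochner_Integration.integral_cong) (simp_all add: f'\<phi>)
    finally show ?thesis .
  qed
  have km: "koopman ?R g (f' j) \<in> borel_measurable ?N" if "j \<in> {1..m}" for g j
    unfolding koopman_def
    by (rule measurable_compose[OF measurable_conjugate_action[OF inj mp_systemD(2)[OF S]] f'm[OF that]])
  let ?u = "\<lambda>n y. (\<Sum>g\<in>F n. \<Prod>j=1..m. koopman ?R (b j g) (f' j) y) / of_nat (card (F n))"
  have um: "?u n \<in> borel_measurable ?N" for n
    by (intro borel_measurable_divide borel_measurable_sum borel_measurable_prod km
        borel_measurable_const)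
  have "L2_tendsto ?N ?u (\<lambda>y. \<Prod>j=1..m. \<integral>z. f' j z \<partial>?N)"
    using je f'L by (simp add: jointly_ergodic_for_def)
  also have "(\<lambda>y. \<Prod>j=1..m. \<integral>z. f' j z \<partial>?N) = (\<lambda>y. \<Prod>j=1..m. \<integral>z. f j z \<partial>M)"
    by (intro ext prod.cong refl int)
  finally have L: "L2_tendsto ?N ?u (\<lambda>y. \<Prod>j=1..m. \<integral>z. f j z \<partial>M)" .
  have "(\<integral>\<^sup>+y. ennreal ((cmod (?u n y - (\<Prod>j=1..m. \<integral>z. f j z \<partial>M)))\<^sup>2) \<partial>?N) =
     (\<integral>\<^sup>+x. ennreal ((cmod ((\<Sum>g\<in>F n. \<Prod>j=1..m. koopman S (b j g) (f j) x) / of_nat (card (F n)) -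
        (\<Prod>j=1..m. \<integral>z. f j z \<partial>M)))\<^sup>2) \<partial>M)" for n
  proof -
    have "(\<integral>\<^sup>+y. ennreal ((cmod (?u n y - (\<Prod>j=1..m. \<integral>z. f j z \<partial>M)))\<^sup>2) \<partial>?N) =
        (\<integral>\<^sup>+x. ennreal ((cmod (?u n (\<phi> x) - (\<Prod>j=1..m. \<integral>z. f j z \<partial>M)))\<^sup>2) \<partial>M)"
      by (rule nn_integral_embed_measure'[OF inj]) (use um in measurable)
    also have "\<dots> = (\<integral>\<^sup>+x. ennreal ((cmod ((\<Sum>g\<in>F n. \<Prod>j=1..m. koopman S (b j g) (f j) x) / of_nat (card (F n)) -
        (\<Prod>j=1..m. \<integral>z. f j z \<partial>M)))\<^sup>2) \<partial>M)"
      by (rule nn_integral_cong)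
         (simp add: koopman_def conjugate_action_apply[OF inj] f'\<phi> mp_systemD(6)[OF S])
    finally show ?thesis .
  qed
  with L show "L2_tendsto M
      (\<lambda>n x. (\<Sum>g\<in>F n. \<Prod>j=1..m. koopman S (b j g) (f j) x) / of_nat (card (F n)))
      (\<lambda>x. \<Prod>j=1..m. \<integral>z. f j z \<partial>M)"
    by (simp add: L2_tendsto_def)
qed

lemma jointly_ergodic_standard:
  assumes S: "mp_system M S" and "ergodic M S" and je: "jointly_ergodic F m b"
  shows "jointly_ergodic_for F m b M S"
proof -
  obtain \<phi> :: "'a \<Rightarrow> real" where inj: "inj_on \<phi> (space M)"
    using standard_probability_space_inj_real S by (auto simp: mp_system_def)
  show ?thesis
    using je mp_system_conjugate[OF S inj] ergodic_on_conjugate[OF S inj] assms(2)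
    by (intro jointly_ergodic_for_conjugate[OF S inj]) (auto simp: jointly_ergodic_def ergodic_def)
qed

lemma jointly_ergodic_totally_standard:
  assumes S: "mp_system M S" and "totally_ergodic M S" and je: "jointly_ergodic_totally F m b"
  shows "jointly_ergodic_for F m b M S"
proof -
  obtain \<phi> :: "'a \<Rightarrow> real" where inj: "inj_on \<phi> (space M)"
    using standard_probability_space_inj_real S by (auto simp: mp_system_def)
  show ?thesis
    using je mp_system_conjugate[OF S inj] ergodic_on_conjugate[OF S inj] assms(2)
    by (intro jointly_ergodic_for_conjugate[OF S inj])
       (auto simp: jointly_ergodic_totally_def totally_ergodic_def)
qed

section \<open>Averages weighted by functions with singular spectrum\<close>

lemma bounded_measurable_L2_fun: "prob_space M \<Longrightarrow> f \<in> bounded_measurable M \<Longrightarrow> L2_fun M f"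
  by (simp add: L2_fun_def bounded_measurable_measurable bounded_measurable_integrable_sq
      prob_space.finite_measure)

text \<open>The spectral isometry turns the first error into the distance of the polynomial from
  \<open>1\<close> in \<open>L\<^sup>2\<close> of \<open>\<sigma>\<close>, and Parseval turns the
  sum of squares into its norm for Haar measure. The set separating \<open>\<mu>\<close> from Haar
  measure also separates \<open>\<sigma>\<close>, which \<open>\<mu>\<close> dominates.\<close>

lemma singular_spectrum_approximation:
  fixes T :: "'g::{ab_group_add,countable} \<Rightarrow> 'x \<Rightarrow> 'x"
  assumes T: "mp_system M T" and sing: "singular_spectrum M T"
    and f: "f \<in> bounded_measurable M" "(\<integral>x. f x \<partial>M) = 0" and e: "e > 0"
  obtains H p where "finite H" "sqnorm M (\<lambda>x. f x - (\<Sum>h\<in>H. p h * koopman T h f x)) < e"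
    "(\<Sum>h\<in>H. (cmod (p h))\<^sup>2) < e"
proof -
  interpret prob_space M using mp_systemD(1)[OF T] .
  obtain \<mu> m where \<mu>: "dominates_spectrum M T \<mu>" and m: "haar_measure_dual m"
    and ms: "mutually_singular \<mu> m"
    using sing by (auto simp: singular_spectrum_def maximal_spectral_type_def)
  obtain \<sigma> where \<sigma>: "spectral_measure M T f \<sigma>" "absolutely_continuous \<mu> \<sigma>"
    using \<mu> f bounded_measurable_L2_fun[OF prob_space_axioms f(1)]
    unfolding dominates_spectrum_def by blast
  obtain A where A: "A \<in> sets \<mu>" "emeasure \<mu> A = 0" "emeasure m (space m - A) = 0"
    using ms by (auto simp: mutually_singular_def)
  have s: "finite_measure \<sigma>" "sets \<sigma> = sets dual_space"
    using \<sigma>(1) by (auto simp: spectral_measure_def)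
  have sm: "finite_measure m" "sets m = sets dual_space"
    using m by (auto simp: haar_measure_dual_def prob_space.finite_measure)
  have A': "A \<in> sets dual_space" using A(1) \<mu> by (simp add: dominates_spectrum_def)
  have "A \<in> null_sets \<mu>" using A by auto
  then have "emeasure \<sigma> A = 0" using \<sigma>(2) by (auto simp: absolutely_continuous_def)
  from singular_trig_poly[OF s sm A' this A(3) e] obtain H p where H: "finite H"
    "(\<integral>\<omega>. (cmod (1 - (\<Sum>h\<in>H. p h * \<omega> h)))\<^sup>2 \<partial>\<sigma>) < e"
    "(\<integral>\<omega>. (cmod (\<Sum>h\<in>H. p h * \<omega> h))\<^sup>2 \<partial>m) < e"
    by blast
  \<comment> \<open>Coefficients of \<open>1\<close> minus the polynomial; as \<open>0\<close> may
    belong to \<open>H\<close>, the two contributions are added rather than listed by cases.\<close>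
  define q where "q h = (if h = 0 then 1 else 0) - (if h \<in> H then p h else 0)" for h :: 'g
  have q: "(\<Sum>h\<in>insert 0 H. q h * b h) = b 0 - (\<Sum>h\<in>H. p h * b h)" for b :: "'g \<Rightarrow> complex"
  proof -
    have "(\<Sum>h\<in>insert 0 H. (if h = 0 then 1 else 0) * b h) = b 0"
      using H(1) by (subst sum.mono_neutral_right[of _ "{0}"]) auto
    moreover have "(\<Sum>h\<in>insert 0 H. (if h \<in> H then p h else 0) * b h) = (\<Sum>h\<in>H. p h * b h)"
      using H(1) by (intro sum.mono_neutral_cong_right) auto
    ultimately show ?thesis by (simp only: q_def left_diff_distrib sum_subtractf)
  qed
  have sp: "space \<sigma> = characters"
    using s(2)[THEN sets_eq_imp_space_eq] by (simp add: space_dual_space)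
  have "sqnorm M (\<lambda>x. f x - (\<Sum>h\<in>H. p h * koopman T h f x)) =
      sqnorm M (\<lambda>x. \<Sum>h\<in>insert 0 H. q h * koopman T h f x)"
    unfolding q by (rule sqnorm_cong) (simp add: koopman_def mp_systemD(4)[OF T])
  also have "\<dots> = (\<integral>\<omega>. (cmod (\<Sum>h\<in>insert 0 H. q h * \<omega> h))\<^sup>2 \<partial>\<sigma>)"
    by (rule sqnorm_koopman_sum[OF T f(1) \<sigma>(1)])
  also have "\<dots> = (\<integral>\<omega>. (cmod (1 - (\<Sum>h\<in>H. p h * \<omega> h)))\<^sup>2 \<partial>\<sigma>)"
    unfolding q by (rule Bochner_Integration.integral_cong) (simp_all add: sp character_zero)
  also have "\<dots> < e" by (rule H(2))
  finally have "sqnorm M (\<lambda>x. f x - (\<Sum>h\<in>H. p h * koopman T h f x)) < e" .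
  moreover have "(\<Sum>h\<in>H. (cmod (p h))\<^sup>2) < e"
    using H(3) haar_integral_norm_trig_poly[OF m H(1), of p] by simp
  ultimately show ?thesis by (rule that[OF H(1)])
qed

section \<open>Averages of products when the second factor is orthogonal on average\<close>

lemma folner_average_linear:
  "folner_average F n (\<lambda>g. b g + b' g) = folner_average F n b + folner_average F n b'"
  "folner_average F n (\<lambda>g. b g - b' g) = folner_average F n b - folner_average F n b'"
  "folner_average F n (\<lambda>g. c * b g) = c * folner_average F n b"
  "folner_average F n (\<lambda>g. \<Sum>h\<in>H. d h g) = (\<Sum>h\<in>H. folner_average F n (d h))"
  unfolding folner_average_def
     apply (simp_all add: sum.distrib sum_subtractf add_divide_distrib diff_divide_distrib
      sum_distrib_left[symmetric] sum_divide_distrib[symmetric])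
  by (subst sum.swap) simp

lemma sqnorm_folner_average_le:
  assumes F: "folner_sequence F" and M: "finite_measure M" and w: "\<And>g. w g \<in> bounded_measurable M"
    and B: "\<And>g. sqnorm M (w g) \<le> B"
  shows "sqnorm M (\<lambda>x. folner_average F n (\<lambda>g. w g x)) \<le> B"
proof -
  have "sqnorm M (\<lambda>x. folner_average F n (\<lambda>g. w g x)) \<le> (\<Sum>g\<in>F n. sqnorm M (w g)) / card (F n)"
    unfolding folner_average_def
    by (rule sqnorm_average_le) (use M w F in \<open>auto simp: folner_sequence_def\<close>)
  also have "\<dots> \<le> B"
    using sum_bounded_above[of "F n" "\<lambda>g. sqnorm M (w g)" B] B folner_sequence_card_pos[OF F, of n]
    by (simp add: field_simps)
  finally show ?thesis .
qed

lemma norm_integral_mult_cnj_le: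
  assumes "prob_space M" "\<And>x. cmod (u x) \<le> K" "\<And>x. cmod (v x) \<le> K" "K \<ge> 0"
    "u \<in> bounded_measurable M" "v \<in> bounded_measurable M"
  shows "cmod (\<integral>x. u x * cnj (v x) \<partial>M) \<le> K\<^sup>2"
proof -
  interpret prob_space M by fact
  have b: "(\<lambda>x. u x * cnj (v x)) \<in> bounded_measurable M"
    by (intro bounded_measurable_intros assms)
  have "cmod (\<integral>x. u x * cnj (v x) \<partial>M) \<le> (\<integral>x. cmod (u x * cnj (v x)) \<partial>M)"
    by (rule integral_norm_bound)
  also have "\<dots> \<le> (\<integral>x. K\<^sup>2 \<partial>M)"
  proof (rule integral_mono)
    show "integrable M (\<lambda>x. cmod (u x * cnj (v x)))"
      by (intro integrable_norm bounded_measurable_integrable finite_measure_axioms b)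
    show "cmod (u x * cnj (v x)) \<le> K\<^sup>2" for x
      unfolding norm_mult power2_eq_square complex_mod_cnj by (intro mult_mono assms norm_ge_zero)
  qed simp
  finally show ?thesis by (simp add: prob_space)
qed

text \<open>Expanding the square, the pair \<open>h\<close>, \<open>k\<close> contributes a shift of
  the averaged correlation for the difference \<open>h - k\<close>. Off the diagonal this tends to
  zero, on the diagonal it is at most \<open>K\<^sup>2\<close>.\<close>

lemma average_sqnorm_combination_le:
  fixes v :: "'g::ab_group_add \<Rightarrow> 'x \<Rightarrow> complex"
  assumes M: "prob_space M" and F: "folner_sequence F" and H: "finite H" and K: "K \<ge> 0"
    and v: "\<And>g. v g \<in> bounded_measurable M" "\<And>g x. cmod (v g x) \<le> K"
    and dec: "\<And>h. h \<noteq> 0 \<Longrightarrow> (\<lambda>n. folner_average F n (\<lambda>g. \<integral>x. v g x * cnj (v (g + h) x) \<partial>M)) \<longlonglongrightarrow> 0"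
  obtains r where "r \<longlonglongrightarrow> 0"
    "\<And>n. (\<Sum>g\<in>F n. sqnorm M (\<lambda>x. \<Sum>h\<in>H. p h * v (g - h) x)) / card (F n)
       \<le> K\<^sup>2 * (\<Sum>h\<in>H. (cmod (p h))\<^sup>2) + r n"
proof -
  interpret prob_space M by fact
  note bm = bounded_measurable_intros v(1)
  define c where "c h k n = folner_average F n (\<lambda>g. \<integral>x. v (g - h) x * cnj (v (g - k) x) \<partial>M)"
    for h k n
  have c0: "c h k \<longlonglongrightarrow> 0" if "h \<noteq> k" for h k
  proof -
    define D where "D g = (\<integral>x. v g x * cnj (v (g + (h - k)) x) \<partial>M)" for g
    have D: "cmod (D g) \<le> K\<^sup>2" for g
      unfolding D_def by (intro norm_integral_mult_cnj_le M v K)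
    \<comment> \<open>The substitution of \<open>g - h\<close> for \<open>g\<close> brings the
      correlation to the form of \<open>dec\<close>, at the price of one Folner shift.\<close>
    have eq: "c h k n = folner_average F n (\<lambda>g. D (g + - h))" for n
      by (simp add: c_def D_def)
    have "(\<lambda>n. c h k n - folner_average F n D) \<longlonglongrightarrow> 0"
    proof (rule Lim_null_comparison)
      show "\<forall>\<^sub>F n in sequentially. norm (c h k n - folner_average F n D) \<le> K\<^sup>2 * folner_defect F (- h) n"
        unfolding eq by (intro always_eventually allI folner_average_shift F D)
      show "(\<lambda>n. K\<^sup>2 * folner_defect F (- h) n) \<longlonglongrightarrow> 0"
        by (intro tendsto_mult_right_zero folner_defect_tendsto F)
    qed
    moreover have "folner_average F n D = folner_average F n (\<lambda>g. \<integral>x. v g x * cnj (v (g + (h - k)) x) \<partial>M)" for n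
      by (simp add: D_def[abs_def])
    then have "(\<lambda>n. folner_average F n D) \<longlonglongrightarrow> 0" using dec[of "h - k"] that by simp
    ultimately have "(\<lambda>n. (c h k n - folner_average F n D) + folner_average F n D) \<longlonglongrightarrow> 0 + 0"
      by (rule tendsto_add)
    then show ?thesis by simp
  qed
  define r where "r n = cmod (\<Sum>h\<in>H. \<Sum>k\<in>H - {h}. p h * cnj (p k) * c h k n)" for n
  have "r \<longlonglongrightarrow> 0"
  proof -
    have "(\<lambda>n. \<Sum>h\<in>H. \<Sum>k\<in>H - {h}. p h * cnj (p k) * c h k n) \<longlonglongrightarrow> 0"
      by (intro tendsto_null_sum tendsto_mult_right_zero c0) auto
    then show ?thesis unfolding r_def by (rule tendsto_norm_zero)
  qed
  moreover have "(\<Sum>g\<in>F n. sqnorm M (\<lambda>x. \<Sum>h\<in>H. p h * v (g - h) x)) / card (F n)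
       \<le> K\<^sup>2 * (\<Sum>h\<in>H. (cmod (p h))\<^sup>2) + r n" for n
  proof -
    have sq: "complex_of_real (sqnorm M (\<lambda>x. \<Sum>h\<in>H. p h * v (g - h) x)) =
        (\<Sum>h\<in>H. \<Sum>k\<in>H. p h * cnj (p k) * (\<integral>x. v (g - h) x * cnj (v (g - k) x) \<partial>M))" for g
    proof -
      have "complex_of_real (sqnorm M (\<lambda>x. \<Sum>h\<in>H. p h * v (g - h) x)) =
          (\<integral>x. complex_of_real ((cmod (\<Sum>h\<in>H. p h * v (g - h) x))\<^sup>2) \<partial>M)"
        unfolding sqnorm_def by (rule integral_complex_of_real[symmetric])
      also have "\<dots> = (\<integral>x. (\<Sum>h\<in>H. \<Sum>k\<in>H. p h * cnj (p k) * (v (g - h) x * cnj (v (g - k) x))) \<partial>M)"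
        unfolding complex_norm_square cnj_sum sum_product by (simp add: mult_ac)
      also have "\<dots> = (\<Sum>h\<in>H. \<Sum>k\<in>H. (\<integral>x. p h * cnj (p k) * (v (g - h) x * cnj (v (g - k) x)) \<partial>M))"
        by (subst Bochner_Integration.integral_sum,
            (intro bounded_measurable_integrable finite_measure_axioms bm)[1])
           (intro sum.cong refl Bochner_Integration.integral_sum
            bounded_measurable_integrable finite_measure_axioms bm)
      finally show ?thesis by simp
    qed
    have "complex_of_real ((\<Sum>g\<in>F n. sqnorm M (\<lambda>x. \<Sum>h\<in>H. p h * v (g - h) x)) / card (F n)) =
        folner_average F n (\<lambda>g. complex_of_real (sqnorm M (\<lambda>x. \<Sum>h\<in>H. p h * v (g - h) x)))"
      by (simp add: folner_average_def)
    also have "\<dots> = (\<Sum>h\<in>H. \<Sum>k\<in>H. p h * cnj (p k) * c h k n)"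
      unfolding sq c_def folner_average_linear ..
    also have "\<dots> = (\<Sum>h\<in>H. p h * cnj (p h) * c h h n + (\<Sum>k\<in>H - {h}. p h * cnj (p k) * c h k n))"
      using H by (intro sum.cong refl sum.remove)
    also have "\<dots> = (\<Sum>h\<in>H. p h * cnj (p h) * c h h n) + (\<Sum>h\<in>H. \<Sum>k\<in>H - {h}. p h * cnj (p k) * c h k n)"
      by (rule sum.distrib)
    also have "cmod \<dots> \<le> cmod (\<Sum>h\<in>H. p h * cnj (p h) * c h h n) + r n"
      unfolding r_def by (rule norm_triangle_ineq)
    also have "cmod (\<Sum>h\<in>H. p h * cnj (p h) * c h h n) \<le> (\<Sum>h\<in>H. K\<^sup>2 * (cmod (p h))\<^sup>2)"
    proof (rule sum_norm_le)
      fix h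
      have "cmod (c h h n) \<le> K\<^sup>2"
        unfolding c_def by (intro folner_average_norm_le F norm_integral_mult_cnj_le M v K)
      then have "(cmod (p h))\<^sup>2 * cmod (c h h n) \<le> (cmod (p h))\<^sup>2 * K\<^sup>2" by (intro mult_left_mono) auto
      then show "cmod (p h * cnj (p h) * c h h n) \<le> K\<^sup>2 * (cmod (p h))\<^sup>2"
        by (simp add: norm_mult power2_eq_square mult_ac)
    qed
    finally have "cmod (complex_of_real ((\<Sum>g\<in>F n. sqnorm M (\<lambda>x. \<Sum>h\<in>H. p h * v (g - h) x)) / card (F n)))
        \<le> K\<^sup>2 * (\<Sum>h\<in>H. (cmod (p h))\<^sup>2) + r n"
      by (simp add: sum_distrib_left)
    then show ?thesis unfolding norm_of_real by linarith
  qed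
  ultimately show ?thesis by (rule that)
qed

text \<open>Nothing relates \<open>v\<close> to \<open>T\<close>: decay of the correlations of
  \<open>v\<close> and a uniform bound suffice against any mean-zero \<open>f\<close> of singular
  spectrum.\<close>

lemma singular_average_tendsto_0:
  fixes T :: "'g::{ab_group_add,countable} \<Rightarrow> 'x \<Rightarrow> 'x"
  assumes T: "mp_system M T" and sing: "singular_spectrum M T" and F: "folner_sequence F"
    and f: "f \<in> bounded_measurable M" "(\<integral>x. f x \<partial>M) = 0"
    and v: "\<And>g. v g \<in> bounded_measurable M" "\<And>g x. cmod (v g x) \<le> K"
    and dec: "\<And>h. h \<noteq> 0 \<Longrightarrow> (\<lambda>n. folner_average F n (\<lambda>g. \<integral>x. v g x * cnj (v (g + h) x) \<partial>M)) \<longlonglongrightarrow> 0"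
  shows "(\<lambda>n. sqnorm M (\<lambda>x. folner_average F n (\<lambda>g. koopman T g f x * v g x))) \<longlonglongrightarrow> 0"
proof -
  interpret prob_space M using mp_systemD(1)[OF T] .
  obtain C where C: "C \<ge> 0" "\<And>x. cmod (f x) \<le> C" using bounded_measurableD[OF f(1)] by auto
  have K: "K \<ge> 0" using v(2)[of 0 undefined] norm_ge_zero order_trans by blast
  let ?W = "\<lambda>n x. folner_average F n (\<lambda>g. koopman T g f x * v g x)"
  \<comment> \<open>The polynomial, and with it the null sequence \<open>t\<close>, depends on
    \<open>e\<close>, but the coefficient of \<open>e\<close> does not. So \<open>e\<close> is fixed
    first and \<open>n\<close> goes to infinity afterwards.\<close>
  have bound: "\<exists>t. t \<longlonglongrightarrow> 0 \<and> (\<forall>n. sqnorm M (?W n) \<le> (4 * K\<^sup>2 + 2 * C\<^sup>2 * K\<^sup>2) * e + t n)"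
    if e: "e > 0" for e
  proof -
    obtain H p where H: "finite H" and p: "sqnorm M (\<lambda>x. f x - (\<Sum>h\<in>H. p h * koopman T h f x)) < e"
      "(\<Sum>h\<in>H. (cmod (p h))\<^sup>2) < e"
      using singular_spectrum_approximation[OF T sing f e] by blast
    define V where "V g x = (\<Sum>h\<in>H. p h * v (g - h) x)" for g x
    (* A1: error of replacing f by the sum of p h T_h f; A2: error of shifting the Folner sequence;
       A3: the remaining main term. *)
    define A1 where "A1 n x = folner_average F n
      (\<lambda>g. (koopman T g f x - (\<Sum>h\<in>H. p h * koopman T (g + h) f x)) * v g x)" for n x
    define A2 where "A2 n x = (\<Sum>h\<in>H. p h * (folner_average F n (\<lambda>g. koopman T (g + h) f x * v g x) -
      folner_average F n (\<lambda>g. koopman T g f x * v (g - h) x)))" for n x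
    define A3 where "A3 n x = folner_average F n (\<lambda>g. koopman T g f x * V g x)" for n x
    obtain r where r: "r \<longlonglongrightarrow> 0"
      "\<And>n. (\<Sum>g\<in>F n. sqnorm M (V g)) / card (F n) \<le> K\<^sup>2 * (\<Sum>h\<in>H. (cmod (p h))\<^sup>2) + r n"
      using average_sqnorm_combination_le[OF prob_space_axioms F H K v dec, of p] 
      unfolding V_def by blast
    note bm = bounded_measurable_intros T f(1) v(1) bounded_measurable_folner_average
    have Vb: "V g \<in> bounded_measurable M" for g unfolding V_def by (intro bm)
    have Ab: "A1 n \<in> bounded_measurable M" "A2 n \<in> bounded_measurable M" "A3 n \<in> bounded_measurable M" for n
      unfolding A1_def A2_def A3_def by (intro bm Vb)+
    have W: "?W n x = A1 n x + A2 n x + A3 n x" for n x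
    proof -
      have "A1 n x = ?W n x - (\<Sum>h\<in>H. p h * folner_average F n (\<lambda>g. koopman T (g + h) f x * v g x))"
        unfolding A1_def left_diff_distrib sum_distrib_right mult.assoc folner_average_linear ..
      moreover have "A3 n x = (\<Sum>h\<in>H. p h * folner_average F n (\<lambda>g. koopman T g f x * v (g - h) x))"
        unfolding A3_def V_def sum_distrib_left mult.left_commute[of _ "p _"] folner_average_linear ..
      ultimately show ?thesis by (simp add: A2_def right_diff_distrib sum_subtractf)
    qed
    \<comment> \<open>\<open>T\<close> preserves the norm, so replacing \<open>f\<close> by its
      approximant costs at most \<open>K\<^sup>2 * e\<close> for every single \<open>g\<close>,
      uniformly in \<open>n\<close>.\<close>
    have s1: "sqnorm M (A1 n) \<le> K\<^sup>2 * e" for n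
      unfolding A1_def
    proof (rule sqnorm_folner_average_le[OF F finite_measure_axioms])
      fix g
      let ?d = "\<lambda>x. f x - (\<Sum>h\<in>H. p h * koopman T h f x)"
      have "sqnorm M (\<lambda>x. (koopman T g f x - (\<Sum>h\<in>H. p h * koopman T (g + h) f x)) * v g x)
          \<le> K\<^sup>2 * sqnorm M (koopman T g ?d)"
      proof (intro sqnorm_mono_mult finite_measure_axioms bm)
        fix x assume x: "x \<in> space M"
        have "koopman T g ?d x = koopman T g f x - (\<Sum>h\<in>H. p h * koopman T (g + h) f x)"
          using koopman_koopman[OF T x, of _ f g] by (simp add: koopman_def add.commute)
        then show "cmod ((koopman T g f x - (\<Sum>h\<in>H. p h * koopman T (g + h) f x)) * v g x)
            \<le> K * cmod (koopman T g ?d x)"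
          by (simp add: norm_mult mult.commute[of K] mult_left_mono v(2))
      qed
      also have "sqnorm M (koopman T g ?d) = sqnorm M ?d" by (intro sqnorm_koopman bm)
      also have "K\<^sup>2 * sqnorm M ?d \<le> K\<^sup>2 * e" using p(1) by (intro mult_left_mono) auto
      finally show "sqnorm M (\<lambda>x. (koopman T g f x - (\<Sum>h\<in>H. p h * koopman T (g + h) f x)) * v g x)
          \<le> K\<^sup>2 * e" .
    qed (intro bm)
    \<comment> \<open>Reindexing by \<open>h\<close> turns the first average in \<open>A2\<close>
      into the second. The products are bounded by \<open>C * K\<close>, so each \<open>h\<close>
      costs at most that multiple of its defect.\<close>
    define s where "s n = (\<Sum>h\<in>H. cmod (p h) * (C * K * folner_defect F h n))" for n
    have "s \<longlonglongrightarrow> 0"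
      unfolding s_def by (intro tendsto_null_sum tendsto_mult_right_zero folner_defect_tendsto F)
    have s2: "sqnorm M (A2 n) \<le> (s n)\<^sup>2" for n
    proof (intro sqnorm_le_bound prob_space_axioms Ab)
      fix x
      show "cmod (A2 n x) \<le> s n"
        unfolding A2_def s_def
      proof (rule sum_norm_le)
        fix h
        have "cmod (koopman T g f x * v (g - h) x) \<le> C * K" for g
          unfolding norm_mult koopman_def by (intro mult_mono C v(2) norm_ge_zero)
        then have "cmod (folner_average F n (\<lambda>g. koopman T (g + h) f x * v g x) -
            folner_average F n (\<lambda>g. koopman T g f x * v (g - h) x)) \<le> C * K * folner_defect F h n"
          using folner_average_shift[OF F, of "\<lambda>g. koopman T g f x * v (g - h) x" "C * K" n h] by simp
        then show "cmod (p h * (folner_average F n (\<lambda>g. koopman T (g + h) f x * v g x) -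
            folner_average F n (\<lambda>g. koopman T g f x * v (g - h) x))) \<le> cmod (p h) * (C * K * folner_defect F h n)"
          unfolding norm_mult[of "p h"] by (intro mult_left_mono norm_ge_zero)
      qed
    qed
    \<comment> \<open>The factor \<open>koopman T g f\<close> is used only through its bound
      \<open>C\<close>; the smallness comes from the norms of \<open>V g\<close> on average.\<close>
    have s3: "sqnorm M (A3 n) \<le> C\<^sup>2 * (K\<^sup>2 * e + r n)" for n
    proof -
      have "sqnorm M (A3 n) \<le> (\<Sum>g\<in>F n. sqnorm M (\<lambda>x. koopman T g f x * V g x)) / card (F n)"
        unfolding A3_def folner_average_def using F
        by (intro sqnorm_average_le finite_measure_axioms bm Vb) (auto simp: folner_sequence_def)
      also have "\<dots> \<le> (\<Sum>g\<in>F n. C\<^sup>2 * sqnorm M (V g)) / card (F n)"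
        by (intro divide_right_mono sum_mono sqnorm_mono_mult finite_measure_axioms bm Vb)
           (auto simp: norm_mult koopman_def intro!: mult_right_mono C)
      also have "\<dots> = C\<^sup>2 * ((\<Sum>g\<in>F n. sqnorm M (V g)) / card (F n))"
        by (simp add: sum_distrib_left)
      also have "\<dots> \<le> C\<^sup>2 * (K\<^sup>2 * (\<Sum>h\<in>H. (cmod (p h))\<^sup>2) + r n)" by (intro mult_left_mono r(2)) simp
      also have "\<dots> \<le> C\<^sup>2 * (K\<^sup>2 * e + r n)"
        using p(2) by (intro mult_left_mono add_right_mono) auto
      finally show ?thesis .
    qed
    define t where "t n = 4 * (s n)\<^sup>2 + 2 * C\<^sup>2 * r n" for n
    have "(\<lambda>n. 4 * (s n)\<^sup>2 + 2 * C\<^sup>2 * r n) \<longlonglongrightarrow> 4 * 0\<^sup>2 + 2 * C\<^sup>2 * 0"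
      by (intro tendsto_intros \<open>s \<longlonglongrightarrow> 0\<close> r(1))
    then have "t \<longlonglongrightarrow> 0" by (simp add: t_def[abs_def])
    moreover have "sqnorm M (?W n) \<le> (4 * K\<^sup>2 + 2 * C\<^sup>2 * K\<^sup>2) * e + t n" for n
    proof -
      have "sqnorm M (?W n) \<le> 2 * sqnorm M (\<lambda>x. A1 n x + A2 n x) + 2 * sqnorm M (A3 n)"
        unfolding W by (intro sqnorm_add_le finite_measure_axioms bm Ab)
      moreover have "sqnorm M (\<lambda>x. A1 n x + A2 n x) \<le> 2 * sqnorm M (A1 n) + 2 * sqnorm M (A2 n)"
        by (intro sqnorm_add_le finite_measure_axioms bm Ab)
      ultimately have "sqnorm M (?W n) \<le> 4 * (K\<^sup>2 * e) + 4 * (s n)\<^sup>2 + 2 * (C\<^sup>2 * (K\<^sup>2 * e + r n))"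
        using s1[of n] s2[of n] s3[of n] by linarith
      then show ?thesis by (simp add: t_def algebra_simps)
    qed
    ultimately show ?thesis by blast
  qed
  show ?thesis
  proof (rule order_tendstoI)
    show "\<forall>\<^sub>F n in sequentially. y < sqnorm M (?W n)" if "y < 0" for y
      by (rule always_eventually, rule allI) (rule less_le_trans[OF that sqnorm_nonneg])
    fix d :: real assume d: "0 < d"
    define B where "B = 4 * K\<^sup>2 + 2 * C\<^sup>2 * K\<^sup>2"
    have B: "B \<ge> 0" by (simp add: B_def)
    \<comment> \<open>Dividing by \<open>B + 1\<close> instead of \<open>B\<close> allows for
      \<open>B = 0\<close>.\<close>
    have "d / (2 * (B + 1)) > 0" using d B by simp
    from bound[OF this] obtain t where t: "t \<longlonglongrightarrow> 0"
      "\<And>n. sqnorm M (?W n) \<le> B * (d / (2 * (B + 1))) + t n" unfolding B_def by blast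
    have "B * (d / (2 * (B + 1))) \<le> d / 2" using B d by (simp add: field_simps)
    then have *: "sqnorm M (?W n) < d" if "t n < d / 2" for n
      using t(2)[of n] that by linarith
    have "\<forall>\<^sub>F n in sequentially. t n < d / 2"
      by (rule order_tendstoD(2)[OF t(1)]) (use d in simp)
    then show "\<forall>\<^sub>F n in sequentially. sqnorm M (?W n) < d"
      by (rule eventually_mono) (rule *)
  qed
qed

section \<open>Joint ergodicity along the shifts\<close>

lemma sqnorm_tendsto_add:
  assumes "finite_measure M" "\<And>n. u n \<in> bounded_measurable M" "\<And>n. v n \<in> bounded_measurable M"
    and "(\<lambda>n. sqnorm M (u n)) \<longlonglongrightarrow> 0" "(\<lambda>n. sqnorm M (v n)) \<longlonglongrightarrow> 0"
  shows "(\<lambda>n. sqnorm M (\<lambda>x. u n x + v n x)) \<longlonglongrightarrow> 0"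
proof (rule tendsto_sandwich[OF _ _ tendsto_const])
  show "(\<lambda>n. 2 * sqnorm M (u n) + 2 * sqnorm M (v n)) \<longlonglongrightarrow> 0"
    using tendsto_add[OF tendsto_mult_right_zero[OF assms(4), of 2] tendsto_mult_right_zero[OF assms(5), of 2]]
    by simp
qed (auto intro!: always_eventually sqnorm_nonneg sqnorm_add_le assms)

lemma sqnorm_cmult: "sqnorm M (\<lambda>x. c * u x) = (cmod c)\<^sup>2 * sqnorm M u"
  by (simp add: sqnorm_def norm_mult power_mult_distrib)

lemma sqnorm_tendsto_cmult:
  "(\<lambda>n. sqnorm M (u n)) \<longlonglongrightarrow> 0 \<Longrightarrow> (\<lambda>n. sqnorm M (\<lambda>x. c * u n x)) \<longlonglongrightarrow> 0"
  by (simp add: sqnorm_cmult tendsto_mult_right_zero)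

lemma prod_atLeastAtMost_double:
  fixes b :: "nat \<Rightarrow> 'a::comm_monoid_mult"
  shows "(\<Prod>j=1..2 * l. b j) = (\<Prod>j=1..l. b j) * (\<Prod>j=1..l. b (l + j))"
proof -
  have "(\<Prod>j=1..l + l. b j) = (\<Prod>j=1..l. b j) * (\<Prod>j=l + 1..l + l. b j)"
    by (rule prod.ub_add_nat) simp
  also have "(\<Prod>j=l + 1..l + l. b j) = (\<Prod>j=1..l. b (j + l))"
    using prod.shift_bounds_cl_nat_ivl[of b 1 l l] by (simp add: add.commute)
  finally show ?thesis by (simp add: mult_2 add.commute)
qed

text \<open>The functions \<open>\<phi>\<close> fill the unshifted slots and \<open>\<psi>\<close>
  the shifted ones. Choosing them among the given functions, their conjugates and \<open>1\<close>
  extracts every limit needed about the \<open>S\<close>-products.\<close>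

lemma shifted_family_jointly_ergodic_sqnorm:
  assumes S: "mp_system M S" and je: "jointly_ergodic_for F (2 * l) (shifted_family l a h) M S"
    and \<phi>: "\<And>j. \<phi> j \<in> bounded_measurable M" and \<psi>: "\<And>j. \<psi> j \<in> bounded_measurable M"
  shows "(\<lambda>n. sqnorm M (\<lambda>x. folner_average F n (\<lambda>g. (\<Prod>j=1..l. koopman S (a j g) (\<phi> j) x) *
      (\<Prod>j=1..l. koopman S (a j (g + h)) (\<psi> j) x)) -
      (\<Prod>j=1..l. \<integral>x. \<phi> j x \<partial>M) * (\<Prod>j=1..l. \<integral>x. \<psi> j x \<partial>M))) \<longlonglongrightarrow> 0"
proof -
  interpret prob_space M using mp_systemD(1)[OF S] .
  define \<theta> where "\<theta> j = (if j \<le> l then \<phi> j else \<psi> (j - l))" for j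
  have \<theta>: "\<theta> j \<in> bounded_measurable M" for j by (simp add: \<theta>_def \<phi> \<psi>)
  have "Linf_fun M (\<theta> j)" for j
    using bounded_measurable_measurable[OF \<theta>] bounded_measurableD[OF \<theta>, of j]
    by (auto simp: Linf_fun_def)
  then have "L2_tendsto M
      (\<lambda>n y. (\<Sum>g\<in>F n. \<Prod>j=1..2 * l. koopman S (shifted_family l a h j g) (\<theta> j) y) / of_nat (card (F n)))
      (\<lambda>y. \<Prod>j=1..2 * l. \<integral>z. \<theta> j z \<partial>M)"
    using je unfolding jointly_ergodic_for_def by blast
  also have "(\<lambda>y. \<Prod>j=1..2 * l. \<integral>z. \<theta> j z \<partial>M) =
      (\<lambda>y. (\<Prod>j=1..l. \<integral>x. \<phi> j x \<partial>M) * (\<Prod>j=1..l. \<integral>x. \<psi> j x \<partial>M))"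
    unfolding prod_atLeastAtMost_double
    by (intro ext arg_cong2[where f = times] prod.cong refl) (auto simp: \<theta>_def)
  also have "(\<lambda>n y. (\<Sum>g\<in>F n. \<Prod>j=1..2 * l. koopman S (shifted_family l a h j g) (\<theta> j) y) / of_nat (card (F n)))
      = (\<lambda>n y. folner_average F n (\<lambda>g. (\<Prod>j=1..l. koopman S (a j g) (\<phi> j) y) *
          (\<Prod>j=1..l. koopman S (a j (g + h)) (\<psi> j) y)))"
    unfolding folner_average_def prod_atLeastAtMost_double
    by (intro ext arg_cong2[where f = divide] sum.cong refl arg_cong2[where f = times] prod.cong)
       (auto simp: \<theta>_def shifted_family_def)
  finally show ?thesis
    by (subst (asm) L2_tendsto_iff_sqnorm)
       (auto intro!: finite_measure_axioms bounded_measurable_folner_average bounded_measurable_intros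
         S \<phi> \<psi>)
qed

text \<open>Both factors are centred: \<open>f 0\<close> because singularity concerns mean-zero
  functions, the \<open>S\<close>-product because its correlations tend to zero only after
  subtracting \<open>c\<close>.\<close>

lemma singular_jointly_ergodic_bounded:
  fixes F :: "nat \<Rightarrow> 'g::{ab_group_add, countable} set"
  assumes inf: "infinite (UNIV :: 'g set)" and F: "folner_sequence F"
    and T: "mp_system M T" and S: "mp_system M S" and sing: "singular_spectrum M T"
    and f: "\<And>j. f j \<in> bounded_measurable M"
    and je: "\<And>h. h \<noteq> 0 \<Longrightarrow> jointly_ergodic_for F (2 * l) (shifted_family l a h) M S"
  shows "L2_tendsto M
        (\<lambda>N x. (\<Sum>g\<in>F N. koopman T g (f 0) x * (\<Prod>j=1..l. koopman S (a j g) (f j) x))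
                 / of_nat (card (F N)))
        (\<lambda>x. complex_cond_exp M (invariant_algebra M T) (f 0) x * (\<Prod>j=1..l. \<integral>y. f j y \<partial>M))"
proof -
  interpret prob_space M using mp_systemD(1)[OF T] .
  note fin = finite_measure_axioms
  define c where "c = (\<Prod>j=1..l. \<integral>y. f j y \<partial>M)"
  define u where "u g x = (\<Prod>j=1..l. koopman S (a j g) (f j) x)" for g x
  define v where "v g x = u g x - c" for g x
  note bm = bounded_measurable_intros bounded_measurable_folner_average S T f
  have ub: "u g \<in> bounded_measurable M" for g unfolding u_def by (intro bm)
  have vb: "v g \<in> bounded_measurable M" for g unfolding v_def by (intro bm ub)
  obtain C where C: "\<And>j. C j \<ge> 0" "\<And>j x. cmod (f j x) \<le> C j"
    using bounded_measurableD[OF f] by metis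
  have vK: "cmod (v g x) \<le> (\<Prod>j=1..l. C j) + cmod c" for g x
  proof -
    have "cmod (u g x) \<le> (\<Prod>j=1..l. C j)"
      unfolding u_def prod_norm[symmetric] koopman_def by (intro prod_mono) (auto simp: C)
    then show ?thesis unfolding v_def using norm_triangle_ineq4[of "u g x" c] by linarith
  qed
  \<comment> \<open>Joint ergodicity is given for nonzero shifts; one is picked to obtain the
    average of \<open>u\<close> alone, in which the shift does not appear.\<close>
  obtain h0 :: 'g where h0: "h0 \<noteq> 0" using inf by (metis finite.simps ex_new_if_finite singletonI)
  have cnj_c: "(\<Prod>j=1..l. \<integral>y. cnj (f j y) \<partial>M) = cnj c"
    and cnj_c': "(\<Prod>j=1..l. cnj (\<integral>y. f j y \<partial>M)) = cnj c"
    by (simp_all add: c_def)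
  have cnj_u: "(\<Prod>j=1..l. koopman S (a j g) (\<lambda>x. cnj (f j x)) x) = cnj (u g x)" for g x
    by (simp add: u_def koopman_def)
  have one: "koopman S g (\<lambda>x. 1) x = 1" for g x by (simp add: koopman_def)
  \<comment> \<open>Three choices of test functions: \<open>f\<close> with its conjugates,
    \<open>f\<close> with \<open>1\<close>, and \<open>1\<close> with the conjugates.\<close>
  have je1: "(\<lambda>n. sqnorm M (\<lambda>x. folner_average F n (\<lambda>g. u g x * cnj (u (g + h) x)) - c * cnj c)) \<longlonglongrightarrow> 0"
    if "h \<noteq> 0" for h
    using shifted_family_jointly_ergodic_sqnorm[OF S je[OF that], of f "\<lambda>j x. cnj (f j x)"]
    by (simp only: cnj_u cnj_c u_def[symmetric] c_def[symmetric] bm)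
  have je2: "(\<lambda>n. sqnorm M (\<lambda>x. folner_average F n (\<lambda>g. u g x) - c)) \<longlonglongrightarrow> 0"
    using shifted_family_jointly_ergodic_sqnorm[OF S je[OF h0], of f "\<lambda>j x. 1"]
    by (simp add: one u_def[symmetric] c_def[symmetric] bm prob_space del: One_nat_def)
  have je3: "(\<lambda>n. sqnorm M (\<lambda>x. folner_average F n (\<lambda>g. cnj (u (g + h) x)) - cnj c)) \<longlonglongrightarrow> 0"
    if "h \<noteq> 0" for h
    using shifted_family_jointly_ergodic_sqnorm[OF S je[OF that], of "\<lambda>j x. 1" "\<lambda>j x. cnj (f j x)"]
    by (simp add: one cnj_u cnj_c' bm prob_space del: One_nat_def)
  have int: "(\<lambda>n. folner_average F n (\<lambda>g. \<integral>x. w g x \<partial>M)) \<longlonglongrightarrow> d"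
    if w: "\<And>g. w g \<in> bounded_measurable M"
      and "(\<lambda>n. sqnorm M (\<lambda>x. folner_average F n (\<lambda>g. w g x) - d)) \<longlonglongrightarrow> 0" for w :: "'g \<Rightarrow> _" and d
  proof -
    have "(\<lambda>n. \<integral>x. folner_average F n (\<lambda>g. w g x) * 1 \<partial>M) \<longlonglongrightarrow> (\<integral>x. d * 1 \<partial>M)"
      by (intro sqnorm_mult_tendsto_integral prob_space_axioms bm w that(2))
    moreover have "(\<integral>x. folner_average F n (\<lambda>g. w g x) * 1 \<partial>M) = folner_average F n (\<lambda>g. \<integral>x. w g x \<partial>M)" for n
      unfolding folner_average_def
      by (simp add: Bochner_Integration.integral_sum bounded_measurable_integrable[OF fin w])
    ultimately show ?thesis by (simp add: prob_space)
  qed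
  \<comment> \<open>Expanding the product of the centred factors gives four terms, each with limit
    of modulus \<open>(cmod c)\<^sup>2\<close>, and the signs cancel them.\<close>
  have dec: "(\<lambda>n. folner_average F n (\<lambda>g. \<integral>x. v g x * cnj (v (g + h) x) \<partial>M)) \<longlonglongrightarrow> 0"
    if h: "h \<noteq> 0" for h
  proof -
    have "(\<integral>x. v g x * cnj (v (g + h) x) \<partial>M) = (\<integral>x. u g x * cnj (u (g + h) x) \<partial>M) -
        cnj c * (\<integral>x. u g x \<partial>M) - c * (\<integral>x. cnj (u (g + h) x) \<partial>M) + c * cnj c" for g
    proof -
      have i: "integrable M (\<lambda>x. u g x * cnj (u (g + h) x))" "integrable M (u g)"
        "integrable M (\<lambda>x. cnj (u (g + h) x))"
        by (intro bounded_measurable_integrable fin bm ub)+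
      have "(\<integral>x. v g x * cnj (v (g + h) x) \<partial>M) = (\<integral>x. u g x * cnj (u (g + h) x) -
          cnj c * u g x - c * cnj (u (g + h) x) + c * cnj c \<partial>M)"
        by (intro Bochner_Integration.integral_cong refl) (simp add: v_def algebra_simps)
      also have "\<dots> = (\<integral>x. u g x * cnj (u (g + h) x) \<partial>M) -
        (\<integral>x. cnj c * u g x \<partial>M) - (\<integral>x. c * cnj (u (g + h) x) \<partial>M) + (\<integral>x. c * cnj c \<partial>M)"
        by (subst Bochner_Integration.integral_add Bochner_Integration.integral_diff,
            (intro bounded_measurable_integrable fin bm ub)+)+ simp
      finally show ?thesis by (simp add: prob_space)
    qed
    moreover have "folner_average F n (\<lambda>g. z) = z" for n z
      using folner_sequence_card_pos[OF F, of n] by (simp add: folner_average_def)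
    ultimately have "folner_average F n (\<lambda>g. \<integral>x. v g x * cnj (v (g + h) x) \<partial>M) =
        folner_average F n (\<lambda>g. \<integral>x. u g x * cnj (u (g + h) x) \<partial>M) -
        cnj c * folner_average F n (\<lambda>g. \<integral>x. u g x \<partial>M) -
        c * folner_average F n (\<lambda>g. \<integral>x. cnj (u (g + h) x) \<partial>M) + c * cnj c" for n
      by (simp only: folner_average_linear)
    moreover have "(\<lambda>n. folner_average F n (\<lambda>g. \<integral>x. u g x * cnj (u (g + h) x) \<partial>M) -
        cnj c * folner_average F n (\<lambda>g. \<integral>x. u g x \<partial>M) -
        c * folner_average F n (\<lambda>g. \<integral>x. cnj (u (g + h) x) \<partial>M) + c * cnj c)
        \<longlonglongrightarrow> c * cnj c - cnj c * c - c * cnj c + c * cnj c"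
      by (intro tendsto_add tendsto_diff tendsto_mult tendsto_const int je1 je2 je3 h bm ub)
    ultimately show ?thesis by (simp add: mult.commute)
  qed
  define m where "m = (\<integral>x. f 0 x \<partial>M)"
  define f1 where "f1 x = f 0 x - m" for x
  have f1b: "f1 \<in> bounded_measurable M" unfolding f1_def by (intro bm)
  have f10: "(\<integral>x. f1 x \<partial>M) = 0"
    unfolding f1_def
    by (subst Bochner_Integration.integral_diff)
       (auto intro!: bounded_measurable_integrable fin f simp: m_def prob_space)
  have lim1: "(\<lambda>n. sqnorm M (\<lambda>x. folner_average F n (\<lambda>g. koopman T g f1 x * v g x))) \<longlonglongrightarrow> 0"
    by (rule singular_average_tendsto_0[OF T sing F f1b f10 vb vK dec])
  obtain \<sigma> where "spectral_measure M T f1 \<sigma>"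
    using sing f10 bounded_measurable_L2_fun[OF prob_space_axioms f1b]
    unfolding singular_spectrum_def maximal_spectral_type_def dominates_spectrum_def by blast
  then have "spectral_measure M T (\<lambda>x. f 0 x - m) \<sigma>" by (simp only: f1_def[abs_def])
  from mean_ergodic_folner[OF T F f this] obtain e where e: "e \<in> bounded_measurable M"
    "AE x in M. complex_cond_exp M (invariant_algebra M T) (f 0) x = e x"
    "(\<lambda>n. sqnorm M (\<lambda>x. folner_average F n (\<lambda>g. koopman T g (f 0) x) - e x)) \<longlonglongrightarrow> 0"
    by blast
  have e': "AE x in M. e x = complex_cond_exp M (invariant_algebra M T) (f 0) x"
    using e(2) by eventually_elim simp
  \<comment> \<open>Pointwise, \<open>koopman T g (f 0) * u g\<close> equals
    \<open>koopman T g f1 * v g + m * u g + c * (koopman T g (f 0) - m)\<close>. The averages of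
    these terms are settled by singularity, joint ergodicity and the mean ergodic theorem
    respectively.\<close>
  have split: "folner_average F n (\<lambda>g. koopman T g (f 0) x * u g x) - e x * c =
      folner_average F n (\<lambda>g. koopman T g f1 x * v g x) + m * (folner_average F n (\<lambda>g. u g x) - c) +
      c * (folner_average F n (\<lambda>g. koopman T g (f 0) x) - e x)" for n x
  proof -
    have "koopman T g (f 0) x * u g x =
        koopman T g f1 x * v g x + m * u g x + (c * koopman T g (f 0) x - m * c)" for g
      by (simp add: f1_def v_def koopman_def algebra_simps)
    moreover have "folner_average F n (\<lambda>g. m * c) = m * c"
      using folner_sequence_card_pos[OF F, of n] by (simp add: folner_average_def)
    ultimately show ?thesis
      by (simp only: folner_average_linear) (simp add: algebra_simps)
  qed
  have "(\<lambda>n. sqnorm M (\<lambda>x. folner_average F n (\<lambda>g. koopman T g (f 0) x * u g x) - e x * c)) \<longlonglongrightarrow> 0"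
    unfolding split
    by (intro sqnorm_tendsto_add sqnorm_tendsto_cmult fin lim1 je2 e(3) bm ub vb f1b e(1))
  then have "L2_tendsto M (\<lambda>n x. folner_average F n (\<lambda>g. koopman T g (f 0) x * u g x)) (\<lambda>x. e x * c)"
    by (subst L2_tendsto_iff_sqnorm) (auto intro!: fin bm ub e(1))
  then show ?thesis
    unfolding c_def[symmetric] u_def[symmetric] folner_average_def
    by (rule L2_tendsto_cong_AE[THEN iffD1, rotated 2]) (use e' in auto)
qed

section \<open>Passage to essentially bounded functions and the two cases of the theorem\<close>

lemma Linf_fun_bounded_version:
  assumes "Linf_fun M f"
  obtains f' where "f' \<in> bounded_measurable M" "AE x in M. f x = f' x"
proof -
  obtain C where f: "f \<in> borel_measurable M" and C: "AE x in M. cmod (f x) \<le> C"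
    using assms by (auto simp: Linf_fun_def)
  show ?thesis
  proof
    show "(\<lambda>x. if cmod (f x) \<le> C then f x else 0) \<in> bounded_measurable M"
      using f by (intro bounded_measurableI[of _ _ "max C 0"]) (auto simp: le_max_iff_disj)
    show "AE x in M. f x = (if cmod (f x) \<le> C then f x else 0)"
      using C by eventually_elim simp
  qed
qed

lemma complex_cond_exp_cong_AE:
  assumes M: "prob_space M" and sub: "subalgebra M N"
    and "f \<in> borel_measurable M" "f' \<in> borel_measurable M" "AE x in M. f x = f' x"
  shows "AE x in M. complex_cond_exp M N f x = complex_cond_exp M N f' x"
proof -
  interpret prob_space M by fact
  interpret finite_measure_subalgebra M N by unfold_locales (rule sub)
  have "AE x in M. real_cond_exp M N (\<lambda>x. Re (f x)) x = real_cond_exp M N (\<lambda>x. Re (f' x)) x"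
    "AE x in M. real_cond_exp M N (\<lambda>x. Im (f x)) x = real_cond_exp M N (\<lambda>x. Im (f' x)) x"
    by (rule real_cond_exp_cong; use assms(3-5) in \<open>auto elim: eventually_mono\<close>)+
  then show ?thesis by eventually_elim (simp add: complex_cond_exp_def)
qed

text \<open>Joint ergodicity is assumed just for the system formed by \<open>M\<close> and
  \<open>S\<close>, so the ergodic and the totally ergodic case share this statement.\<close>

lemma singular_jointly_ergodic:
  fixes F :: "nat \<Rightarrow> 'g::{ab_group_add, countable} set"
  assumes inf: "infinite (UNIV :: 'g set)" and F: "folner_sequence F"
    and T: "mp_system M T" and S: "mp_system M S" and sing: "singular_spectrum M T"
    and f: "\<And>j. j \<le> l \<Longrightarrow> Linf_fun M (f j)"
    and je: "\<And>h. h \<noteq> 0 \<Longrightarrow> jointly_ergodic_for F (2 * l) (shifted_family l a h) M S"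
  shows "L2_tendsto M
        (\<lambda>N x. (\<Sum>g\<in>F N. koopman T g (f 0) x * (\<Prod>j=1..l. koopman S (a j g) (f j) x))
                 / of_nat (card (F N)))
        (\<lambda>x. complex_cond_exp M (invariant_algebra M T) (f 0) x * (\<Prod>j=1..l. \<integral>y. f j y \<partial>M))"
proof -
  have "\<exists>f'. f' \<in> bounded_measurable M \<and> (j \<le> l \<longrightarrow> (AE x in M. f j x = f' x))" for j
  proof (cases "j \<le> l")
    case True
    then show ?thesis using Linf_fun_bounded_version[OF f[OF True]] by metis
  qed (use bounded_measurable_const in blast)
  then obtain f' where f': "\<And>j. f' j \<in> bounded_measurable M"
    "\<And>j. j \<le> l \<Longrightarrow> AE x in M. f j x = f' j x" by metis
  have fm: "f j \<in> borel_measurable M" if "j \<le> l" for j using f[OF that] by (simp add: Linf_fun_def)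
  note f'm = bounded_measurable_measurable[OF f'(1)]
  have int: "(\<Prod>j=1..l. \<integral>y. f j y \<partial>M) = (\<Prod>j=1..l. \<integral>y. f' j y \<partial>M)"
    by (intro prod.cong refl integral_cong_AE fm f'm f'(2)) auto
  have ce: "AE x in M. complex_cond_exp M (invariant_algebra M T) (f 0) x =
      complex_cond_exp M (invariant_algebra M T) (f' 0) x"
    by (intro complex_cond_exp_cong_AE mp_systemD(1)[OF T] subalgebra_invariant_algebra T fm f'm f'(2)) simp_all
  \<comment> \<open>Countability of the group lets one null set serve all translates at
    once.\<close>
  have T0: "AE x in M. \<forall>g. f 0 (T (- g) x) = f' 0 (T (- g) x)"
    unfolding AE_all_countable using mp_system_AE[OF T f'(2)[of 0]] by simp
  have "AE x in M. \<forall>j\<in>{1..l}. \<forall>g. f j (S (- g) x) = f' j (S (- g) x)"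
    by (intro AE_finite_allI) (auto simp: AE_all_countable intro: mp_system_AE[OF S f'(2)])
  with T0 have eq: "AE x in M. (\<Sum>g\<in>F N. koopman T g (f 0) x * (\<Prod>j=1..l. koopman S (a j g) (f j) x))
        / of_nat (card (F N)) =
      (\<Sum>g\<in>F N. koopman T g (f' 0) x * (\<Prod>j=1..l. koopman S (a j g) (f' j) x)) / of_nat (card (F N))" for N
    by eventually_elim (simp add: koopman_def)
  show ?thesis
    by (rule L2_tendsto_cong_AE[THEN iffD2, OF _ _ singular_jointly_ergodic_bounded
          [where f = f', OF inf F T S sing f'(1) je]])
       (use eq ce in \<open>auto simp: int simp del: One_nat_def elim: eventually_mono\<close>)
qed

theorem theorem1p9:
  fixes F :: "nat \<Rightarrow> 'g::{ab_group_add, countable} set"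
    and l :: nat
    and a :: "nat \<Rightarrow> 'g \<Rightarrow> 'g"
    and M :: "'x measure"
    and T S :: "'g \<Rightarrow> 'x \<Rightarrow> 'x"
    and f :: "nat \<Rightarrow> 'x \<Rightarrow> complex"
  assumes "infinite (UNIV :: 'g set)"
    and "folner_sequence F"
    and "1 \<le> l"
    and "mp_system M T"
    and "mp_system M S"
    and "singular_spectrum M T"
    and "\<forall>j\<in>{0..l}. Linf_fun M (f j)"
  shows
    "((\<forall>h. h \<noteq> 0 \<longrightarrow> jointly_ergodic F (2 * l) (shifted_family l a h)) \<and> ergodic M S \<longrightarrow>
      L2_tendsto M
        (\<lambda>N x. (\<Sum>g\<in>F N. koopman T g (f 0) x * (\<Prod>j=1..l. koopman S (a j g) (f j) x))
                 / of_nat (card (F N)))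
        (\<lambda>x. complex_cond_exp M (invariant_algebra M T) (f 0) x * (\<Prod>j=1..l. \<integral>y. f j y \<partial>M)))
     \<and>
     ((\<forall>h. h \<noteq> 0 \<longrightarrow> jointly_ergodic_totally F (2 * l) (shifted_family l a h)) \<and>
        totally_ergodic M S \<longrightarrow>
      L2_tendsto M
        (\<lambda>N x. (\<Sum>g\<in>F N. koopman T g (f 0) x * (\<Prod>j=1..l. koopman S (a j g) (f j) x))
                 / of_nat (card (F N)))
        (\<lambda>x. complex_cond_exp M (invariant_algebra M T) (f 0) x * (\<Prod>j=1..l. \<integral>y. f j y \<partial>M)))"
proof (intro conjI impI; elim conjE)
  have f: "Linf_fun M (f j)" if "j \<le> l" for j using assms(7) that by simp
  \<comment> \<open>The two halves differ only in how joint ergodicity is transferred to the given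
    system.\<close>
  note main = singular_jointly_ergodic[where f = f and l = l and a = a, OF assms(1,2,4,5,6) f]
  {
    assume "\<forall>h. h \<noteq> 0 \<longrightarrow> jointly_ergodic F (2 * l) (shifted_family l a h)" "ergodic M S"
    then have "jointly_ergodic_for F (2 * l) (shifted_family l a h) M S" if "h \<noteq> 0" for h
      using jointly_ergodic_standard[OF assms(5)] that by blast
    then show "L2_tendsto M
        (\<lambda>N x. (\<Sum>g\<in>F N. koopman T g (f 0) x * (\<Prod>j=1..l. koopman S (a j g) (f j) x))
                 / of_nat (card (F N)))
        (\<lambda>x. complex_cond_exp M (invariant_algebra M T) (f 0) x * (\<Prod>j=1..l. \<integral>y. f j y \<partial>M))"
      by (intro main)
  }
  {
    assume "\<forall>h. h \<noteq> 0 \<longrightarrow> jointly_ergodic_totally F (2 * l) (shifted_family l a h)"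
      "totally_ergodic M S"
    then have "jointly_ergodic_for F (2 * l) (shifted_family l a h) M S" if "h \<noteq> 0" for h
      using jointly_ergodic_totally_standard[OF assms(5)] that by blast
    then show "L2_tendsto M
        (\<lambda>N x. (\<Sum>g\<in>F N. koopman T g (f 0) x * (\<Prod>j=1..l. koopman S (a j g) (f j) x))
                 / of_nat (card (F N)))
        (\<lambda>x. complex_cond_exp M (invariant_algebra M T) (f 0) x * (\<Prod>j=1..l. \<integral>y. f j y \<partial>M))"
      by (intro main)
  }
qed

end
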